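(* In the setting described in the context, there is a graded Poisson structure on $\mathrm H^\bullet(\mathfrak g,\mathcal C^\infty(Z))$: if $[a],[b]$ are the cohomology classes of cocycles $a,b\in C^\bullet(\mathfrak g,\mathcal C^\infty(Z))$, the bracket is given by $$\{[a],[b]\}:=[\operatorname{res}\{\Phi(a),\Phi(b)\}].$$ The restriction of this bracket to $\mathrm H^0(\mathfrak g,\mathcal C^\infty(Z))=\mathcal C^\infty(Z)^{\mathfrak g}$ coincides with the Dirac reduced Poisson structure.
   Context: $\mathbb K=\mathbb R$ or $\mathbb C$. $M$ is a symplectic manifold with a Hamiltonian action of a compact connected Lie group $G$ with Lie algebra $\mathfrak g$ and equivariant moment map $J:M\to\mathfrak g^*$; $e_1,\dots,e_\ell$ is a basis of $\mathfrak g$ with structure constants $f_{ab}^c$, $J_a=\langle J,e_a\rangle$, $\{J_a,J_b\}=\sum_cf_{ab}^cJ_c$. Let $Z=J^{-1}(0)$, $I_Z$ the ideal of smooth functions vanishing on $Z$, $\mathcal C^\infty(Z)=\mathcal C^\infty(M)/I_Z$. Standing assumption: the Koszul complex $K_\bullet=\mathcal C^\infty(M)\otimes\wedge^\bullet\mathfrak g$ with $\mathcal C^\infty(M)$-linear superderivation $\partial e_a=J_a$ is a free resolution of the $\mathcal C^\infty(M)$-module $\mathcal C^\infty(Z)$. The BRST algebra is $\mathscr A=\mathcal C^\infty(M)\otimes\wedge(\mathfrak g^*\oplus\mathfrak g)$, supercommutative, generated over $\mathcal C^\infty(M)$ by ghosts $\xi^a$ (degree $1$) and antighosts $\xi_a$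 (degree $-1$). It carries the even graded Poisson bracket $\{fv,gw\}=\{f,g\}vw+fg\{v,w\}$ ($f,g\in\mathcal C^\infty(M)$, $v,w\in\wedge(\mathfrak g^*\oplus\mathfrak g)$), where on $\wedge(\mathfrak g^*\oplus\mathfrak g)$ one uses the even super-Poisson bracket with $\{\xi_a,\xi^b\}=2\delta_a^b$, $\{\xi_a,\xi_b\}=0=\{\xi^a,\xi^b\}$. Put $\theta=-\frac14\sum f_{ab}^c\xi^a\xi^b\xi_c+\sum_aJ_a\xi^a$ and $\mathscr D=\{\theta,\cdot\}$, $\mathscr D^2=0$. $\operatorname{res}:\mathscr A^\bullet\to C^\bullet(\mathfrak g,\mathcal C^\infty(Z))=\wedge^\bullet\mathfrak g^*\otimes\mathcal C^\infty(Z)$ restricts coefficients to $Z$ and is zero on terms containing antighosts; $d$ is the Lie algebra cohomology differential for the $\mathfrak g$-action on $\mathcal C^\infty(Z)$ induced by $X\mapsto\{J(X),\cdot\}$. $\Phi:C^\bullet(\mathfrak g,\mathcal C^\infty(Z))\to\mathscr A^\bullet$ and $H:\mathscr A^\bullet\to\mathscr A^{\bullet-1}$ are continuous linear maps such that $\operatorname{res},\Phi$ are chain maps, $\operatorname{res}\Phi=\operatorname{id}$, $\operatorname{id}-\Phi\operatorname{res}=\mathscr DH+H\mathscr D$. The Dirac reduced Poisson structure on $\mathcal C^\infty(Z)^{\mathfrak g}$ is $\{\operatorname{res}F,\operatorname{res}G\}=\operatorname{res}\{F,G\}$ for $F,G\in\mathcal C^\infty(M)$ with $\operatorname{res}F,\operatorname{res}G\in\mathcal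 C^\infty(Z)^{\mathfrak g}$. *)

theory Defs
  imports
    "HOL-Analysis.Analysis"
    "HOL-Algebra.Module"
    "HOL-Algebra.Group_Action"
    "HOL-Library.Function_Algebras"
begin

section \<open>Smooth manifolds\<close>

primrec iter_deriv ::
  "'a::real_normed_vector list \<Rightarrow> ('a \<Rightarrow> 'b::real_normed_vector) \<Rightarrow> 'a \<Rightarrow> 'b" where
  "iter_deriv [] f = f"
| "iter_deriv (v # vs) f = iter_deriv vs (\<lambda>x. frechet_derivative f (at x) v)"

text \<open>For open \<open>U\<close>: \<open>f\<close> is \<open>C\<^sup>\<infinity>\<close> on \<open>U\<close>.\<close>

definition smooth_on ::
  "'a::real_normed_vector set \<Rightarrow> ('a \<Rightarrow> 'b::real_normed_vector) \<Rightarrow> bool" where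
  "smooth_on U f \<longleftrightarrow> (\<forall>vs. \<forall>x\<in>U. iter_deriv vs f differentiable (at x))"

type_synonym ('m, 'e) atlas = "('m set \<times> ('m \<Rightarrow> 'e)) set"

text \<open>
  The manifold is the whole type \<open>'m\<close>, Hausdorff and second countable. The model space is an
  arbitrary finite-dimensional real normed space, so that dimension 0 is included (a type of class
  \<open>euclidean_space\<close> has positive dimension).
\<close>

locale smooth_manifold =
  fixes A :: "('m::{t2_space,second_countable_topology}, 'e::real_normed_vector) atlas"
  assumes finite_dim: "\<exists>B::'e set. finite B \<and> span B = UNIV"
    and open_domain: "(U, \<phi>) \<in> A \<Longrightarrow> open U"
    and open_image: "(U, \<phi>) \<in> A \<Longrightarrow> open (\<phi> ` U)"
    and homeo: "(U, \<phi>) \<in> A \<Longrightarrow> homeomorphism U (\<phi> ` U) \<phi> (inv_into U \<phi>)"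
    and cover: "(\<Union>(U, \<phi>)\<in>A. U) = UNIV"
    and compatible: "(U, \<phi>) \<in> A \<Longrightarrow> (V, \<psi>) \<in> A \<Longrightarrow>
      smooth_on (\<phi> ` (U \<inter> V)) (\<psi> \<circ> inv_into U \<phi>)"

definition Cinf ::
  "('m, 'e::real_normed_vector) atlas \<Rightarrow> ('m \<Rightarrow> 'k::real_normed_vector) set" where
  "Cinf A = {f. \<forall>(U, \<phi>)\<in>A. smooth_on (\<phi> ` U) (f \<circ> inv_into U \<phi>)}"

definition smooth_map ::
  "('m::topological_space, 'e::real_normed_vector) atlas \<Rightarrow>
   ('n::topological_space, 'f::real_normed_vector) atlas \<Rightarrow> ('m \<Rightarrow> 'n) \<Rightarrow> bool" where
  "smooth_map A B F \<longleftrightarrow> continuous_on UNIV F \<and>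
    (\<forall>(U, \<phi>)\<in>A. \<forall>(V, \<psi>)\<in>B. smooth_on (\<phi> ` (U \<inter> F -` V)) (\<psi> \<circ> F \<circ> inv_into U \<phi>))"

definition prod_atlas ::
  "('m, 'e) atlas \<Rightarrow> ('n, 'f) atlas \<Rightarrow> ('m \<times> 'n, 'e \<times> 'f) atlas" where
  "prod_atlas A B = {(U \<times> V, map_prod \<phi> \<psi>) | U \<phi> V \<psi>. (U, \<phi>) \<in> A \<and> (V, \<psi>) \<in> B}"

text \<open>
  Vector fields are the derivations of the algebra of smooth \<open>'k\<close>-valued functions. They are
  extended by 0 to non-smooth functions, so that equality of vector fields is equality in HOL.
  A type of class \<open>real_normed_field\<close> is isomorphic to the real or to the complex numbers
  (Gelfand--Mazur); for complex \<open>'k\<close> these are the sections of the complexified tangent bundle.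
\<close>

definition vector_fields ::
  "('m, 'e::real_normed_vector) atlas \<Rightarrow> (('m \<Rightarrow> 'k::real_normed_field) \<Rightarrow> 'm \<Rightarrow> 'k) set" where
  "vector_fields A = {X.
     (\<forall>f. f \<notin> Cinf A \<longrightarrow> X f = 0) \<and>
     (\<forall>f\<in>Cinf A. X f \<in> Cinf A) \<and>
     (\<forall>f\<in>Cinf A. \<forall>g\<in>Cinf A. X (f + g) = X f + X g) \<and>
     (\<forall>c. \<forall>f\<in>Cinf A. X (\<lambda>p. c * f p) = (\<lambda>p. c * X f p)) \<and>
     (\<forall>f\<in>Cinf A. \<forall>g\<in>Cinf A. X (f * g) = X f * g + f * X g)}"

definition real_vector_fields ::
  "('m, 'e::real_normed_vector) atlas \<Rightarrow> (('m \<Rightarrow> 'k::real_normed_field) \<Rightarrow> 'm \<Rightarrow> 'k) set" where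
  "real_vector_fields A =
    {X \<in> vector_fields A. \<forall>f\<in>Cinf A. range f \<subseteq> \<real> \<longrightarrow> range (X f) \<subseteq> \<real>}"

definition lie_bracket ::
  "(('m \<Rightarrow> 'k) \<Rightarrow> 'm \<Rightarrow> 'k::real_normed_field) \<Rightarrow> (('m \<Rightarrow> 'k) \<Rightarrow> 'm \<Rightarrow> 'k) \<Rightarrow> ('m \<Rightarrow> 'k) \<Rightarrow> 'm \<Rightarrow> 'k" where
  "lie_bracket X Y = (\<lambda>f. X (Y f) - Y (X f))"

section \<open>Symplectic manifolds\<close>

text \<open>
  A differential form is an alternating \<open>C\<^sup>\<infinity>\<close>-multilinear form on vector fields. By the assumption
  \<open>real_form\<close>, \<open>\<omega>\<close> is the \<open>'k\<close>-linear extension of a real 2-form. Nondegeneracy says that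
  \<open>X \<mapsto> \<omega>(X, -)\<close> is an isomorphism from vector fields onto 1-forms.
\<close>

locale symplectic_manifold = smooth_manifold A
  for A :: "('m::{t2_space,second_countable_topology}, 'e::real_normed_vector) atlas" +
  fixes \<omega> :: "(('m \<Rightarrow> 'k::real_normed_field) \<Rightarrow> 'm \<Rightarrow> 'k) \<Rightarrow> (('m \<Rightarrow> 'k) \<Rightarrow> 'm \<Rightarrow> 'k) \<Rightarrow> 'm \<Rightarrow> 'k"
  assumes form_closed: "X \<in> vector_fields A \<Longrightarrow> Y \<in> vector_fields A \<Longrightarrow> \<omega> X Y \<in> Cinf A"
    and form_add: "X \<in> vector_fields A \<Longrightarrow> Y \<in> vector_fields A \<Longrightarrow> W \<in> vector_fields A \<Longrightarrow>
      \<omega> (X + Y) W = \<omega> X W + \<omega> Y W"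
    and form_mult: "f \<in> Cinf A \<Longrightarrow> X \<in> vector_fields A \<Longrightarrow> Y \<in> vector_fields A \<Longrightarrow>
      \<omega> (\<lambda>h. f * X h) Y = f * \<omega> X Y"
    and form_antisym: "X \<in> vector_fields A \<Longrightarrow> Y \<in> vector_fields A \<Longrightarrow> \<omega> X Y = - \<omega> Y X"
    and real_form: "X \<in> real_vector_fields A \<Longrightarrow> Y \<in> real_vector_fields A \<Longrightarrow>
      range (\<omega> X Y) \<subseteq> \<real>"
    and closed_form: "X \<in> vector_fields A \<Longrightarrow> Y \<in> vector_fields A \<Longrightarrow> W \<in> vector_fields A \<Longrightarrow>
      X (\<omega> Y W) - Y (\<omega> X W) + W (\<omega> X Y)
      - \<omega> (lie_bracket X Y) W + \<omega> (lie_bracket X W) Y - \<omega> (lie_bracket Y W) X = 0"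
    and nondegenerate_inj: "X \<in> vector_fields A \<Longrightarrow> (\<And>Y. Y \<in> vector_fields A \<Longrightarrow> \<omega> X Y = 0) \<Longrightarrow> X = 0"
    and nondegenerate_surj: "(\<And>X. X \<in> vector_fields A \<Longrightarrow> \<alpha> X \<in> Cinf A) \<Longrightarrow>
      (\<And>X Y. X \<in> vector_fields A \<Longrightarrow> Y \<in> vector_fields A \<Longrightarrow> \<alpha> (X + Y) = \<alpha> X + \<alpha> Y) \<Longrightarrow>
      (\<And>f X. f \<in> Cinf A \<Longrightarrow> X \<in> vector_fields A \<Longrightarrow> \<alpha> (\<lambda>h. f * X h) = f * \<alpha> X) \<Longrightarrow>
      \<exists>X\<in>vector_fields A. \<forall>Y\<in>vector_fields A. \<omega> X Y = \<alpha> Y"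

text \<open>
  Sign convention: \<open>\<omega>(X\<^sub>f, -) = - df\<close> and \<open>{f, g} = X\<^sub>f g = \<omega>(X\<^sub>f, X\<^sub>g)\<close>. The opposite
  convention amounts to replacing \<open>\<omega>\<close> by \<open>- \<omega>\<close> and a moment map \<open>J\<close> by \<open>- J\<close>.
\<close>

definition hamiltonian_field ::
  "('m, 'e::real_normed_vector) atlas \<Rightarrow>
   ((('m \<Rightarrow> 'k::real_normed_field) \<Rightarrow> 'm \<Rightarrow> 'k) \<Rightarrow> (('m \<Rightarrow> 'k) \<Rightarrow> 'm \<Rightarrow> 'k) \<Rightarrow> 'm \<Rightarrow> 'k) \<Rightarrow>
   ('m \<Rightarrow> 'k) \<Rightarrow> ('m \<Rightarrow> 'k) \<Rightarrow> 'm \<Rightarrow> 'k" where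
  "hamiltonian_field A \<omega> f =
    (THE X. X \<in> vector_fields A \<and> (\<forall>Y\<in>vector_fields A. \<omega> X Y = - Y f))"

definition symplectic_bracket ::
  "('m, 'e::real_normed_vector) atlas \<Rightarrow>
   ((('m \<Rightarrow> 'k::real_normed_field) \<Rightarrow> 'm \<Rightarrow> 'k) \<Rightarrow> (('m \<Rightarrow> 'k) \<Rightarrow> 'm \<Rightarrow> 'k) \<Rightarrow> 'm \<Rightarrow> 'k) \<Rightarrow>
   ('m \<Rightarrow> 'k) \<Rightarrow> ('m \<Rightarrow> 'k) \<Rightarrow> 'm \<Rightarrow> 'k" where
  "symplectic_bracket A \<omega> f g = hamiltonian_field A \<omega> f g"

section \<open>Lie groups and Hamiltonian actions\<close>

locale lie_group = Group.group G + smooth_manifold A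
  for G :: "'g::{t2_space,second_countable_topology} monoid" (structure)
    and A :: "('g, 'h::real_normed_vector) atlas" +
  assumes carrier_UNIV: "carrier G = UNIV"
    and smooth_mult: "smooth_map (prod_atlas A A) A (\<lambda>(x, y). x \<otimes> y)"
    and smooth_inv: "smooth_map A A (\<lambda>x. inv x)"

text \<open>The Lie algebra: left-invariant real vector fields, with \<^const>\<open>lie_bracket\<close>.\<close>

definition lie_algebra ::
  "'g monoid \<Rightarrow> ('g, 'h::real_normed_vector) atlas \<Rightarrow> (('g \<Rightarrow> real) \<Rightarrow> 'g \<Rightarrow> real) set" where
  "lie_algebra G A = {X \<in> vector_fields A.
     \<forall>f\<in>Cinf A. \<forall>g. X (\<lambda>x. f (g \<otimes>\<^bsub>G\<^esub> x)) = (\<lambda>x. X f (g \<otimes>\<^bsub>G\<^esub> x))}"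

text \<open>
  The left-invariant field whose value at the unit is the image of the value of \<open>X\<close> at the unit
  under the differential of conjugation by \<open>g\<close>.
\<close>

definition Ad :: "'g monoid \<Rightarrow> 'g \<Rightarrow> (('g \<Rightarrow> real) \<Rightarrow> 'g \<Rightarrow> real) \<Rightarrow> ('g \<Rightarrow> real) \<Rightarrow> 'g \<Rightarrow> real" where
  "Ad G g X = (\<lambda>f x. X (\<lambda>h. f (x \<otimes>\<^bsub>G\<^esub> (g \<otimes>\<^bsub>G\<^esub> h \<otimes>\<^bsub>G\<^esub> inv\<^bsub>G\<^esub> g))) \<one>\<^bsub>G\<^esub>)"

text \<open>\<open>moment S p X\<close> is the value of \<open>J(p)\<close> on the element \<open>X\<close> of the Lie algebra.\<close>

record ('m, 'e, 'k, 'g, 'h) ham_data =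
  atlas :: "('m, 'e) atlas"
  form :: "(('m \<Rightarrow> 'k) \<Rightarrow> 'm \<Rightarrow> 'k) \<Rightarrow> (('m \<Rightarrow> 'k) \<Rightarrow> 'm \<Rightarrow> 'k) \<Rightarrow> 'm \<Rightarrow> 'k"
  grp :: "'g monoid"
  grp_atlas :: "('g, 'h) atlas"
  act :: "'g \<Rightarrow> 'm \<Rightarrow> 'm"
  moment :: "'m \<Rightarrow> (('g \<Rightarrow> real) \<Rightarrow> 'g \<Rightarrow> real) \<Rightarrow> real"
  lie_dim :: nat
  basis :: "nat \<Rightarrow> ('g \<Rightarrow> real) \<Rightarrow> 'g \<Rightarrow> real"
  struct_const :: "nat \<Rightarrow> nat \<Rightarrow> nat \<Rightarrow> real"

definition smooth_funs ::
  "('m, 'e::real_normed_vector, 'k::real_normed_field, 'g, 'h) ham_data \<Rightarrow> ('m \<Rightarrow> 'k) set" where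
  "smooth_funs S = Cinf (atlas S)"

definition pbr ::
  "('m, 'e::real_normed_vector, 'k::real_normed_field, 'g, 'h) ham_data \<Rightarrow>
   ('m \<Rightarrow> 'k) \<Rightarrow> ('m \<Rightarrow> 'k) \<Rightarrow> 'm \<Rightarrow> 'k" where
  "pbr S = symplectic_bracket (atlas S) (form S)"

definition moment_fun ::
  "('m, 'e, 'k::real_normed_field, 'g, 'h) ham_data \<Rightarrow>
   (('g \<Rightarrow> real) \<Rightarrow> 'g \<Rightarrow> real) \<Rightarrow> 'm \<Rightarrow> 'k" where
  "moment_fun S X = (\<lambda>p. of_real (moment S p X))"

abbreviation mom ::
  "('m, 'e, 'k::real_normed_field, 'g, 'h) ham_data \<Rightarrow> nat \<Rightarrow> 'm \<Rightarrow> 'k" where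
  "mom S a \<equiv> moment_fun S (basis S a)"

definition push_field ::
  "('m, 'e, 'k, 'g, 'h) ham_data \<Rightarrow> 'g \<Rightarrow> (('m \<Rightarrow> 'k) \<Rightarrow> 'm \<Rightarrow> 'k) \<Rightarrow> ('m \<Rightarrow> 'k) \<Rightarrow> 'm \<Rightarrow> 'k" where
  "push_field S g X = (\<lambda>f p. X (f \<circ> act S g) (act S (inv\<^bsub>grp S\<^esub> g) p))"

text \<open>
  In \<open>moment_map\<close>, the right-hand side is the derivative of \<open>f(exp(-tX)p)\<close> at \<open>t = 0\<close>. With
  this sign, \<open>X \<mapsto> {J(X), -}\<close> is the infinitesimal form of the action of \<open>G\<close> on functions, hence
  a homomorphism of Lie algebras, in accordance with \<open>moment_bracket\<close>.
\<close>

locale hamiltonian_space =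
  fixes S :: "('m::{t2_space,second_countable_topology}, 'e::real_normed_vector,
               'k::real_normed_field,
               'g::{t2_space,second_countable_topology}, 'h::real_normed_vector) ham_data"
  assumes symplectic: "symplectic_manifold (atlas S) (form S)"
    and lie_group: "lie_group (grp S) (grp_atlas S)"
    and compact_group: "compact (UNIV :: 'g set)"
    and connected_group: "connected (UNIV :: 'g set)"
    and action: "group_action (grp S) UNIV (act S)"
    and smooth_action:
      "smooth_map (prod_atlas (grp_atlas S) (atlas S)) (atlas S) (\<lambda>(g, p). act S g p)"
    and symplectic_action:
      "V \<in> vector_fields (atlas S) \<Longrightarrow> W \<in> vector_fields (atlas S) \<Longrightarrow>
       form S (push_field S g V) (push_field S g W) =
         (\<lambda>p. form S V W (act S (inv\<^bsub>grp S\<^esub> g) p))"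
    and moment_add:
      "X \<in> lie_algebra (grp S) (grp_atlas S) \<Longrightarrow> Y \<in> lie_algebra (grp S) (grp_atlas S) \<Longrightarrow>
       moment S p (X + Y) = moment S p X + moment S p Y"
    and moment_scale:
      "X \<in> lie_algebra (grp S) (grp_atlas S) \<Longrightarrow>
       moment S p (\<lambda>f x. c * X f x) = c * moment S p X"
    and moment_smooth:
      "X \<in> lie_algebra (grp S) (grp_atlas S) \<Longrightarrow> (\<lambda>p. moment S p X) \<in> Cinf (atlas S)"
    and moment_map:
      "X \<in> lie_algebra (grp S) (grp_atlas S) \<Longrightarrow> f \<in> Cinf (atlas S) \<Longrightarrow>
       pbr S (moment_fun S X) (\<lambda>p. of_real (f p)) =
         (\<lambda>p. of_real (- X (\<lambda>g. f (act S g p)) \<one>\<^bsub>grp S\<^esub>))"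
    and moment_equivariant:
      "X \<in> lie_algebra (grp S) (grp_atlas S) \<Longrightarrow>
       moment S (act S g p) X = moment S p (Ad (grp S) (inv\<^bsub>grp S\<^esub> g) X)"
    and basis_mem: "a < lie_dim S \<Longrightarrow> basis S a \<in> lie_algebra (grp S) (grp_atlas S)"
    and basis_expansion:
      "X \<in> lie_algebra (grp S) (grp_atlas S) \<Longrightarrow>
       \<exists>!c. (\<forall>a\<ge>lie_dim S. c a = 0) \<and> X = (\<lambda>f x. \<Sum>a<lie_dim S. c a * basis S a f x)"
    and structure_constants:
      "a < lie_dim S \<Longrightarrow> b < lie_dim S \<Longrightarrow>
       lie_bracket (basis S a) (basis S b) =
         (\<lambda>f x. \<Sum>c<lie_dim S. struct_const S a b c * basis S c f x)"
    and moment_bracket: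
      "a < lie_dim S \<Longrightarrow> b < lie_dim S \<Longrightarrow>
       pbr S (mom S a) (mom S b) =
         (\<lambda>p. \<Sum>c<lie_dim S. of_real (struct_const S a b c) * mom S c p)"

section \<open>The zero fibre\<close>

definition zero_fibre ::
  "('m, 'e, 'k, 'g, 'h::real_normed_vector) ham_data \<Rightarrow> 'm set" where
  "zero_fibre S = {p. \<forall>X\<in>lie_algebra (grp S) (grp_atlas S). moment S p X = 0}"

definition vanishing_ideal ::
  "('m, 'e::real_normed_vector, 'k::real_normed_field, 'g, 'h::real_normed_vector) ham_data \<Rightarrow>
   ('m \<Rightarrow> 'k) set" where
  "vanishing_ideal S = {f \<in> smooth_funs S. \<forall>p\<in>zero_fibre S. f p = 0}"

text \<open>
  The class of \<open>f\<close> modulo the vanishing ideal is represented by the restriction of \<open>f\<close> to the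
  zero fibre, which in turn is represented by its extension by 0.
\<close>

definition restr ::
  "('m, 'e, 'k, 'g, 'h::real_normed_vector) ham_data \<Rightarrow> ('m \<Rightarrow> 'k::real_normed_field) \<Rightarrow> 'm \<Rightarrow> 'k" where
  "restr S f = (\<lambda>p. if p \<in> zero_fibre S then f p else 0)"

definition smooth_funs_Z ::
  "('m, 'e::real_normed_vector, 'k::real_normed_field, 'g, 'h::real_normed_vector) ham_data \<Rightarrow>
   ('m \<Rightarrow> 'k) set" where
  "smooth_funs_Z S = restr S ` smooth_funs S"

text \<open>Action of \<open>e\<^sub>a\<close> on functions on the zero fibre, computed on any smooth extension.\<close>

definition act_Z ::
  "('m, 'e::real_normed_vector, 'k::real_normed_field, 'g, 'h::real_normed_vector) ham_data \<Rightarrow>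
   nat \<Rightarrow> ('m \<Rightarrow> 'k) \<Rightarrow> 'm \<Rightarrow> 'k" where
  "act_Z S a u = restr S (pbr S (mom S a) (SOME f. f \<in> smooth_funs S \<and> restr S f = u))"

definition invariants_Z ::
  "('m, 'e::real_normed_vector, 'k::real_normed_field, 'g, 'h::real_normed_vector) ham_data \<Rightarrow>
   ('m \<Rightarrow> 'k) set" where
  "invariants_Z S = {u \<in> smooth_funs_Z S. \<forall>a<lie_dim S. act_Z S a u = 0}"

section \<open>Exterior algebras\<close>

text \<open>
  An element of an exterior algebra with generators \<open>x\<^sub>0, x\<^sub>1, \<dots>\<close> over an algebra of functions is
  the family of its coefficients: \<open>F U\<close> is the coefficient of the product, in increasing order,
  of the \<open>x\<^sub>i\<close> with \<open>i \<in> U\<close>.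
\<close>

type_synonym ('m, 'k) ext = "nat set \<Rightarrow> 'm \<Rightarrow> 'k"

definition ext_over :: "('m \<Rightarrow> 'k::real_normed_field) set \<Rightarrow> nat \<Rightarrow> ('m, 'k) ext set" where
  "ext_over R n = {F. (\<forall>U. F U \<in> R) \<and> (\<forall>U. \<not> U \<subseteq> {..<n} \<longrightarrow> F U = 0)}"

definition gen :: "nat \<Rightarrow> ('m, 'k::real_normed_field) ext" where
  "gen i = (\<lambda>U p. if U = {i} then 1 else 0)"

text \<open>The sign of the permutation sorting the concatenation of \<open>S\<close> and \<open>T\<close>.\<close>

definition shuffle_sign :: "nat set \<Rightarrow> nat set \<Rightarrow> 'k::real_normed_field" where
  "shuffle_sign S T = (-1) ^ card {(s, t). s \<in> S \<and> t \<in> T \<and> t < s}"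

definition wedge ::
  "('m, 'k::real_normed_field) ext \<Rightarrow> ('m, 'k) ext \<Rightarrow> ('m, 'k) ext" (infixl \<open>\<and>\<^sub>e\<close> 70) where
  "F \<and>\<^sub>e G = (\<lambda>U p. \<Sum>T\<in>Pow U. shuffle_sign T (U - T) * F T p * G (U - T) p)"

text \<open>Left and right partial derivatives with respect to the generator \<open>x\<^sub>i\<close>.\<close>

definition lderiv :: "nat \<Rightarrow> ('m, 'k::real_normed_field) ext \<Rightarrow> ('m, 'k) ext" where
  "lderiv i F = (\<lambda>U p. if i \<in> U then 0 else (-1) ^ card {j \<in> U. j < i} * F (insert i U) p)"

definition rderiv :: "nat \<Rightarrow> ('m, 'k::real_normed_field) ext \<Rightarrow> ('m, 'k) ext" where
  "rderiv i F = (\<lambda>U p. if i \<in> U then 0 else (-1) ^ card {j \<in> U. i < j} * F (insert i U) p)"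

section \<open>The Koszul complex\<close>

definition koszul ::
  "('m, 'e::real_normed_vector, 'k::real_normed_field, 'g, 'h) ham_data \<Rightarrow>
   nat \<Rightarrow> ('m, 'k) ext set" where
  "koszul S k = {F \<in> ext_over (smooth_funs S) (lie_dim S). \<forall>U. F U \<noteq> 0 \<longrightarrow> card U = k}"

text \<open>The superderivation with \<open>e\<^sub>a \<mapsto> J\<^sub>a\<close>.\<close>

definition koszul_diff ::
  "('m, 'e, 'k::real_normed_field, 'g, 'h) ham_data \<Rightarrow> ('m, 'k) ext \<Rightarrow> ('m, 'k) ext" where
  "koszul_diff S F = (\<lambda>U p. \<Sum>a<lie_dim S. mom S a p * lderiv a F U p)"

text \<open>
  Exactness of the complex augmented by the restriction to the zero fibre. The modules
  \<^const>\<open>koszul\<close> are free by construction, and the augmentation is onto by definition.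
\<close>

definition koszul_resolution ::
  "('m, 'e::real_normed_vector, 'k::real_normed_field, 'g, 'h::real_normed_vector) ham_data \<Rightarrow>
   bool" where
  "koszul_resolution S \<longleftrightarrow>
     (\<forall>k\<ge>1. \<forall>F\<in>koszul S k. koszul_diff S F = 0 \<longrightarrow> (\<exists>G\<in>koszul S (k + 1). F = koszul_diff S G)) \<and>
     (\<lambda>G. koszul_diff S G {}) ` koszul S 1 = vanishing_ideal S"

section \<open>The BRST algebra\<close>

text \<open>
  With \<open>n = lie_dim S\<close>, the ghost \<open>\<xi>\<^sup>a\<close> is the generator with number \<open>a\<close> and the antighost \<open>\<xi>\<^sub>a\<close> is
  the generator with number \<open>n + a\<close>, for \<open>a < n\<close>.
\<close>

definition brst ::
  "('m, 'e::real_normed_vector, 'k::real_normed_field, 'g, 'h) ham_data \<Rightarrow> ('m, 'k) ext set" where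
  "brst S = ext_over (smooth_funs S) (2 * lie_dim S)"

definition brst_deg ::
  "('m, 'e::real_normed_vector, 'k::real_normed_field, 'g, 'h) ham_data \<Rightarrow>
   int \<Rightarrow> ('m, 'k) ext set" where
  "brst_deg S k = {F \<in> brst S. \<forall>U. F U \<noteq> 0 \<longrightarrow>
     int (card (U \<inter> {..<lie_dim S})) - int (card (U \<inter> {lie_dim S..<2 * lie_dim S})) = k}"

text \<open>
  The even bracket on the exterior algebra which is linear over functions and a graded derivation
  in both arguments, with \<open>{\<xi>\<^sub>a, \<xi>\<^sup>b} = 2 \<delta>\<^sub>a\<^sup>b\<close> and all other brackets of generators 0: it is the sum
  of \<open>(F \<leftarrow>\<partial>/\<partial>x) {x, y} (\<partial>/\<partial>y G)\<close> over all pairs of generators \<open>x, y\<close>.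
\<close>

definition ghost_bracket ::
  "('m, 'e, 'k::real_normed_field, 'g, 'h) ham_data \<Rightarrow>
   ('m, 'k) ext \<Rightarrow> ('m, 'k) ext \<Rightarrow> ('m, 'k) ext" where
  "ghost_bracket S F G = (\<lambda>U p. 2 * (\<Sum>a<lie_dim S.
     (rderiv (lie_dim S + a) F \<and>\<^sub>e lderiv a G) U p + (rderiv a F \<and>\<^sub>e lderiv (lie_dim S + a) G) U p))"

definition brst_bracket ::
  "('m, 'e::real_normed_vector, 'k::real_normed_field, 'g, 'h) ham_data \<Rightarrow>
   ('m, 'k) ext \<Rightarrow> ('m, 'k) ext \<Rightarrow> ('m, 'k) ext" where
  "brst_bracket S F G = (\<lambda>U p.
     (\<Sum>T\<in>Pow U. shuffle_sign T (U - T) * pbr S (F T) (G (U - T)) p) + ghost_bracket S F G U p)"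

definition brst_charge ::
  "('m, 'e, 'k::real_normed_field, 'g, 'h) ham_data \<Rightarrow> ('m, 'k) ext" where
  "brst_charge S = (\<lambda>U p.
     - (1 / 4) * (\<Sum>a<lie_dim S. \<Sum>b<lie_dim S. \<Sum>c<lie_dim S.
        of_real (struct_const S a b c) * (gen a \<and>\<^sub>e gen b \<and>\<^sub>e gen (lie_dim S + c)) U p)
     + (\<Sum>a<lie_dim S. mom S a p * gen a U p))"

definition brst_diff ::
  "('m, 'e::real_normed_vector, 'k::real_normed_field, 'g, 'h) ham_data \<Rightarrow>
   ('m, 'k) ext \<Rightarrow> ('m, 'k) ext" where
  "brst_diff S F = brst_bracket S (brst_charge S) F"

section \<open>Lie algebra cochains with values in the functions on the zero fibre\<close>

definition cochains ::
  "('m, 'e::real_normed_vector, 'k::real_normed_field, 'g, 'h::real_normed_vector) ham_data \<Rightarrow>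
   ('m, 'k) ext set" where
  "cochains S = ext_over (smooth_funs_Z S) (lie_dim S)"

definition cochains_deg ::
  "('m, 'e::real_normed_vector, 'k::real_normed_field, 'g, 'h::real_normed_vector) ham_data \<Rightarrow>
   int \<Rightarrow> ('m, 'k) ext set" where
  "cochains_deg S k = {u \<in> cochains S. \<forall>U. u U \<noteq> 0 \<longrightarrow> int (card U) = k}"

text \<open>
  The Chevalley--Eilenberg differential in the basis \<open>e\<^sub>a\<close>:
  \<open>d = \<Sum>\<^sub>a \<xi>\<^sup>a e\<^sub>a - 1/2 \<Sum>\<^sub>a\<^sub>b\<^sub>c f\<^sub>a\<^sub>b\<^sup>c \<xi>\<^sup>a \<xi>\<^sup>b \<partial>/\<partial>\<xi>\<^sup>c\<close>.
\<close>

definition ce_diff ::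
  "('m, 'e::real_normed_vector, 'k::real_normed_field, 'g, 'h::real_normed_vector) ham_data \<Rightarrow>
   ('m, 'k) ext \<Rightarrow> ('m, 'k) ext" where
  "ce_diff S u = (\<lambda>U p.
     (\<Sum>a<lie_dim S. (gen a \<and>\<^sub>e (\<lambda>T. act_Z S a (u T))) U p)
     - (1 / 2) * (\<Sum>a<lie_dim S. \<Sum>b<lie_dim S. \<Sum>c<lie_dim S.
        of_real (struct_const S a b c) * (gen a \<and>\<^sub>e gen b \<and>\<^sub>e lderiv c u) U p))"

definition res ::
  "('m, 'e, 'k::real_normed_field, 'g, 'h::real_normed_vector) ham_data \<Rightarrow>
   ('m, 'k) ext \<Rightarrow> ('m, 'k) ext" where
  "res S F = (\<lambda>U. if U \<subseteq> {..<lie_dim S} then restr S (F U) else 0)"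

section \<open>Topologies and continuous linear maps\<close>

text \<open>
  Uniform convergence of all derivatives of all coefficients on compact subsets of charts; this is
  the product of finitely many copies of the Frechet space of smooth functions.
\<close>

definition brst_topology ::
  "('m, 'e::real_normed_vector, 'k::real_normed_field, 'g, 'h) ham_data \<Rightarrow>
   ('m, 'k) ext topology" where
  "brst_topology S = topology_generated_by
     {{G \<in> brst S. \<forall>x\<in>K. norm (iter_deriv vs ((G T - F T) \<circ> inv_into U \<phi>) x) < \<epsilon>}
      | F T U \<phi> K vs \<epsilon>. F \<in> brst S \<and> (U, \<phi>) \<in> atlas S \<and> compact K \<and> K \<subseteq> \<phi> ` U \<and> 0 < \<epsilon>}"

text \<open>
  The quotient topology of \<^const>\<open>res\<close>. As \<^const>\<open>res\<close> is a coordinate projection followed by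
  passage to the quotient by the vanishing ideal in each coefficient, this is the product of
  finitely many copies of the quotient topology on functions on the zero fibre.
\<close>

definition cochain_topology ::
  "('m, 'e::real_normed_vector, 'k::real_normed_field, 'g, 'h::real_normed_vector) ham_data \<Rightarrow>
   ('m, 'k) ext topology" where
  "cochain_topology S = topology (\<lambda>W.
     W \<subseteq> cochains S \<and> openin (brst_topology S) {F \<in> brst S. res S F \<in> W})"

lemma openin_cochain_topology:
  "openin (cochain_topology S) W \<longleftrightarrow>
     W \<subseteq> cochains S \<and> openin (brst_topology S) {F \<in> brst S. res S F \<in> W}"
proof -
  have inter: "{F \<in> brst S. res S F \<in> V \<inter> W} =
      {F \<in> brst S. res S F \<in> V} \<inter> {F \<in> brst S. res S F \<in> W}" for V W
    by blast
  have union: "{F \<in> brst S. res S F \<in> \<Union>K} = (\<Union>W\<in>K. {F \<in> brst S. res S F \<in> W})" for K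
    by blast
  have "istopology (\<lambda>W. W \<subseteq> cochains S \<and> openin (brst_topology S) {F \<in> brst S. res S F \<in> W})"
    unfolding istopology_def inter union by blast
  then show ?thesis
    by (simp add: cochain_topology_def)
qed

definition linear_map ::
  "('m, 'k::real_normed_field) ext set \<Rightarrow> ('m, 'k) ext set \<Rightarrow>
   (('m, 'k) ext \<Rightarrow> ('m, 'k) ext) \<Rightarrow> bool" where
  "linear_map V W L \<longleftrightarrow> L ` V \<subseteq> W \<and>
     (\<forall>F\<in>V. \<forall>G\<in>V. L (F + G) = L F + L G) \<and>
     (\<forall>c. \<forall>F\<in>V. L (\<lambda>U p. c * F U p) = (\<lambda>U p. c * L F U p))"

section \<open>Cohomology\<close>

definition cocycles ::
  "('m, 'e::real_normed_vector, 'k::real_normed_field, 'g, 'h::real_normed_vector) ham_data \<Rightarrow>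
   ('m, 'k) ext set" where
  "cocycles S = {a \<in> cochains S. ce_diff S a = 0}"

definition cohomologous ::
  "('m, 'e::real_normed_vector, 'k::real_normed_field, 'g, 'h::real_normed_vector) ham_data \<Rightarrow>
   (('m, 'k) ext \<times> ('m, 'k) ext) set" where
  "cohomologous S = {(a, b). a \<in> cocycles S \<and> b \<in> cocycles S \<and>
     (\<exists>c\<in>cochains S. b = a + ce_diff S c)}"

abbreviation coh_class ::
  "('m, 'e::real_normed_vector, 'k::real_normed_field, 'g, 'h::real_normed_vector) ham_data \<Rightarrow>
   ('m, 'k) ext \<Rightarrow> ('m, 'k) ext set" where
  "coh_class S a \<equiv> cohomologous S `` {a}"

definition cochain0 :: "('m \<Rightarrow> 'k::real_normed_field) \<Rightarrow> ('m, 'k) ext" where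
  "cochain0 u = (\<lambda>U. if U = {} then u else 0)"

definition cohomology ::
  "('m, 'e::real_normed_vector, 'k::real_normed_field, 'g, 'h::real_normed_vector) ham_data \<Rightarrow>
   ('k, ('m, 'k) ext set) module" where
  "cohomology S = \<lparr>
     carrier = cocycles S // cohomologous S,
     mult = (\<lambda>X Y. \<Union>a\<in>X. \<Union>b\<in>Y. coh_class S (a \<and>\<^sub>e b)),
     one = coh_class S (cochain0 (restr S 1)),
     zero = coh_class S 0,
     add = (\<lambda>X Y. \<Union>a\<in>X. \<Union>b\<in>Y. coh_class S (a + b)),
     smult = (\<lambda>c X. \<Union>a\<in>X. coh_class S (\<lambda>U p. c * a U p))\<rparr>"

definition cohomology_deg ::
  "('m, 'e::real_normed_vector, 'k::real_normed_field, 'g, 'h::real_normed_vector) ham_data \<Rightarrow>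
   int \<Rightarrow> ('m, 'k) ext set set" where
  "cohomology_deg S k = coh_class S ` (cocycles S \<inter> cochains_deg S k)"

definition cohomology_bracket ::
  "('m, 'e::real_normed_vector, 'k::real_normed_field, 'g, 'h::real_normed_vector) ham_data \<Rightarrow>
   (('m, 'k) ext \<Rightarrow> ('m, 'k) ext) \<Rightarrow>
   ('m, 'k) ext set \<Rightarrow> ('m, 'k) ext set \<Rightarrow> ('m, 'k) ext set" where
  "cohomology_bracket S \<Phi> X Y =
     (\<Union>a\<in>X. \<Union>b\<in>Y. coh_class S (res S (brst_bracket S (\<Phi> a) (\<Phi> b))))"

section \<open>Graded Poisson algebras\<close>

definition scalar_ring :: "'k::real_normed_field ring" where
  "scalar_ring = \<lparr>carrier = UNIV, mult = (*), one = 1, zero = 0, add = (+)\<rparr>"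

text \<open>\<open>(-1)\<^sup>i\<^sup>j x\<close>\<close>

definition koszul_sign :: "('b, 'c) ring_scheme \<Rightarrow> int \<Rightarrow> int \<Rightarrow> 'b \<Rightarrow> 'b" where
  "koszul_sign M i j x = (if odd i \<and> odd j then \<ominus>\<^bsub>M\<^esub> x else x)"

text \<open>A graded commutative algebra with a graded Poisson bracket of degree 0.\<close>

locale graded_poisson_algebra = Module.module R M + Ring.ring M
  for R :: "('a, 'r) ring_scheme" (structure) and M :: "('a, 'b, 'c) module_scheme" (structure) +
  fixes deg :: "int \<Rightarrow> 'b set"
    and bracket :: "'b \<Rightarrow> 'b \<Rightarrow> 'b"
  assumes smult_mult_left: "c \<in> carrier R \<Longrightarrow> x \<in> carrier M \<Longrightarrow> y \<in> carrier M \<Longrightarrow>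
      (c \<odot>\<^bsub>M\<^esub> x) \<otimes>\<^bsub>M\<^esub> y = c \<odot>\<^bsub>M\<^esub> (x \<otimes>\<^bsub>M\<^esub> y)"
    and smult_mult_right: "c \<in> carrier R \<Longrightarrow> x \<in> carrier M \<Longrightarrow> y \<in> carrier M \<Longrightarrow>
      x \<otimes>\<^bsub>M\<^esub> (c \<odot>\<^bsub>M\<^esub> y) = c \<odot>\<^bsub>M\<^esub> (x \<otimes>\<^bsub>M\<^esub> y)"
    and deg_submodule: "submodule (deg i) R M"
    and deg_direct_sum: "x \<in> carrier M \<Longrightarrow>
      \<exists>!f. (\<forall>i. f i \<in> deg i) \<and> finite {i. f i \<noteq> \<zero>\<^bsub>M\<^esub>} \<and> x = finsum M f {i. f i \<noteq> \<zero>\<^bsub>M\<^esub>}"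
    and one_deg: "\<one>\<^bsub>M\<^esub> \<in> deg 0"
    and mult_deg: "x \<in> deg i \<Longrightarrow> y \<in> deg j \<Longrightarrow> x \<otimes>\<^bsub>M\<^esub> y \<in> deg (i + j)"
    and graded_comm: "x \<in> deg i \<Longrightarrow> y \<in> deg j \<Longrightarrow> x \<otimes>\<^bsub>M\<^esub> y = koszul_sign M i j (y \<otimes>\<^bsub>M\<^esub> x)"
    and bracket_closed: "x \<in> carrier M \<Longrightarrow> y \<in> carrier M \<Longrightarrow> bracket x y \<in> carrier M"
    and bracket_add_left: "x \<in> carrier M \<Longrightarrow> y \<in> carrier M \<Longrightarrow> z \<in> carrier M \<Longrightarrow>
      bracket (x \<oplus>\<^bsub>M\<^esub> y) z = bracket x z \<oplus>\<^bsub>M\<^esub> bracket y z"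
    and bracket_add_right: "x \<in> carrier M \<Longrightarrow> y \<in> carrier M \<Longrightarrow> z \<in> carrier M \<Longrightarrow>
      bracket x (y \<oplus>\<^bsub>M\<^esub> z) = bracket x y \<oplus>\<^bsub>M\<^esub> bracket x z"
    and bracket_smult_left: "c \<in> carrier R \<Longrightarrow> x \<in> carrier M \<Longrightarrow> y \<in> carrier M \<Longrightarrow>
      bracket (c \<odot>\<^bsub>M\<^esub> x) y = c \<odot>\<^bsub>M\<^esub> bracket x y"
    and bracket_smult_right: "c \<in> carrier R \<Longrightarrow> x \<in> carrier M \<Longrightarrow> y \<in> carrier M \<Longrightarrow>
      bracket x (c \<odot>\<^bsub>M\<^esub> y) = c \<odot>\<^bsub>M\<^esub> bracket x y"
    and bracket_deg: "x \<in> deg i \<Longrightarrow> y \<in> deg j \<Longrightarrow> bracket x y \<in> deg (i + j)"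
    and graded_antisym: "x \<in> deg i \<Longrightarrow> y \<in> deg j \<Longrightarrow>
      bracket x y = \<ominus>\<^bsub>M\<^esub> koszul_sign M i j (bracket y x)"
    and graded_leibniz: "x \<in> deg i \<Longrightarrow> y \<in> deg j \<Longrightarrow> z \<in> deg k \<Longrightarrow>
      bracket x (y \<otimes>\<^bsub>M\<^esub> z) = bracket x y \<otimes>\<^bsub>M\<^esub> z \<oplus>\<^bsub>M\<^esub> koszul_sign M i j (y \<otimes>\<^bsub>M\<^esub> bracket x z)"
    and graded_jacobi: "x \<in> deg i \<Longrightarrow> y \<in> deg j \<Longrightarrow> z \<in> deg k \<Longrightarrow>
      bracket x (bracket y z) = bracket (bracket x y) z \<oplus>\<^bsub>M\<^esub> koszul_sign M i j (bracket y (bracket x z))"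

end

theory Submission
  imports Defs
begin

text \<open>
  The BRST algebra \<open>A\<close> is a graded Poisson algebra, and its differential \<open>D = {\<theta>, -}\<close> is bracketing with
  an odd element, hence a graded derivation of the product (by the Leibniz rule) and of the bracket
  (by the Jacobi identity). The restriction \<open>res\<close> is a surjective homomorphism of algebras and a
  chain map, so that the Chevalley--Eilenberg differential \<open>d u = res (D (\<Phi> u))\<close> is a derivation as
  well, and products of cocycles are cocycles.

  The bracket on cohomology is transported along the contraction. Everything rests on one
  consequence of the homotopy formula: if \<open>D F = 0\<close>, then \<open>\<Phi> (res F) = F - D Y\<close> for some \<open>Y\<close>. As \<open>D\<close> is
  a derivation of the bracket, bracketing a \<open>D\<close>-cocycle with \<open>D Y\<close> gives a \<open>D\<close>-exact element, whose
  restriction is \<open>d\<close>-exact. Hence, up to coboundaries, \<open>\<Phi>\<close> may be treated as a homomorphism of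
  algebras, and a composite \<open>\<Phi> \<circ> res\<close> inside an iterated bracket may be dropped. Independence of
  representatives, Leibniz rule and Jacobi identity on cohomology follow from the corresponding facts
  in \<open>A\<close>; antisymmetry even holds before passing to classes.

  That \<open>A\<close> is a graded Poisson algebra is a computation with signs, organised as follows. The
  bracket is the sum of a product of the same shape as the exterior product, with the Poisson bracket
  of functions in place of multiplication of coefficients, and a ghost part made of derivatives with
  respect to the generators. Leibniz rule and antisymmetry are checked for each summand. The defect of
  the Jacobi identity is then a graded derivation in the last argument, so that it only has to vanish
  on functions and on generators; there it says that bracketing with a function and differentiating
  with respect to a generator are derivations of the bracket.

  In degree 0, cocycles are the invariant functions on the zero fibre. The value of the bracket of two
  elements of ghost number 0 at the empty set of generators is the Poisson bracket of their values,
  because such elements have no component with a single generator. Finally the restriction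
  of \<open>{f, g}\<close> to the zero fibre depends only on the restrictions of \<open>f\<close> and \<open>g\<close> if these are
  invariant: the Koszul resolution says that the vanishing ideal is generated by the \<open>J\<^sub>a\<close>, and
  \<open>{J\<^sub>a, g}\<close> vanishes on the zero fibre. This gives the Dirac bracket.
\<close>

section \<open>Smooth functions\<close>

text \<open>
  Smoothness cut off at order \<open>n\<close>. The derivative of \<open>f * g\<close> involves \<open>f\<close> and \<open>g\<close> themselves besides
  their derivatives, so that closure under products is an induction on the order and not
  on the list of directions.
\<close>

definition diff_upto :: "nat \<Rightarrow> 'a::real_normed_vector set \<Rightarrow> ('a \<Rightarrow> 'b::real_normed_vector) \<Rightarrow> bool" where
  "diff_upto n U f \<longleftrightarrow> (\<forall>vs. length vs \<le> n \<longrightarrow> (\<forall>x\<in>U. iter_deriv vs f differentiable (at x)))"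

lemma smooth_on_iff_diff_upto: "smooth_on U f \<longleftrightarrow> (\<forall>n. diff_upto n U f)"
  unfolding smooth_on_def diff_upto_def by blast

lemma frechet_derivative_cong_open:
  assumes "open U" "x \<in> U" "\<And>y. y \<in> U \<Longrightarrow> f y = g y"
  shows "frechet_derivative f (at x) = frechet_derivative g (at x)"
proof -
  have "(f has_derivative D) (at x) \<longleftrightarrow> (g has_derivative D) (at x)" for D
    using has_derivative_transform_within_open[of f D x UNIV U g]
      has_derivative_transform_within_open[of g D x UNIV U f] assms by auto
  then show ?thesis unfolding frechet_derivative_def by simp
qed

lemma frechet_derivative_eqI:
  "(f has_derivative D) (at x) \<Longrightarrow> frechet_derivative f (at x) = D"
  using frechet_derivative_at by metis

text \<open>
  The rules of calculus identify derivatives only at points where the functions are differentiable,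
  that is, on \<open>U\<close>. Openness of \<open>U\<close> makes this enough for differentiating again.
\<close>

lemma iter_deriv_cong_open:
  assumes "open U" "x \<in> U" "\<And>y. y \<in> U \<Longrightarrow> f y = g y"
  shows "iter_deriv vs f x = iter_deriv vs g x"
  using assms
proof (induction vs arbitrary: f g x)
  case (Cons v vs)
  show ?case
    using Cons.IH[OF Cons.prems(1,2), of "\<lambda>x. frechet_derivative f (at x) v"
        "\<lambda>x. frechet_derivative g (at x) v"]
      frechet_derivative_cong_open[OF Cons.prems(1) _ Cons.prems(3)]
    by simp
qed auto

lemma differentiable_cong_open:
  assumes "open U" "x \<in> U" "\<And>y. y \<in> U \<Longrightarrow> f y = g y" "f differentiable (at x)"
  shows "g differentiable (at x)"
  using assms has_derivative_transform_within_open[of f _ x UNIV U g]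
  unfolding differentiable_def by blast

lemma diff_upto_cong:
  assumes "open U" "\<And>y. y \<in> U \<Longrightarrow> f y = g y" "diff_upto n U f"
  shows "diff_upto n U g"
  unfolding diff_upto_def
proof (intro allI impI ballI)
  fix vs :: "'a list" and x assume "length vs \<le> n" "x \<in> U"
  then show "iter_deriv vs g differentiable at x"
    using differentiable_cong_open[OF assms(1) _ iter_deriv_cong_open[OF assms(1) _ assms(2)]] assms(3)
    unfolding diff_upto_def by simp
qed

lemma diff_upto_0: "diff_upto 0 U f \<longleftrightarrow> (\<forall>x\<in>U. f differentiable (at x))"
  by (simp add: diff_upto_def)

lemma diff_upto_Suc:
  "diff_upto (Suc n) U f \<longleftrightarrow>
     (\<forall>x\<in>U. f differentiable (at x)) \<and> (\<forall>v. diff_upto n U (\<lambda>x. frechet_derivative f (at x) v))"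
proof
  assume *: "diff_upto (Suc n) U f"
  show "(\<forall>x\<in>U. f differentiable (at x)) \<and> (\<forall>v. diff_upto n U (\<lambda>x. frechet_derivative f (at x) v))"
    unfolding diff_upto_def
  proof (intro conjI allI impI ballI)
    fix x assume "x \<in> U"
    then show "f differentiable at x" using *[unfolded diff_upto_def, rule_format, of "[]" x] by simp
  next
    fix v vs x assume "length (vs::'a list) \<le> n" "x \<in> U"
    then show "iter_deriv vs (\<lambda>x. frechet_derivative f (at x) v) differentiable at x"
      using *[unfolded diff_upto_def, rule_format, of "v # vs" x] by simp
  qed
next
  assume *: "(\<forall>x\<in>U. f differentiable (at x)) \<and> (\<forall>v. diff_upto n U (\<lambda>x. frechet_derivative f (at x) v))"
  show "diff_upto (Suc n) U f" unfolding diff_upto_def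
  proof (intro allI impI ballI)
    fix vs x assume "length (vs::'a list) \<le> Suc n" "x \<in> U"
    then show "iter_deriv vs f differentiable at x"
      using * by (cases vs) (auto simp: diff_upto_def)
  qed
qed

lemma diff_upto_mono_Suc: "diff_upto (Suc n) U f \<Longrightarrow> diff_upto n U f"
  unfolding diff_upto_def by auto

lemma diff_upto_add:
  assumes "open U"
  shows "diff_upto n U f \<Longrightarrow> diff_upto n U g \<Longrightarrow> diff_upto n U (\<lambda>x. f x + g x)"
proof (induction n arbitrary: f g)
  case (Suc n)
  have "diff_upto n U (\<lambda>x. frechet_derivative (\<lambda>x. f x + g x) (at x) v)" for v
  proof (rule diff_upto_cong[OF assms])
    show "diff_upto n U (\<lambda>x. frechet_derivative f (at x) v + frechet_derivative g (at x) v)"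
      using Suc by (auto simp: diff_upto_Suc)
    fix y assume "y \<in> U"
    then show "frechet_derivative f (at y) v + frechet_derivative g (at y) v =
        frechet_derivative (\<lambda>x. f x + g x) (at y) v"
      using Suc.prems frechet_derivative_eqI[OF has_derivative_add[OF
          frechet_derivative_works[THEN iffD1, of f] frechet_derivative_works[THEN iffD1, of g]]]
      by (simp add: diff_upto_Suc)
  qed
  then show ?case using Suc.prems by (auto simp: diff_upto_Suc)
qed (auto simp: diff_upto_0)

lemma diff_upto_mult:
  fixes f g :: "'a::real_normed_vector \<Rightarrow> 'b::real_normed_algebra"
  assumes "open U"
  shows "diff_upto n U f \<Longrightarrow> diff_upto n U g \<Longrightarrow> diff_upto n U (\<lambda>x. f x * g x)"
proof (induction n arbitrary: f g)
  case 0
  then show ?case using differentiable_mult by (auto simp: diff_upto_0)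
next
  case (Suc n)
  note fg = diff_upto_mono_Suc[OF Suc.prems(1)] diff_upto_mono_Suc[OF Suc.prems(2)]
  have "diff_upto n U (\<lambda>x. frechet_derivative (\<lambda>x. f x * g x) (at x) v)" for v
  proof (rule diff_upto_cong[OF assms])
    show "diff_upto n U (\<lambda>x. f x * frechet_derivative g (at x) v + frechet_derivative f (at x) v * g x)"
      using Suc fg by (intro diff_upto_add assms Suc.IH) (auto simp: diff_upto_Suc)
    fix y assume "y \<in> U"
    then show "f y * frechet_derivative g (at y) v + frechet_derivative f (at y) v * g y =
        frechet_derivative (\<lambda>x. f x * g x) (at y) v"
      using Suc.prems frechet_derivative_eqI[OF has_derivative_mult[OF
          frechet_derivative_works[THEN iffD1, of f] frechet_derivative_works[THEN iffD1, of g]]]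
      by (simp add: diff_upto_Suc)
  qed
  then show ?case using Suc.prems differentiable_mult by (auto simp: diff_upto_Suc)
qed

lemma diff_upto_linear:
  assumes "open U" "bounded_linear L"
  shows "diff_upto n U f \<Longrightarrow> diff_upto n U (\<lambda>x. L (f x))"
proof (induction n arbitrary: f)
  have D: "((\<lambda>x. L (f x)) has_derivative (\<lambda>v. L (frechet_derivative f (at y) v))) (at y)"
    if "f differentiable (at y)" for f y
    using bounded_linear.has_derivative[OF assms(2)] that frechet_derivative_works by blast
  {
    case 0
    then show ?case using D unfolding diff_upto_0 differentiable_def by blast
  next
    case (Suc n)
    have "diff_upto n U (\<lambda>x. frechet_derivative (\<lambda>x. L (f x)) (at x) v)" for v
    proof (rule diff_upto_cong[OF assms(1)])
      show "diff_upto n U (\<lambda>x. L (frechet_derivative f (at x) v))"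
        using Suc by (auto simp: diff_upto_Suc)
      fix y assume "y \<in> U"
      then show "L (frechet_derivative f (at y) v) = frechet_derivative (\<lambda>x. L (f x)) (at y) v"
        using Suc.prems D[of f y] by (auto simp: diff_upto_Suc frechet_derivative_eqI)
    qed
    then show ?case using Suc.prems D unfolding diff_upto_Suc differentiable_def by blast
  }
qed

lemma diff_upto_const: "diff_upto n U (\<lambda>x. c)"
  by (induction n arbitrary: c) (auto simp: diff_upto_0 diff_upto_Suc)

context smooth_manifold
begin

lemma Cinf_iff:
  "f \<in> Cinf A \<longleftrightarrow> (\<forall>U \<phi> n. (U, \<phi>) \<in> A \<longrightarrow> diff_upto n (\<phi> ` U) (\<lambda>x. f (inv_into U \<phi> x)))"
  unfolding Cinf_def smooth_on_iff_diff_upto comp_def by auto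

lemma Cinf_add: "f \<in> Cinf A \<Longrightarrow> g \<in> Cinf A \<Longrightarrow> f + g \<in> Cinf A"
  by (auto simp: Cinf_iff plus_fun_def intro!: diff_upto_add open_image)

lemma Cinf_mult:
  fixes f g :: "'m \<Rightarrow> 'k::real_normed_algebra"
  shows "f \<in> Cinf A \<Longrightarrow> g \<in> Cinf A \<Longrightarrow> f * g \<in> Cinf A"
  by (auto simp: Cinf_iff times_fun_def intro!: diff_upto_mult open_image)

lemma Cinf_const: "(\<lambda>p. c) \<in> Cinf A"
  by (auto simp: Cinf_iff intro!: diff_upto_const)

lemma Cinf_linear: "bounded_linear L \<Longrightarrow> f \<in> Cinf A \<Longrightarrow> (\<lambda>p. L (f p)) \<in> Cinf A"
  by (simp add: Cinf_iff diff_upto_linear[where L = L] open_image)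

lemma Cinf_scale:
  fixes f :: "'m \<Rightarrow> 'k::real_normed_algebra"
  shows "f \<in> Cinf A \<Longrightarrow> (\<lambda>p. c * f p) \<in> Cinf A"
  using Cinf_linear[of "\<lambda>x. c * x" f] bounded_linear_mult_right by blast

end

section \<open>Poisson bracket of a symplectic manifold\<close>

context smooth_manifold
begin

lemma Cinf_uminus:
  fixes f :: "'m \<Rightarrow> 'k::real_normed_algebra_1"
  shows "f \<in> Cinf A \<Longrightarrow> - f \<in> Cinf A"
  using Cinf_scale[of f "- 1"] by (simp add: fun_Compl_def)

lemma Cinf_diff:
  fixes f g :: "'m \<Rightarrow> 'k::real_normed_algebra_1"
  shows "f \<in> Cinf A \<Longrightarrow> g \<in> Cinf A \<Longrightarrow> f - g \<in> Cinf A"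
  using Cinf_add[OF _ Cinf_uminus, of f g] by simp

lemma Cinf_0: "0 \<in> Cinf A" and Cinf_1: "1 \<in> Cinf A"
  using Cinf_const by (auto simp: zero_fun_def one_fun_def)

lemma vector_fieldD:
  assumes "X \<in> vector_fields A"
  shows "f \<notin> Cinf A \<Longrightarrow> X f = 0"
    and "f \<in> Cinf A \<Longrightarrow> X f \<in> Cinf A"
    and "f \<in> Cinf A \<Longrightarrow> g \<in> Cinf A \<Longrightarrow> X (f + g) = X f + X g"
    and "f \<in> Cinf A \<Longrightarrow> X (\<lambda>p. c * f p) = (\<lambda>p. c * X f p)"
    and "f \<in> Cinf A \<Longrightarrow> g \<in> Cinf A \<Longrightarrow> X (f * g) = X f * g + f * X g"
  using assms unfolding vector_fields_def by blast+

lemma vector_field_zero: "X \<in> vector_fields A \<Longrightarrow> X 0 = 0"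
  using vector_fieldD(3)[of X 0 0] Cinf_0 by simp

lemma vector_field_uminus:
  "X \<in> vector_fields A \<Longrightarrow> f \<in> Cinf A \<Longrightarrow> X (- f) = - X f"
  using vector_fieldD(4)[of X f "- 1"] by (simp add: fun_Compl_def)

lemma vector_field_add:
  assumes X: "X \<in> vector_fields A" and Y: "Y \<in> vector_fields A"
  shows "X + Y \<in> vector_fields A"
  unfolding vector_fields_def
  using vector_fieldD[OF X] vector_fieldD[OF Y]
  by (auto intro!: Cinf_add simp: algebra_simps fun_eq_iff)

lemma vector_field_mult:
  assumes X: "X \<in> vector_fields A" and f: "f \<in> Cinf A"
  shows "(\<lambda>h. f * X h) \<in> vector_fields A"
  unfolding vector_fields_def
  using vector_fieldD[OF X] f
  by (auto intro!: Cinf_mult simp: algebra_simps fun_eq_iff)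

lemma vector_field_lie_bracket:
  assumes X: "X \<in> vector_fields A" and Y: "Y \<in> vector_fields A"
  shows "lie_bracket X Y \<in> vector_fields A"
proof -
  have d: "f \<in> Cinf A \<Longrightarrow> (\<lambda>x. X (Y f) x - Y (X f) x) \<in> Cinf A" for f
    using Cinf_diff[of "X (Y f)" "Y (X f)"] by (simp add: vector_fieldD[OF X] vector_fieldD[OF Y] fun_diff_def)
  note [simp] = d vector_fieldD[OF X] vector_fieldD[OF Y] vector_field_zero[OF X] vector_field_zero[OF Y]
    Cinf_add Cinf_mult Cinf_diff
  show ?thesis
    unfolding vector_fields_def lie_bracket_def
    by (auto simp: fun_diff_def right_diff_distrib) (auto simp: fun_eq_iff algebra_simps)
qed

end

context symplectic_manifold
begin

text \<open>
  Nondegeneracy of the form, applied to the 1-form \<open>Y \<mapsto> - Y f\<close>, gives existence and uniqueness.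
\<close>

lemma hamiltonian_field:
  assumes f: "f \<in> Cinf A"
  shows "hamiltonian_field A \<omega> f \<in> vector_fields A"
    and "\<And>Y. Y \<in> vector_fields A \<Longrightarrow> \<omega> (hamiltonian_field A \<omega> f) Y = - Y f"
proof -
  let ?P = "\<lambda>X. X \<in> vector_fields A \<and> (\<forall>Y\<in>vector_fields A. \<omega> X Y = - Y f)"
  have "\<exists>X\<in>vector_fields A. \<forall>Y\<in>vector_fields A. \<omega> X Y = - Y f"
    using nondegenerate_surj[of "\<lambda>Y. - Y f"] f
    by (simp add: Cinf_uminus vector_fieldD(2))
  then obtain X where X: "?P X" by blast
  have "X' = X" if X': "?P X'" for X'
  proof -
    \<comment> \<open>\<open>- X\<close>, written as a multiple by a smooth function to suit \<open>form_mult\<close>\<close>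
    let ?N = "\<lambda>h. (\<lambda>p. - 1) * X h"
    have N: "?N \<in> vector_fields A"
      using X vector_field_mult Cinf_const by blast
    have "X' + ?N = 0"
    proof (rule nondegenerate_inj)
      show "X' + ?N \<in> vector_fields A" using N X' vector_field_add by blast
      fix Y :: "('m \<Rightarrow> 'k) \<Rightarrow> 'm \<Rightarrow> 'k" assume Y: "Y \<in> vector_fields A"
      have "\<omega> (X' + ?N) Y = \<omega> X' Y + (\<lambda>p. - 1) * \<omega> X Y"
        using form_add[of X' ?N Y] form_mult[of "\<lambda>p. - 1" X Y] N X X' Y
          Cinf_const[of "- 1"] by simp
      then show "\<omega> (X' + ?N) Y = 0" using X X' Y by (auto simp: fun_eq_iff)
    qed
    then have "X' h p + - 1 * X h p = 0" for h p
      by (auto simp: fun_eq_iff dest: spec[of _ h])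
    then show ?thesis by (simp add: fun_eq_iff)
  qed
  then have "?P (hamiltonian_field A \<omega> f)"
    unfolding hamiltonian_field_def by (rule theI[of ?P, OF X])
  then show "hamiltonian_field A \<omega> f \<in> vector_fields A"
    and "\<And>Y. Y \<in> vector_fields A \<Longrightarrow> \<omega> (hamiltonian_field A \<omega> f) Y = - Y f"
    by blast+
qed

abbreviation br where "br \<equiv> symplectic_bracket A \<omega>"

lemma br_closed: "f \<in> Cinf A \<Longrightarrow> g \<in> Cinf A \<Longrightarrow> br f g \<in> Cinf A"
  unfolding symplectic_bracket_def using hamiltonian_field vector_fieldD(2) by blast

lemma br_add_right: "f \<in> Cinf A \<Longrightarrow> g \<in> Cinf A \<Longrightarrow> h \<in> Cinf A \<Longrightarrow> br f (g + h) = br f g + br f h"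
  unfolding symplectic_bracket_def using hamiltonian_field vector_fieldD(3) by blast

lemma br_scale_right: "f \<in> Cinf A \<Longrightarrow> g \<in> Cinf A \<Longrightarrow> br f (\<lambda>p. c * g p) = (\<lambda>p. c * br f g p)"
  unfolding symplectic_bracket_def using hamiltonian_field vector_fieldD(4) by blast

lemma br_mult_right: "f \<in> Cinf A \<Longrightarrow> g \<in> Cinf A \<Longrightarrow> h \<in> Cinf A \<Longrightarrow> br f (g * h) = br f g * h + g * br f h"
  unfolding symplectic_bracket_def using hamiltonian_field vector_fieldD(5) by blast

text \<open>
  The form takes the value \<open>{f, g} = - {g, f}\<close> on the two Hamiltonian fields, one expression for each of
  the two arguments.
\<close>

lemma br_antisym:
  assumes f: "f \<in> Cinf A" and g: "g \<in> Cinf A"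
  shows "br f g = - br g f"
  using hamiltonian_field(2)[OF f hamiltonian_field(1)[OF g]]
    hamiltonian_field(2)[OF g hamiltonian_field(1)[OF f]]
    form_antisym[OF hamiltonian_field(1)[OF f] hamiltonian_field(1)[OF g]]
  by (simp add: symplectic_bracket_def)

lemma br_add_left: "f \<in> Cinf A \<Longrightarrow> g \<in> Cinf A \<Longrightarrow> h \<in> Cinf A \<Longrightarrow> br (f + g) h = br f h + br g h"
  using br_antisym[of "f + g" h] br_antisym[of f h] br_antisym[of g h] br_add_right[of h f g]
  by (simp add: Cinf_add)

lemma br_scale_left: "f \<in> Cinf A \<Longrightarrow> g \<in> Cinf A \<Longrightarrow> br (\<lambda>p. c * f p) g = (\<lambda>p. c * br f g p)"
  using br_antisym[of "\<lambda>p. c * f p" g] br_antisym[of f g] br_scale_right[of g f c]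
  by (simp add: Cinf_scale fun_eq_iff)

lemma br_mult_left: "f \<in> Cinf A \<Longrightarrow> g \<in> Cinf A \<Longrightarrow> h \<in> Cinf A \<Longrightarrow> br (f * g) h = f * br g h + br f h * g"
  using br_antisym[of "f * g" h] br_antisym[of f h] br_antisym[of g h] br_mult_right[of h f g]
  by (simp add: Cinf_mult algebra_simps)

text \<open>
  This is closedness of the form on the Hamiltonian fields of \<open>f\<close>, \<open>g\<close>, \<open>h\<close>: all six terms become iterated
  brackets, and their sum is the negative of the Jacobi expression.
\<close>

lemma br_jacobi:
  assumes f: "f \<in> Cinf A" and g: "g \<in> Cinf A" and h: "h \<in> Cinf A"
  shows "br f (br g h) = br (br f g) h + br g (br f h)"
proof -
  define X Y W where "X = hamiltonian_field A \<omega> f" "Y = hamiltonian_field A \<omega> g" "W = hamiltonian_field A \<omega> h"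
  note XYW = this
  have V: "X \<in> vector_fields A" "Y \<in> vector_fields A" "W \<in> vector_fields A"
    using hamiltonian_field(1) f g h XYW by auto
  have a: "\<omega> X Y = br f g" "\<omega> X W = br f h" "\<omega> Y W = br g h"
    using hamiltonian_field(2)[OF f V(2)] hamiltonian_field(2)[OF f V(3)] hamiltonian_field(2)[OF g V(3)]
      br_antisym[OF f g] br_antisym[OF f h] br_antisym[OF g h]
    by (auto simp: XYW symplectic_bracket_def)
  have b: "\<omega> (lie_bracket U V) W = lie_bracket U V h"
      if "U \<in> vector_fields A" "V \<in> vector_fields A" "W = hamiltonian_field A \<omega> h" "h \<in> Cinf A" for U V W h
    using that form_antisym[OF vector_field_lie_bracket[OF that(1,2)] hamiltonian_field(1)[OF that(4)]]
     hamiltonian_field(2)[OF that(4) vector_field_lie_bracket[OF that(1,2)]] by simp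
  have c: "br g f = - br f g" "br h f = - br f h" "br h g = - br g h" "br h (br f g) = - br (br f g) h"
    using f g h br_antisym br_closed by blast+
  have d: "X (- br g h) = - br f (br g h)" "Y (- br f h) = - br g (br f h)" "W (- br f g) = - br h (br f g)"
    using V vector_field_uminus br_closed f g h by (auto simp: XYW symplectic_bracket_def)
  have "X (\<omega> Y W) - Y (\<omega> X W) + W (\<omega> X Y)
      - \<omega> (lie_bracket X Y) W + \<omega> (lie_bracket X W) Y - \<omega> (lie_bracket Y W) X = 0"
    by (rule closed_form[OF V])
  then have "br f (br g h) - br g (br f h) + br h (br f g) - (br f (br g h) - br g (br f h))
     + (br f (br h g) - br h (br f g)) - (br g (br h f) - br h (br g f)) = 0"
    unfolding a b[OF V(1,2) XYW(3) h] b[OF V(1,3) XYW(2) g] b[OF V(2,3) XYW(1) f]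
    unfolding lie_bracket_def
    by (simp add: XYW symplectic_bracket_def)
  then show ?thesis
    using d unfolding c XYW symplectic_bracket_def[symmetric]
    by (simp add: algebra_simps)
qed

end

section \<open>Products on exterior algebras\<close>

lemma shuffle_sign_Un_left:
  assumes "finite A" "finite B" "finite C" "A \<inter> B = {}"
  shows "shuffle_sign (A \<union> B) C = (shuffle_sign A C * shuffle_sign B C :: 'k::real_normed_field)"
proof -
  have "{(s, t). s \<in> A \<union> B \<and> t \<in> C \<and> t < s} =
      {(s, t). s \<in> A \<and> t \<in> C \<and> t < s} \<union> {(s, t). s \<in> B \<and> t \<in> C \<and> t < s}" by auto
  moreover have "finite {(s, t). s \<in> A \<and> t \<in> C \<and> t < s}" "finite {(s, t). s \<in> B \<and> t \<in> C \<and> t < s}"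
    using assms by (auto intro: finite_subset[of _ "(A \<union> B) \<times> C"])
  ultimately show ?thesis
    unfolding shuffle_sign_def using assms
    by (subst power_add[symmetric], subst card_Un_disjoint[symmetric]) auto
qed

lemma shuffle_sign_Un_right:
  assumes "finite A" "finite B" "finite C" "A \<inter> B = {}"
  shows "shuffle_sign C (A \<union> B) = (shuffle_sign C A * shuffle_sign C B :: 'k::real_normed_field)"
proof -
  have "{(s, t). s \<in> C \<and> t \<in> A \<union> B \<and> t < s} =
      {(s, t). s \<in> C \<and> t \<in> A \<and> t < s} \<union> {(s, t). s \<in> C \<and> t \<in> B \<and> t < s}" by auto
  moreover have "finite {(s, t). s \<in> C \<and> t \<in> A \<and> t < s}" "finite {(s, t). s \<in> C \<and> t \<in> B \<and> t < s}"
    using assms by (auto intro: finite_subset[of _ "C \<times> (A \<union> B)"])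
  ultimately show ?thesis
    unfolding shuffle_sign_def using assms
    by (subst power_add[symmetric], subst card_Un_disjoint[symmetric]) auto
qed

lemma shuffle_sign_square: "shuffle_sign A B * shuffle_sign A B = (1::'k::real_normed_field)"
  by (simp add: shuffle_sign_def flip: power_add)

text \<open>
  Of the two words formed from a pair in \<open>A \<times> B\<close>, exactly one is an inversion.
\<close>

lemma shuffle_sign_swap:
  assumes "finite A" "finite B" "A \<inter> B = {}"
  shows "shuffle_sign A B = (-1) ^ (card A * card B) * (shuffle_sign B A :: 'k::real_normed_field)"
proof -
  let ?P = "{(s, t). s \<in> A \<and> t \<in> B \<and> t < s}" and ?Q = "{(s, t). s \<in> B \<and> t \<in> A \<and> t < s}"
  have fin: "finite ?P" "finite ?Q"
    using assms by (auto intro: finite_subset[of _ "A \<times> B"] finite_subset[of _ "B \<times> A"])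
  have "A \<times> B = ?P \<union> prod.swap ` ?Q"
  proof -
    have "(s, t) \<in> prod.swap ` ?Q" if "s \<in> A" "t \<in> B" "\<not> t < s" for s t
      using that assms(3) by (intro image_eqI[of _ _ "(t, s)"]) (auto simp: nat_neq_iff)
    then show ?thesis by force
  qed
  moreover have "?P \<inter> prod.swap ` ?Q = {}" by auto
  ultimately have "card A * card B = card ?P + card ?Q"
    using fin card_Un_disjoint[of ?P "prod.swap ` ?Q"]
    by (simp add: card_cartesian_product[symmetric] card_image)
  then show ?thesis
    unfolding shuffle_sign_def by (simp add: power_add flip: power_add) (simp add: power_add)
qed

lemma shuffle_sign_empty [simp]: "shuffle_sign {} A = 1" "shuffle_sign A {} = 1"
  by (auto simp: shuffle_sign_def)

lemma lderiv_shuffle_sign: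
  "lderiv i F U p = (if i \<in> U then 0 else shuffle_sign {i} U * F (insert i U) p)"
proof -
  have "{(s, t). s \<in> {i} \<and> t \<in> U \<and> t < s} = (\<lambda>j. (i, j)) ` {j \<in> U. j < i}" by auto
  then show ?thesis unfolding lderiv_def shuffle_sign_def by (simp add: card_image inj_on_def)
qed

lemma rderiv_shuffle_sign:
  "rderiv i F U p = (if i \<in> U then 0 else shuffle_sign U {i} * F (insert i U) p)"
proof -
  have "{(s, t). s \<in> U \<and> t \<in> {i} \<and> t < s} = (\<lambda>j. (j, i)) ` {j \<in> U. i < j}" by auto
  then show ?thesis unfolding rderiv_def shuffle_sign_def by (simp add: card_image inj_on_def)
qed

text \<open>
  The grading involution. Moving an odd element past \<open>F\<close> replaces \<open>F\<close> by \<open>twist F\<close>; this takes the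
  place of the sign \<open>(-1)\<^sup>|\<^sup>F\<^sup>|\<close> and makes sense for inhomogeneous \<open>F\<close>.
\<close>

definition twist :: "('m, 'k::real_normed_field) ext \<Rightarrow> ('m, 'k) ext" where
  "twist F = (\<lambda>U p. (-1) ^ card U * F U p)"

text \<open>
  The effect on \<open>F\<close> of moving an element of parity \<open>e\<close> past it.
\<close>

definition twist_if :: "bool \<Rightarrow> ('m, 'k::real_normed_field) ext \<Rightarrow> ('m, 'k) ext" where
  "twist_if e F = (if e then twist F else F)"

definition parity :: "bool \<Rightarrow> ('m, 'k::real_normed_field) ext \<Rightarrow> bool" where
  "parity e F \<longleftrightarrow> (\<forall>U. F U \<noteq> 0 \<longrightarrow> (odd (card U) \<longleftrightarrow> e))"

definition ext_scale :: "'k \<Rightarrow> ('m, 'k::real_normed_field) ext \<Rightarrow> ('m, 'k) ext" where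
  "ext_scale c F = (\<lambda>U p. c * F U p)"

definition monomial :: "('m \<Rightarrow> 'k::real_normed_field) \<Rightarrow> nat set \<Rightarrow> ('m, 'k) ext" where
  "monomial h U = (\<lambda>V. if V = U then h else 0)"

text \<open>
  The exterior product with multiplication of coefficients replaced by a bilinear operation \<open>B\<close>. The
  exterior product is the case of multiplication; the Poisson bracket of functions yields the part of
  the BRST bracket that differentiates the coefficients.
\<close>

definition ext_product ::
  "(('m \<Rightarrow> 'k) \<Rightarrow> ('m \<Rightarrow> 'k) \<Rightarrow> 'm \<Rightarrow> 'k::real_normed_field) \<Rightarrow> ('m, 'k) ext \<Rightarrow> ('m, 'k) ext \<Rightarrow> ('m, 'k) ext"
  where "ext_product B F G =
    (\<lambda>U p. \<Sum>T\<in>Pow U. shuffle_sign T (U - T) * B (F T) (G (U - T)) p)"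

text \<open>
  An iterated product, bracketed either way, is of this form, with parts \<open>A\<close>, \<open>B\<close> and \<open>U - A - B\<close> of \<open>U\<close>, so that an identity between operations on the coefficients turns into an
  identity on the exterior algebra.
\<close>

definition triple_product ::
  "(('m \<Rightarrow> 'k) \<Rightarrow> ('m \<Rightarrow> 'k) \<Rightarrow> ('m \<Rightarrow> 'k) \<Rightarrow> 'm \<Rightarrow> 'k::real_normed_field) \<Rightarrow>
    ('m, 'k) ext \<Rightarrow> ('m, 'k) ext \<Rightarrow> ('m, 'k) ext \<Rightarrow> ('m, 'k) ext"
  where "triple_product T F G H = (\<lambda>U p. \<Sum>(A, B)\<in>{(A, B). A \<subseteq> U \<and> B \<subseteq> U \<and> A \<inter> B = {}}.
     shuffle_sign A (U - A) * shuffle_sign B (U - A - B) * T (F A) (G B) (H (U - A - B)) p)"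

lemma wedge_eq_ext_product: "F \<and>\<^sub>e G = ext_product (*) F G"
  by (simp add: wedge_def ext_product_def mult.assoc)

lemma ext_product_infinite: "infinite U \<Longrightarrow> ext_product B F G U = 0"
  by (auto simp: ext_product_def fun_eq_iff)

lemma triple_product_infinite: "infinite U \<Longrightarrow> triple_product T F G H U = 0"
proof -
  assume "infinite U"
  then have "infinite ((\<lambda>A. (A, {} :: nat set)) ` Pow U)"
    by (subst finite_image_iff) (auto simp: inj_on_def)
  moreover have "(\<lambda>A. (A, {})) ` Pow U \<subseteq> {(A, B). A \<subseteq> U \<and> B \<subseteq> U \<and> A \<inter> B = {}}" by auto
  ultimately have "infinite {(A, B). A \<subseteq> U \<and> B \<subseteq> U \<and> A \<inter> B = {}}"
    using finite_subset by blast
  then show ?thesis by (simp add: triple_product_def fun_eq_iff)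
qed

text \<open>
  An operation on coefficients in \<open>R\<close>. The carrier is explicit because the Poisson bracket is bilinear
  on smooth functions only.
\<close>

locale coef_bilinear =
  fixes R :: "('m \<Rightarrow> 'k::real_normed_field) set" and B :: "('m \<Rightarrow> 'k) \<Rightarrow> ('m \<Rightarrow> 'k) \<Rightarrow> 'm \<Rightarrow> 'k"
  assumes zero_mem: "0 \<in> R"
    and add_mem: "f \<in> R \<Longrightarrow> g \<in> R \<Longrightarrow> f + g \<in> R"
    and scale_mem: "f \<in> R \<Longrightarrow> (\<lambda>p. c * f p) \<in> R"
    and closed: "f \<in> R \<Longrightarrow> g \<in> R \<Longrightarrow> B f g \<in> R"
    and add_left: "f \<in> R \<Longrightarrow> g \<in> R \<Longrightarrow> h \<in> R \<Longrightarrow> B (f + g) h = B f h + B g h"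
    and add_right: "f \<in> R \<Longrightarrow> g \<in> R \<Longrightarrow> h \<in> R \<Longrightarrow> B h (f + g) = B h f + B h g"
    and scale_left: "f \<in> R \<Longrightarrow> g \<in> R \<Longrightarrow> B (\<lambda>p. c * f p) g = (\<lambda>p. c * B f g p)"
    and scale_right: "f \<in> R \<Longrightarrow> g \<in> R \<Longrightarrow> B f (\<lambda>p. c * g p) = (\<lambda>p. c * B f g p)"
begin

lemma zero_left: "g \<in> R \<Longrightarrow> B 0 g = 0" and zero_right: "g \<in> R \<Longrightarrow> B g 0 = 0"
  using add_left[of 0 0 g] add_right[of 0 0 g] zero_mem by auto

lemma sum_mem: "(\<And>x. x \<in> X \<Longrightarrow> g x \<in> R) \<Longrightarrow> (\<lambda>p. \<Sum>x\<in>X. c x * g x p) \<in> R"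
proof (induction X rule: infinite_finite_induct)
  case (insert x X)
  have "(\<lambda>p. \<Sum>x\<in>insert x X. c x * g x p) = (\<lambda>p. c x * g x p) + (\<lambda>p. \<Sum>x\<in>X. c x * g x p)"
    using insert by (simp add: fun_eq_iff)
  then show ?case using insert by (simp add: add_mem scale_mem)
qed (use zero_mem in \<open>auto simp: zero_fun_def\<close>)

lemma sum_left:
  "(\<And>x. x \<in> X \<Longrightarrow> g x \<in> R) \<Longrightarrow> h \<in> R \<Longrightarrow>
    B (\<lambda>p. \<Sum>x\<in>X. c x * g x p) h = (\<lambda>p. \<Sum>x\<in>X. c x * B (g x) h p)"
proof (induction X rule: infinite_finite_induct)
  case (insert x X)
  have e: "(\<lambda>p. \<Sum>x\<in>insert x X. c x * g x p) = (\<lambda>p. c x * g x p) + (\<lambda>p. \<Sum>x\<in>X. c x * g x p)"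
    using insert by (simp add: fun_eq_iff)
  have "B (\<lambda>p. \<Sum>x\<in>insert x X. c x * g x p) h = B (\<lambda>p. c x * g x p) h + B (\<lambda>p. \<Sum>x\<in>X. c x * g x p) h"
    unfolding e by (rule add_left) (use insert in \<open>auto intro!: scale_mem sum_mem\<close>)
  also have "\<dots> = (\<lambda>p. \<Sum>x\<in>insert x X. c x * B (g x) h p)"
    using insert by (simp add: scale_left fun_eq_iff)
  finally show ?case .
qed (use zero_left in \<open>auto simp: zero_fun_def\<close>)

lemma sum_right:
  "(\<And>x. x \<in> X \<Longrightarrow> g x \<in> R) \<Longrightarrow> h \<in> R \<Longrightarrow>
    B h (\<lambda>p. \<Sum>x\<in>X. c x * g x p) = (\<lambda>p. \<Sum>x\<in>X. c x * B h (g x) p)"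
proof (induction X rule: infinite_finite_induct)
  case (insert x X)
  have e: "(\<lambda>p. \<Sum>x\<in>insert x X. c x * g x p) = (\<lambda>p. c x * g x p) + (\<lambda>p. \<Sum>x\<in>X. c x * g x p)"
    using insert by (simp add: fun_eq_iff)
  have "B h (\<lambda>p. \<Sum>x\<in>insert x X. c x * g x p) = B h (\<lambda>p. c x * g x p) + B h (\<lambda>p. \<Sum>x\<in>X. c x * g x p)"
    unfolding e by (rule add_right) (use insert in \<open>auto intro!: scale_mem sum_mem\<close>)
  also have "\<dots> = (\<lambda>p. \<Sum>x\<in>insert x X. c x * B h (g x) p)"
    using insert by (simp add: scale_right fun_eq_iff)
  finally show ?case .
qed (use zero_right in \<open>auto simp: zero_fun_def\<close>)

lemma ext_product_closed:
  assumes "F \<in> ext_over R n" "G \<in> ext_over R n"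
  shows "ext_product B F G \<in> ext_over R n"
proof -
  have "ext_product B F G U \<in> R" for U
    unfolding ext_product_def using assms by (intro sum_mem closed) (auto simp: ext_over_def)
  moreover have "ext_product B F G U = 0" if U: "\<not> U \<subseteq> {..<n}" for U
  proof -
    have "B (F T) (G (U - T)) = 0" if "T \<subseteq> U" for T
    proof (cases "T \<subseteq> {..<n}")
      case True
      then have "\<not> U - T \<subseteq> {..<n}" using U by blast
      then show ?thesis using assms zero_right unfolding ext_over_def by simp
    next
      case False
      then show ?thesis using assms zero_left unfolding ext_over_def by simp
    qed
    then show ?thesis by (auto simp: ext_product_def fun_eq_iff)
  qed
  ultimately show ?thesis by (simp add: ext_over_def)
qed

lemma ext_product_add_left:
  "F \<in> ext_over R n \<Longrightarrow> G \<in> ext_over R n \<Longrightarrow> H \<in> ext_over R n \<Longrightarrow>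
    ext_product B (F + G) H = ext_product B F H + ext_product B G H"
  by (simp add: ext_product_def ext_over_def add_left fun_eq_iff distrib_left sum.distrib)

lemma ext_product_add_right:
  "F \<in> ext_over R n \<Longrightarrow> G \<in> ext_over R n \<Longrightarrow> H \<in> ext_over R n \<Longrightarrow>
    ext_product B H (F + G) = ext_product B H F + ext_product B H G"
  by (simp add: ext_product_def ext_over_def add_right fun_eq_iff distrib_left sum.distrib)

lemma ext_product_scale_left:
  "F \<in> ext_over R n \<Longrightarrow> G \<in> ext_over R n \<Longrightarrow> ext_product B (ext_scale c F) G = ext_scale c (ext_product B F G)"
  by (simp add: ext_product_def ext_over_def ext_scale_def scale_left fun_eq_iff sum_distrib_left mult.left_commute)

lemma ext_product_scale_right:
  "F \<in> ext_over R n \<Longrightarrow> G \<in> ext_over R n \<Longrightarrow> ext_product B F (ext_scale c G) = ext_scale c (ext_product B F G)"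
  by (simp add: ext_product_def ext_over_def ext_scale_def scale_right fun_eq_iff sum_distrib_left mult.left_commute)

lemma ext_product_twist:
  assumes "F \<in> ext_over R n" "G \<in> ext_over R n"
  shows "twist (ext_product B F G) = ext_product B (twist F) (twist G)"
proof (intro ext)
  fix U p
  show "twist (ext_product B F G) U p = ext_product B (twist F) (twist G) U p"
  proof (cases "finite U")
    case True
    have "card T + card (U - T) = card U" if "T \<subseteq> U" for T
      using that True by (simp add: card_Diff_subset card_mono finite_subset)
    then have "(-1) ^ card U = (-1) ^ card T * ((-1) ^ card (U - T) :: 'k)" if "T \<subseteq> U" for T
      using that by (metis power_add)
    moreover have "B (twist F T) (twist G V) p = (-1) ^ card T * ((-1) ^ card V * B (F T) (G V) p)" for T V
      using assms by (simp add: twist_def ext_over_def scale_left scale_right scale_mem)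
    ultimately show ?thesis
      by (simp add: twist_def ext_product_def sum_distrib_left mult_ac)
  qed (simp add: ext_product_infinite twist_def)
qed

lemma ext_product_swap:
  assumes "F \<in> ext_over R n" "G \<in> ext_over R n" "parity e F"
  shows "ext_product B F G = ext_product (\<lambda>g f. B f g) (twist_if e G) F"
proof (intro ext)
  fix U p
  show "ext_product B F G U p = ext_product (\<lambda>g f. B f g) (twist_if e G) F U p"
  proof (cases "finite U")
    case True
    have "ext_product B F G U p = (\<Sum>T\<in>Pow U. shuffle_sign (U - T) T * B (F (U - T)) (G T) p)"
      unfolding ext_product_def
      by (rule sum.reindex_bij_witness[of _ "\<lambda>T. U - T" "\<lambda>T. U - T"])
        (auto simp: double_diff)
    also have "\<dots> = ext_product (\<lambda>g f. B f g) (twist_if e G) F U p"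
      unfolding ext_product_def
    proof (intro sum.cong refl)
      fix T assume T: "T \<in> Pow U"
      show "shuffle_sign (U - T) T * B (F (U - T)) (G T) p =
            shuffle_sign T (U - T) * B (F (U - T)) (twist_if e G T) p"
      proof (cases "F (U - T) = 0")
        case True
        have "twist_if e G T \<in> R" "G T \<in> R"
          using assms(2) by (auto simp: twist_if_def twist_def ext_over_def scale_mem)
        then show ?thesis by (simp add: True zero_left)
      next
        case False
        then have "e \<longleftrightarrow> odd (card (U - T))" using assms(3) by (auto simp: parity_def)
        moreover have "shuffle_sign (U - T) T = (-1) ^ (card (U - T) * card T) * (shuffle_sign T (U - T) :: 'k)"
          by (rule shuffle_sign_swap) (use T \<open>finite U\<close> finite_subset[of T U] in auto)
        moreover have "twist_if e G T = (\<lambda>p. (if e then (-1) ^ card T else 1) * G T p)"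
          by (simp add: twist_if_def twist_def)
        ultimately show ?thesis using assms
          by (simp add: ext_over_def scale_right power_mult)
      qed
    qed
    finally show ?thesis .
  qed (simp add: ext_product_infinite)
qed

text \<open>
  For \<open>i \<notin> U\<close>, the subsets of \<open>insert i U\<close> that contain \<open>i\<close> give the first summand and the others the
  second one. For \<open>i \<in> U\<close> the two summands on the right cancel term by term, reflecting that the
  generator with number \<open>i\<close> has square 0.
\<close>

lemma ext_product_lderiv:
  assumes "F \<in> ext_over R n" "G \<in> ext_over R n"
  shows "lderiv i (ext_product B F G) = ext_product B (lderiv i F) G + ext_product B (twist F) (lderiv i G)"
proof (intro ext)
  fix U p
  have FG: "F T \<in> R" "G T \<in> R" for T using assms by (auto simp: ext_over_def)
  have lF: "lderiv i F T = (if i \<in> T then 0 else (\<lambda>p. shuffle_sign {i} T * F (insert i T) p))" for F :: "('m, 'k) ext" and T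
    by (auto simp: lderiv_shuffle_sign fun_eq_iff)
  have L: "B (lderiv i F T) (G V) p = (if i \<in> T then 0 else shuffle_sign {i} T * B (F (insert i T)) (G V) p)" for T V
    by (simp add: lF zero_left scale_left FG)
  have Rr: "B (twist F T) (lderiv i G V) p = (if i \<in> V then 0 else (- 1) ^ card T * shuffle_sign {i} V * B (F T) (G (insert i V)) p)" for T V
    by (simp add: lF twist_def zero_right scale_left scale_right scale_mem FG)
  show "lderiv i (ext_product B F G) U p =
      (ext_product B (lderiv i F) G + ext_product B (twist F) (lderiv i G)) U p"
  proof (cases "finite U")
    case False
    then show ?thesis by (simp add: ext_product_infinite lderiv_def)
  next
    case fin: True
    then have finT: "finite T" if "T \<subseteq> U" for T using that finite_subset by blast
    show ?thesis
    proof (cases "i \<in> U")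
      case True
      let ?V = "U - {i}"
      have U: "U = insert i ?V" using True by auto
      have split: "Pow U = Pow ?V \<union> insert i ` Pow ?V" "Pow ?V \<inter> insert i ` Pow ?V = {}"
        "inj_on (insert i) (Pow ?V)" 
        using True by (auto simp: Pow_insert[symmetric] insert_absorb inj_on_def)
      have 1: "ext_product B (lderiv i F) G U p =
          (\<Sum>T\<in>Pow ?V. shuffle_sign T (U - T) * (shuffle_sign {i} T * B (F (insert i T)) (G (U - T)) p))"
        unfolding ext_product_def L
        by (rule sum.mono_neutral_cong_right) (use fin in auto)
      have 2: "ext_product B (twist F) (lderiv i G) U p =
          (\<Sum>T\<in>insert i ` Pow ?V. shuffle_sign T (U - T) * ((- 1) ^ card T * shuffle_sign {i} (U - T) * B (F T) (G (insert i (U - T))) p))"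
        unfolding ext_product_def Rr
        by (rule sum.mono_neutral_cong_right) (use fin split in auto)
      have "shuffle_sign T (U - T) * (shuffle_sign {i} T * B (F (insert i T)) (G (U - T)) p) +
        shuffle_sign (insert i T) (U - insert i T) * ((- 1) ^ card (insert i T) * shuffle_sign {i} (U - insert i T) *
           B (F (insert i T)) (G (insert i (U - insert i T))) p) = 0" if T: "T \<in> Pow ?V" for T
      proof -
        have f: "finite T" "finite (?V - T)" "i \<notin> T" using T finT[of T] fin by auto
        have e: "insert i (U - insert i T) = U - T" "U - T = {i} \<union> (?V - T)" "U - insert i T = ?V - T" "insert i (?V - T) = U - T"
          using T True by auto
        have s1: "shuffle_sign T (U - T) = shuffle_sign T {i} * (shuffle_sign T (?V - T) :: 'k)"
          unfolding e(2) by (rule shuffle_sign_Un_right) (use f in auto)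
        have s2: "shuffle_sign (insert i T) (?V - T) = shuffle_sign {i} (?V - T) * (shuffle_sign T (?V - T) :: 'k)"
          using shuffle_sign_Un_left[of "{i}" T "?V - T"] f by simp
        have s3: "shuffle_sign T {i} = (-1) ^ card T * (shuffle_sign {i} T :: 'k)"
          using shuffle_sign_swap[of T "{i}"] f by simp
        have sq: "shuffle_sign {i} T * (shuffle_sign {i} T * x) = x"
            "shuffle_sign {i} (?V - T) * (shuffle_sign {i} (?V - T) * x) = x" for x :: 'k
          by (metis shuffle_sign_square mult.assoc mult_1)+
        show ?thesis unfolding e(3,4) s1 s2 s3 using f
          by (simp add: mult_ac sq shuffle_sign_square)
      qed
      then have "ext_product B (lderiv i F) G U p + ext_product B (twist F) (lderiv i G) U p = 0"
        unfolding 1 2 sum.reindex[OF split(3)] sum.distrib[symmetric] by (intro sum.neutral) simp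
      then show ?thesis using True by (simp add: lderiv_def)
    next
      case False
      have split: "Pow (insert i U) = Pow U \<union> insert i ` Pow U" "Pow U \<inter> insert i ` Pow U = {}"
        "inj_on (insert i) (Pow U)" 
        using False by (auto simp: Pow_insert inj_on_def)
      have "lderiv i (ext_product B F G) U p = shuffle_sign {i} U * 
        (\<Sum>T\<in>Pow (insert i U). shuffle_sign T (insert i U - T) * B (F T) (G (insert i U - T)) p)"
        using False by (simp add: lderiv_shuffle_sign ext_product_def)
      also have "\<dots> = (\<Sum>T\<in>Pow U. shuffle_sign {i} U * (shuffle_sign T (insert i U - T) * B (F T) (G (insert i U - T)) p))
        + (\<Sum>T\<in>Pow U. shuffle_sign {i} U * (shuffle_sign (insert i T) (insert i U - insert i T) * B (F (insert i T)) (G (insert i U - insert i T)) p))"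
        unfolding split(1) using fin split(2)
        by (simp add: sum.union_disjoint distrib_left sum_distrib_left sum.reindex[OF split(3)]
            del: Diff_insert0 insert_Diff_if)
      also have "(\<Sum>T\<in>Pow U. shuffle_sign {i} U * (shuffle_sign T (insert i U - T) * B (F T) (G (insert i U - T)) p))
         = ext_product B (twist F) (lderiv i G) U p"
        unfolding ext_product_def Rr
      proof (intro sum.cong refl)
        fix T assume T: "T \<in> Pow U"
        have f: "finite T" "finite (U - T)" "i \<notin> T" "i \<notin> U" using T finT[of T] fin False by auto
        have e: "insert i U - T = {i} \<union> (U - T)" using f by auto
        have s1: "shuffle_sign T (insert i U - T) = shuffle_sign T {i} * (shuffle_sign T (U - T) :: 'k)"
          unfolding e by (rule shuffle_sign_Un_right) (use f in auto)
        have s2: "shuffle_sign {i} U = shuffle_sign {i} T * (shuffle_sign {i} (U - T) :: 'k)"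
          using shuffle_sign_Un_right[of T "U - T" "{i}"] f T by (simp add: Un_absorb1)
        have s3: "shuffle_sign T {i} = (-1) ^ card T * (shuffle_sign {i} T :: 'k)"
          using shuffle_sign_swap[of T "{i}"] f by simp
        have sq: "shuffle_sign {i} T * (shuffle_sign {i} T * x) = x" for x :: 'k
          by (metis shuffle_sign_square mult.assoc mult_1)
        show "shuffle_sign {i} U * (shuffle_sign T (insert i U - T) * B (F T) (G (insert i U - T)) p) =
          shuffle_sign T (U - T) * (if i \<in> U - T then 0 else (- 1) ^ card T * shuffle_sign {i} (U - T) * B (F T) (G (insert i (U - T))) p)"
          unfolding s1 s2 s3 using f e by (simp add: mult_ac sq)
      qed
      also have "(\<Sum>T\<in>Pow U. shuffle_sign {i} U * (shuffle_sign (insert i T) (insert i U - insert i T) * B (F (insert i T)) (G (insert i U - insert i T)) p))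
         = ext_product B (lderiv i F) G U p"
        unfolding ext_product_def L
      proof (intro sum.cong refl)
        fix T assume T: "T \<in> Pow U"
        have f: "finite T" "finite (U - T)" "i \<notin> T" "i \<notin> U" using T finT[of T] fin False by auto
        have e: "insert i U - insert i T = U - T" using f by auto
        have s1: "shuffle_sign (insert i T) (U - T) = shuffle_sign {i} (U - T) * (shuffle_sign T (U - T) :: 'k)"
          using shuffle_sign_Un_left[of "{i}" T "U - T"] f by simp
        have s2: "shuffle_sign {i} U = shuffle_sign {i} T * (shuffle_sign {i} (U - T) :: 'k)"
          using shuffle_sign_Un_right[of T "U - T" "{i}"] f T by (simp add: Un_absorb1)
        have sq: "shuffle_sign {i} (U - T) * (shuffle_sign {i} (U - T) * x) = x" for x :: 'k
          by (metis shuffle_sign_square mult.assoc mult_1)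
        show "shuffle_sign {i} U * (shuffle_sign (insert i T) (insert i U - insert i T) * B (F (insert i T)) (G (insert i U - insert i T)) p) =
          shuffle_sign T (U - T) * (if i \<in> T then 0 else shuffle_sign {i} T * B (F (insert i T)) (G (U - T)) p)"
          unfolding e s1 s2 using f by (simp add: mult_ac sq)
      qed
      finally show ?thesis by simp
    qed
  qed
qed

lemma ext_product_assoc_right:
  assumes "F \<in> ext_over R n" "\<And>U V. B2 (G U) (H V) \<in> R"
  shows "ext_product B F (ext_product B2 G H) = triple_product (\<lambda>f g h. B f (B2 g h)) F G H"
proof (intro ext)
  fix U p
  show "ext_product B F (ext_product B2 G H) U p = triple_product (\<lambda>f g h. B f (B2 g h)) F G H U p"
  proof (cases "finite U")
    case True
    have eq: "{(A, C). A \<subseteq> U \<and> C \<subseteq> U \<and> A \<inter> C = {}} = Sigma (Pow U) (\<lambda>A. Pow (U - A))" by auto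
    have "ext_product B F (ext_product B2 G H) U p =
      (\<Sum>A\<in>Pow U. \<Sum>C\<in>Pow (U - A). shuffle_sign A (U - A) * (shuffle_sign C (U - A - C) * B (F A) (B2 (G C) (H (U - A - C))) p))"
      unfolding ext_product_def using assms
      by (simp add: sum_right ext_over_def sum_distrib_left)
    then show ?thesis
      unfolding triple_product_def eq using True by (simp add: sum.Sigma mult.assoc)
  next
    case False
    then show ?thesis by (simp add: triple_product_infinite ext_product_infinite)
  qed
qed

text \<open>
  A subset \<open>W\<close> of \<open>U\<close> with a subset \<open>A\<close> of \<open>W\<close> is the decomposition into \<open>A\<close>, \<open>W - A\<close> and \<open>U - W\<close>.
\<close>

lemma ext_product_assoc_left:
  assumes "H \<in> ext_over R n" "\<And>U V. B2 (F U) (G V) \<in> R"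
  shows "ext_product B (ext_product B2 F G) H = triple_product (\<lambda>f g h. B (B2 f g) h) F G H"
proof (intro ext)
  fix U p
  show "ext_product B (ext_product B2 F G) H U p = triple_product (\<lambda>f g h. B (B2 f g) h) F G H U p"
  proof (cases "finite U")
    case True
    have eq: "{(A, C). A \<subseteq> U \<and> C \<subseteq> U \<and> A \<inter> C = {}} = Sigma (Pow U) (\<lambda>A. Pow (U - A))" by auto
    have "ext_product B (ext_product B2 F G) H U p =
      (\<Sum>W\<in>Pow U. \<Sum>A\<in>Pow W. shuffle_sign W (U - W) * (shuffle_sign A (W - A) * B (B2 (F A) (G (W - A))) (H (U - W)) p))"
      unfolding ext_product_def using assms
      by (simp add: sum_left ext_over_def sum_distrib_left)
    also have "\<dots> = (\<Sum>(W,A)\<in>Sigma (Pow U) Pow. shuffle_sign W (U - W) * (shuffle_sign A (W - A) * B (B2 (F A) (G (W - A))) (H (U - W)) p))"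
      using True by (intro sum.Sigma) (auto simp: finite_subset)
    also have "\<dots> = triple_product (\<lambda>f g h. B (B2 f g) h) F G H U p"
      unfolding triple_product_def
    proof (rule sum.reindex_bij_witness[of _ "\<lambda>(A, C). (A \<union> C, A)" "\<lambda>(W, A). (A, W - A)"], goal_cases)
      case (5 a)
      obtain W A where a: "a = (W, A)" by (cases a)
      have f: "W \<subseteq> U" "A \<subseteq> W" "finite W" "finite A" "finite U"
        using 5 a True finite_subset[of W U] finite_subset[of A U] by auto
      have e: "U - A - (W - A) = U - W" "W = A \<union> (W - A)" "U - A = (W - A) \<union> (U - W)" using f by auto
      have s1: "shuffle_sign W (U - W) = shuffle_sign A (U - W) * (shuffle_sign (W - A) (U - W) :: 'k)"
        using shuffle_sign_Un_left[of A "W - A" "U - W"] f e by auto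
      have s2: "shuffle_sign A (U - A) = shuffle_sign A (W - A) * (shuffle_sign A (U - W) :: 'k)"
        unfolding e(3) by (rule shuffle_sign_Un_right) (use f in auto)
      show ?case by (simp add: a e(1) s1 s2 mult_ac)
    qed auto
    finally show ?thesis .
  next
    case False
    then show ?thesis by (simp add: triple_product_infinite ext_product_infinite)
  qed
qed

end

text \<open>
  Exchanging the first two parts changes the sign by the product of their parities.
\<close>

lemma triple_product_swap:
  fixes F G H :: "('m, 'k::real_normed_field) ext"
  assumes e: "parity e F"
    and zero: "\<And>A C. T 0 (G A) (H C) = 0" "\<And>A C. T 0 (twist_if e G A) (H C) = 0"
    and scale: "\<And>A C D c. T (F A) (\<lambda>p. c * G C p) (H D) = (\<lambda>p. c * T (F A) (G C) (H D) p)"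
  shows "triple_product T F G H = triple_product (\<lambda>g f h. T f g h) (twist_if e G) F H"
proof (intro ext)
  fix U p
  show "triple_product T F G H U p = triple_product (\<lambda>g f h. T f g h) (twist_if e G) F H U p"
  proof (cases "finite U")
    case True
    show ?thesis unfolding triple_product_def
    proof (rule sum.reindex_bij_witness[of _ prod.swap prod.swap], goal_cases)
      case (5 a)
      obtain A C where a: "a = (A, C)" by (cases a)
      let ?Q = "U - A - C"
      have f: "A \<subseteq> U" "C \<subseteq> U" "A \<inter> C = {}" "finite A" "finite C" "finite ?Q"
        using 5 a True finite_subset[of A U] finite_subset[of C U] by auto
      have Q: "U - A = C \<union> ?Q" "U - C = A \<union> ?Q" "U - C - A = ?Q" using f by auto
      have s1: "shuffle_sign A (U - A) = shuffle_sign A C * (shuffle_sign A ?Q :: 'k)"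
        by (subst Q(1), rule shuffle_sign_Un_right) (use f in auto)
      have s2: "shuffle_sign C (U - C) = shuffle_sign C A * (shuffle_sign C ?Q :: 'k)"
        by (subst Q(2), rule shuffle_sign_Un_right) (use f in auto)
      have s3: "shuffle_sign A C = (-1) ^ (card A * card C) * (shuffle_sign C A :: 'k)"
        by (rule shuffle_sign_swap) (use f in auto)
      have s4: "T (F A) (twist_if e G C) (H ?Q) p = (-1) ^ (card A * card C) * T (F A) (G C) (H ?Q) p"
      proof (cases "F A = 0")
        case False
        then have "odd (card A) \<longleftrightarrow> e" using e by (auto simp: parity_def)
        then show ?thesis using scale by (auto simp: twist_if_def twist_def power_mult)
      qed (simp add: zero)
      show ?case
        by (simp add: a Q(3) s1 s2 s3 s4 mult_ac)
    qed auto
  next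
    case False
    then show ?thesis by (simp add: triple_product_infinite)
  qed
qed

section \<open>Parity, degree and monomials\<close>

lemma sum_ext_apply: "(\<Sum>a\<in>X. f a) U p = (\<Sum>a\<in>X. f a U p)"
  for f :: "'a \<Rightarrow> ('m, 'k::real_normed_field) ext"
  by (induction X rule: infinite_finite_induct) auto

lemma ext_scale_uminus: "ext_scale (- 1) F = - F"
  by (simp add: ext_scale_def fun_eq_iff)

lemma ext_scale_zero [simp]: "ext_scale c 0 = 0" and ext_scale_add: "ext_scale c (F + G) = ext_scale c F + ext_scale c G"
  and ext_scale_minus: "ext_scale c (- F) = - ext_scale c F" and ext_scale_scale: "ext_scale c (ext_scale d F) = ext_scale (c * d) F"
  and ext_scale_one [simp]: "ext_scale 1 F = F"
  by (simp_all add: ext_scale_def fun_eq_iff distrib_left mult.assoc)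

lemma ext_scale_sum: "ext_scale c (\<Sum>a\<in>X. f a) = (\<Sum>a\<in>X. ext_scale c (f a))"
  by (simp add: fun_eq_iff ext_scale_def sum_distrib_left sum_ext_apply)

lemma twist_twist [simp]: "twist (twist F) = F"
  by (simp add: twist_def fun_eq_iff flip: mult.assoc power_add)

lemma twist_add: "twist (F + G) = twist F + twist G"
  and twist_uminus: "twist (- F) = - twist F"
  and twist_diff: "twist (F - G) = twist F - twist G"
  and twist_scale: "twist (ext_scale c F) = ext_scale c (twist F)"
  and twist_zero [simp]: "twist 0 = 0"
  by (simp_all add: twist_def ext_scale_def fun_eq_iff algebra_simps)

lemma twist_sum: "twist (\<Sum>a\<in>X. f a) = (\<Sum>a\<in>X. twist (f a))"
  by (simp add: fun_eq_iff twist_def sum_distrib_left sum_ext_apply)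

lemma lderiv_add: "lderiv i (F + G) = lderiv i F + lderiv i G"
  and lderiv_scale: "lderiv i (ext_scale c F) = ext_scale c (lderiv i F)"
  and lderiv_zero [simp]: "lderiv i 0 = 0"
  by (auto simp: lderiv_def ext_scale_def fun_eq_iff algebra_simps)

lemma lderiv_sum: "lderiv i (\<Sum>a\<in>X. f a) = (\<Sum>a\<in>X. lderiv i (f a))"
  by (simp add: fun_eq_iff lderiv_def sum_distrib_left sum_ext_apply)

lemma twist_if_twist: "twist_if (\<not> e) (twist F) = twist_if e F"
  by (simp add: twist_if_def)

lemma twist_if_parity: "parity e F \<Longrightarrow> twist_if d F = (if e \<and> d then - F else F)"
proof -
  assume e: "parity e F"
  have "twist F U p = (if e then - F U p else F U p)" for U p
    using e by (cases "F U = 0") (auto simp: parity_def twist_def)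
  then show ?thesis by (auto simp: twist_if_def fun_eq_iff)
qed

lemma ext_over_finite: "F \<in> ext_over R n \<Longrightarrow> infinite U \<Longrightarrow> F U = 0"
  using finite_subset[OF _ finite_lessThan, of U n] unfolding ext_over_def by blast

lemma lderiv_twist: "F \<in> ext_over R n \<Longrightarrow> lderiv i (twist F) = - twist (lderiv i F)"
proof (intro ext)
  fix U p assume F: "F \<in> ext_over R n"
  show "lderiv i (twist F) U p = (- twist (lderiv i F)) U p"
    using ext_over_finite[OF F, of "insert i U"]
    by (cases "finite U") (auto simp: lderiv_def twist_def)
qed

lemma rderiv_eq_twist_lderiv: "F \<in> ext_over R n \<Longrightarrow> rderiv i F = twist (lderiv i F)"
proof (intro ext)
  fix U p assume F: "F \<in> ext_over R n"
  show "rderiv i F U p = twist (lderiv i F) U p"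
    using ext_over_finite[OF F, of "insert i U"] shuffle_sign_swap[of U "{i}", where 'k = 'b]
    by (cases "finite U") (auto simp: lderiv_shuffle_sign rderiv_shuffle_sign twist_def)
qed

lemma lderiv_lderiv: "F \<in> ext_over R n \<Longrightarrow> lderiv i (lderiv j F) = - lderiv j (lderiv i F)"
proof (intro ext)
  fix U p assume F: "F \<in> ext_over R n"
  show "lderiv i (lderiv j F) U p = (- lderiv j (lderiv i F)) U p"
  proof (cases "i \<noteq> j \<and> i \<notin> U \<and> j \<notin> U \<and> finite U")
    case True
    have 1: "shuffle_sign {i} (insert j U) = shuffle_sign {i} {j} * (shuffle_sign {i} U :: 'b)"
      "shuffle_sign {j} (insert i U) = shuffle_sign {j} {i} * (shuffle_sign {j} U :: 'b)"
      using shuffle_sign_Un_right[of "{j}" U "{i}", where 'k = 'b] shuffle_sign_Un_right[of "{i}" U "{j}", where 'k = 'b] True by auto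
    have 2: "shuffle_sign {i} {j} = - (shuffle_sign {j} {i} :: 'b)"
      using shuffle_sign_swap[of "{i}" "{j}", where 'k = 'b] True by simp
    show ?thesis using True 1 2
      by (simp add: lderiv_shuffle_sign insert_commute)
  next
    case False
    then show ?thesis using ext_over_finite[OF F, of "insert i (insert j U)"]
      by (auto simp: lderiv_def insert_commute)
  qed
qed

text \<open>
  Homogeneity of degree \<open>k\<close> for a grading \<open>w\<close> by index sets. Two gradings occur: the
  ghost number on the BRST algebra and the exterior degree on Lie algebra cochains.
\<close>

definition homog :: "(nat set \<Rightarrow> int) \<Rightarrow> int \<Rightarrow> ('m, 'k::real_normed_field) ext \<Rightarrow> bool" where
  "homog w k F \<longleftrightarrow> (\<forall>U. F U \<noteq> 0 \<longrightarrow> w U = k)"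

text \<open>
  Additivity of \<open>w\<close> is what makes products of homogeneous elements homogeneous.
\<close>

definition weight :: "(nat set \<Rightarrow> int) \<Rightarrow> bool" where
  "weight w \<longleftrightarrow> (\<forall>A B. finite A \<longrightarrow> finite B \<longrightarrow> A \<inter> B = {} \<longrightarrow> w (A \<union> B) = w A + w B)"

lemma weightD: "weight w \<Longrightarrow> finite A \<Longrightarrow> finite B \<Longrightarrow> A \<inter> B = {} \<Longrightarrow> w (A \<union> B) = w A + w B"
  by (simp add: weight_def)

lemma homog_add:
  assumes "homog w k F" "homog w k G" shows "homog w k (F + G)"
proof -
  have "F U \<noteq> 0 \<or> G U \<noteq> 0" if "(F + G) U \<noteq> 0" for U
    using that by auto
  then show ?thesis using assms unfolding homog_def by blast
qed

lemma homog_scale: "homog w k F \<Longrightarrow> homog w k (ext_scale c F)"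
  and homog_zero [simp]: "homog w k 0"
  and homog_twist: "homog w k F \<Longrightarrow> homog w k (twist F)"
  unfolding homog_def
  subgoal by (intro allI impI, drule_tac x=U in spec) (auto simp: ext_scale_def fun_eq_iff)
  subgoal by simp
  subgoal by (intro allI impI, drule_tac x=U in spec) (auto simp: twist_def fun_eq_iff)
  done

lemma homog_sum: "(\<And>a. a \<in> X \<Longrightarrow> homog w k (f a)) \<Longrightarrow> homog w k (\<Sum>a\<in>X. f a)"
  by (induction X rule: infinite_finite_induct) (auto intro: homog_add)

lemma lderiv_nonzero: "lderiv i F U \<noteq> 0 \<Longrightarrow> i \<notin> U \<and> F (insert i U) \<noteq> 0"
proof (rule ccontr)
  assume "lderiv i F U \<noteq> 0" "\<not> (i \<notin> U \<and> F (insert i U) \<noteq> 0)"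
  moreover from this(2) have "lderiv i F U = 0"
    by (intro ext) (auto simp: lderiv_def)
  ultimately show False by blast
qed

lemma homog_lderiv:
  assumes F: "F \<in> ext_over R n" and w: "weight w" and h: "homog w k F"
  shows "homog w (k - w {i}) (lderiv i F)"
  unfolding homog_def
proof (intro allI impI)
  fix U assume "lderiv i F U \<noteq> 0"
  then have U: "i \<notin> U" "F (insert i U) \<noteq> 0"
    using lderiv_nonzero by blast+
  then have "finite U" "w ({i} \<union> U) = k"
    using ext_over_finite[OF F, of "insert i U"] h unfolding homog_def by auto
  moreover have "w ({i} \<union> U) = w {i} + w U"
    using U \<open>finite U\<close> by (intro weightD[OF w]) auto
  ultimately show "w U = k - w {i}" by simp
qed

lemma (in coef_bilinear) homog_ext_product:
  assumes F: "F \<in> ext_over R n" "homog w i F" and G: "G \<in> ext_over R n" "homog w j G" and w: "weight w"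
  shows "homog w (i + j) (ext_product B F G)"
  unfolding homog_def
proof (intro allI impI)
  fix U assume U: "ext_product B F G U \<noteq> 0"
  then have "finite U" using ext_product_infinite by blast
  obtain p where "ext_product B F G U p \<noteq> 0" using U by (auto simp: fun_eq_iff)
  then obtain T where T: "T \<subseteq> U" "B (F T) (G (U - T)) p \<noteq> 0"
    unfolding ext_product_def by (rule sum.not_neutral_contains_not_neutral) auto
  then have "F T \<noteq> 0" "G (U - T) \<noteq> 0"
    using zero_left[of "G (U - T)"] zero_right[of "F T"] F(1) G(1) unfolding ext_over_def by auto
  then have "w T = i" "w (U - T) = j" using F(2) G(2) unfolding homog_def by auto
  moreover have "w (T \<union> (U - T)) = w T + w (U - T)"
    using T \<open>finite U\<close> finite_subset[of T U] by (intro weightD[OF w]) auto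
  ultimately show "w U = i + j" using T by (simp add: Un_absorb1)
qed

lemma weight_card: "weight (\<lambda>U. int (card U))"
  by (simp add: weight_def card_Un_disjoint)

lemma parity_homog: "homog (\<lambda>U. int (card U)) k F \<Longrightarrow> parity (odd k) F"
  unfolding homog_def parity_def by (metis even_of_nat)

lemma parity_lderiv:
  assumes F: "F \<in> ext_over R n" and p: "parity e F"
  shows "parity (\<not> e) (lderiv i F)"
  unfolding parity_def
proof (intro allI impI)
  fix U assume "lderiv i F U \<noteq> 0"
  then have U: "i \<notin> U" "F (insert i U) \<noteq> 0"
    using lderiv_nonzero by blast+
  then have "finite U" "odd (card (insert i U)) \<longleftrightarrow> e"
    using ext_over_finite[OF F, of "insert i U"] p unfolding parity_def by auto
  then show "odd (card U) \<longleftrightarrow> \<not> e" using U by auto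
qed

lemma parity_twist: "parity e F \<Longrightarrow> parity e (twist F)"
  unfolding parity_def by (intro allI impI, drule_tac x=U in spec) (auto simp: twist_def fun_eq_iff)

lemma parity_twist_if: "parity e F \<Longrightarrow> parity e (twist_if d F)"
  by (auto simp: twist_if_def parity_twist)

lemma (in coef_bilinear) ext_over_add: "F \<in> ext_over R n \<Longrightarrow> G \<in> ext_over R n \<Longrightarrow> F + G \<in> ext_over R n"
  and ext_over_scale: "F \<in> ext_over R n \<Longrightarrow> ext_scale c F \<in> ext_over R n"
  and ext_over_twist: "F \<in> ext_over R n \<Longrightarrow> twist F \<in> ext_over R n"
  and ext_over_zero: "0 \<in> ext_over R n"
  by (auto simp: ext_over_def ext_scale_def twist_def add_mem scale_mem zero_mem)

lemma (in coef_bilinear) ext_over_uminus: "F \<in> ext_over R n \<Longrightarrow> - F \<in> ext_over R n"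
  using ext_over_scale[of F n "- 1"] by (simp add: ext_scale_uminus)

lemma (in coef_bilinear) ext_over_diff: "F \<in> ext_over R n \<Longrightarrow> G \<in> ext_over R n \<Longrightarrow> F - G \<in> ext_over R n"
  using ext_over_add[OF _ ext_over_uminus, of F n G] by simp

lemma (in coef_bilinear) ext_over_twist_if: "F \<in> ext_over R n \<Longrightarrow> twist_if e F \<in> ext_over R n"
  by (simp add: twist_if_def ext_over_twist)

lemma (in coef_bilinear) ext_over_sum:
  "(\<And>a. a \<in> X \<Longrightarrow> f a \<in> ext_over R n) \<Longrightarrow> (\<Sum>a\<in>X. f a) \<in> ext_over R n"
  by (induction X rule: infinite_finite_induct) (auto simp: ext_over_add ext_over_zero)

lemma (in coef_bilinear) ext_over_lderiv:
  assumes "F \<in> ext_over R n" shows "lderiv i F \<in> ext_over R n"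
proof -
  have e: "lderiv i F U = (if i \<in> U then 0 else (\<lambda>p. (-1) ^ card {j \<in> U. j < i} * F (insert i U) p))" for U
    by (auto simp: lderiv_def fun_eq_iff)
  show ?thesis
    using assms unfolding ext_over_def e by (auto simp: zero_mem scale_mem)
qed

lemma (in coef_bilinear) ext_product_uminus_left:
  "F \<in> ext_over R n \<Longrightarrow> G \<in> ext_over R n \<Longrightarrow> ext_product B (- F) G = - ext_product B F G"
  using ext_product_scale_left[of F n G "- 1"] by (simp add: ext_scale_uminus)

lemma (in coef_bilinear) ext_product_uminus_right:
  "F \<in> ext_over R n \<Longrightarrow> G \<in> ext_over R n \<Longrightarrow> ext_product B F (- G) = - ext_product B F G"
  using ext_product_scale_right[of F n G "- 1"] by (simp add: ext_scale_uminus)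

lemma (in coef_bilinear) ext_product_zero_left: "G \<in> ext_over R n \<Longrightarrow> ext_product B 0 G = 0"
  using ext_product_add_left[of 0 n 0 G] ext_over_zero by simp

lemma (in coef_bilinear) ext_product_zero_right: "G \<in> ext_over R n \<Longrightarrow> ext_product B G 0 = 0"
  using ext_product_add_right[of 0 n 0 G] ext_over_zero by simp

lemma (in coef_bilinear) ext_product_sum_left:
  "(\<And>a. a \<in> X \<Longrightarrow> f a \<in> ext_over R n) \<Longrightarrow> G \<in> ext_over R n \<Longrightarrow>
    ext_product B (\<Sum>a\<in>X. f a) G = (\<Sum>a\<in>X. ext_product B (f a) G)"
  by (induction X rule: infinite_finite_induct)
    (auto simp: ext_product_add_left[of _ n] ext_product_zero_left[of _ n] ext_over_sum)

lemma (in coef_bilinear) ext_product_sum_right: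
  "(\<And>a. a \<in> X \<Longrightarrow> f a \<in> ext_over R n) \<Longrightarrow> G \<in> ext_over R n \<Longrightarrow>
    ext_product B G (\<Sum>a\<in>X. f a) = (\<Sum>a\<in>X. ext_product B G (f a))"
  by (induction X rule: infinite_finite_induct)
    (auto simp: ext_product_add_right[of _ n] ext_product_zero_right[of _ n] ext_over_sum)

text \<open>
  A derivation of the coefficients, applied to each coefficient, meets no generator and thus produces
  no signs.
\<close>

lemma (in coef_bilinear) ext_product_derivation:
  assumes F: "F \<in> ext_over R n" and G: "G \<in> ext_over R n"
    and add: "\<And>f g. f \<in> R \<Longrightarrow> g \<in> R \<Longrightarrow> \<delta> (f + g) = \<delta> f + \<delta> g"
    and scale: "\<And>f c. f \<in> R \<Longrightarrow> \<delta> (\<lambda>p. c * f p) = (\<lambda>p. c * \<delta> f p)"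
    and leibniz: "\<And>f g. f \<in> R \<Longrightarrow> g \<in> R \<Longrightarrow> \<delta> (B f g) = B (\<delta> f) g + B f (\<delta> g)"
  shows "(\<lambda>U. \<delta> (ext_product B F G U)) = ext_product B (\<lambda>U. \<delta> (F U)) G + ext_product B F (\<lambda>U. \<delta> (G U))"
proof (intro ext)
  fix U p
  have d0: "\<delta> 0 = 0" using add[of 0 0] zero_mem by simp
  have sum: "(\<And>x. x \<in> X \<Longrightarrow> g x \<in> R) \<Longrightarrow>
    \<delta> (\<lambda>p. \<Sum>x\<in>X. c x * g x p) = (\<lambda>p. \<Sum>x\<in>X. c x * \<delta> (g x) p)" for X :: "nat set set" and g and c :: "nat set \<Rightarrow> 'k"
  proof (induction X rule: infinite_finite_induct)
    case (insert x X)
    have e: "(\<lambda>p. \<Sum>x\<in>insert x X. c x * g x p) = (\<lambda>p. c x * g x p) + (\<lambda>p. \<Sum>x\<in>X. c x * g x p)"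
      using insert by (simp add: fun_eq_iff)
    have "\<delta> (\<lambda>p. \<Sum>x\<in>insert x X. c x * g x p) = \<delta> (\<lambda>p. c x * g x p) + \<delta> (\<lambda>p. \<Sum>x\<in>X. c x * g x p)"
      unfolding e by (rule add) (use insert in \<open>auto intro!: scale_mem sum_mem\<close>)
    also have "\<dots> = (\<lambda>p. \<Sum>x\<in>insert x X. c x * \<delta> (g x) p)"
      using insert by (simp add: scale fun_eq_iff)
    finally show ?case .
  qed (use d0 in \<open>auto simp: zero_fun_def\<close>)
  have "\<delta> (ext_product B F G U) = (\<lambda>p. \<Sum>T\<in>Pow U. shuffle_sign T (U - T) * \<delta> (B (F T) (G (U - T))) p)"
    unfolding ext_product_def using F G by (intro sum closed) (auto simp: ext_over_def)
  then show "\<delta> (ext_product B F G U) p =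
    (ext_product B (\<lambda>U. \<delta> (F U)) G + ext_product B F (\<lambda>U. \<delta> (G U))) U p"
    using F G by (simp add: ext_product_def ext_over_def leibniz distrib_left sum.distrib)
qed

lemma cochain0_eq_monomial: "cochain0 h = monomial h {}"
  by (simp add: cochain0_def monomial_def)

text \<open>
  Multiplication from the left by a generator with a number smaller than all others is already in
  increasing order.
\<close>

lemma gen_wedge_mono:
  assumes "finite U" "\<And>j. j \<in> U \<Longrightarrow> i < j"
  shows "gen i \<and>\<^sub>e monomial h U = monomial h (insert i U)"
proof (intro ext)
  fix V p
  have iU: "i \<notin> U" using assms(2) by blast
  show "(gen i \<and>\<^sub>e monomial h U) V p = monomial h (insert i U) V p"
  proof (cases "finite V \<and> i \<in> V")
    case True
    have "(gen i \<and>\<^sub>e monomial h U) V p = (\<Sum>T\<in>{{i}}. shuffle_sign T (V - T) * gen i T p * monomial h U (V - T) p)"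
      unfolding wedge_def using True by (intro sum.mono_neutral_right) (auto simp: gen_def)
    also have "\<dots> = monomial h (insert i U) V p"
    proof (cases "V - {i} = U")
      case True
      have "{(s, t). s \<in> {i} \<and> t \<in> U \<and> t < s} = {}" using assms(2) by force
      then have "shuffle_sign {i} U = (1 :: 'b)" unfolding shuffle_sign_def by (simp only: card.empty power_0)
      then show ?thesis using True \<open>finite V \<and> i \<in> V\<close> by (auto simp: gen_def monomial_def)
    next
      case False
      then have "V \<noteq> insert i U" using iU by auto
      then show ?thesis using False by (simp add: monomial_def)
    qed
    finally show ?thesis .
  next
    case False
    then consider "infinite V" | "i \<notin> V" by blast
    then show ?thesis
    proof cases
      case 1
      then have "V \<noteq> insert i U" using assms(1) by auto
      then show ?thesis using 1 by (simp add: wedge_def monomial_def)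
    next
      case 2
      then have "V \<noteq> insert i U" "\<And>T. T \<subseteq> V \<Longrightarrow> gen i T p = (0 :: 'b)" by (auto simp: gen_def)
      then show ?thesis by (auto simp: wedge_def monomial_def intro!: sum.neutral)
    qed
  qed
qed

text \<open>
  The exterior algebra is additively generated by monomials, and a monomial arises from its coefficient
  by multiplying with its generators from the left, the one with the smallest number last.
\<close>

lemma ext_over_induct [consumes 2, case_names base step add]:
  assumes F: "F \<in> ext_over R n"
    and R: "0 \<in> R"
    and base: "\<And>h. h \<in> R \<Longrightarrow> P (monomial h {})"
    and step: "\<And>i h U. i < n \<Longrightarrow> U \<subseteq> {..<n} \<Longrightarrow> h \<in> R \<Longrightarrow> monomial h U \<in> ext_over R n \<Longrightarrow>
      P (monomial h U) \<Longrightarrow> P (gen i \<and>\<^sub>e monomial h U)"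
    and add: "\<And>F G. F \<in> ext_over R n \<Longrightarrow> G \<in> ext_over R n \<Longrightarrow> P F \<Longrightarrow> P G \<Longrightarrow> P (F + G)"
  shows "P F"
proof -
  have mem: "monomial h U \<in> ext_over R n" if "h \<in> R" "U \<subseteq> {..<n}" for h U
    using that R by (auto simp: ext_over_def monomial_def)
  have mono: "P (monomial h U)" if h: "h \<in> R" and "U \<subseteq> {..<n}" for h U
    using finite_subset[OF that(2) finite_lessThan] that(2)
  proof (induction U rule: finite_linorder_min_induct)
    case empty
    then show ?case using base h by blast
  next
    case (insert i U)
    then show ?case using step[of i U h] gen_wedge_mono[of U i h] mem h by simp
  qed
  \<comment> \<open>the part of \<open>F\<close> with index sets in \<open>X\<close>\<close>
  let ?r = "\<lambda>X U. if U \<in> X then F U else 0"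
  have "?r X \<in> ext_over R n \<and> P (?r X)" if "finite X" "X \<subseteq> Pow {..<n}" for X
    using that
  proof (induction X)
    case empty
    have "(\<lambda>U. if U \<in> {} then F U else 0) = monomial 0 {}" by (auto simp: monomial_def)
    then show ?case using base[OF R] mem[OF R, of "{}"] by (simp only: empty_subsetI simp_thms)
  next
    case (insert U X)
    have "?r (insert U X) = monomial (F U) U + ?r X"
      using insert by (auto simp: monomial_def fun_eq_iff)
    moreover have "?r (insert U X) \<in> ext_over R n"
      using F R by (auto simp: ext_over_def)
    moreover have "F U \<in> R" using F by (auto simp: ext_over_def)
    ultimately show ?case using add[of "monomial (F U) U" "?r X"] insert mono mem by simp
  qed
  from this[of "Pow {..<n}"] have "P (?r (Pow {..<n}))" by simp
  moreover have "?r (Pow {..<n}) = F" using F by (auto simp: ext_over_def)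
  ultimately show ?thesis by simp
qed

lemma ext_product_monomial0_left:
  assumes "\<And>V. B 0 (G V) = 0"
  shows "ext_product B (monomial h {}) G U = (if finite U then B h (G U) else 0)"
proof (cases "finite U")
  case True
  have "ext_product B (monomial h {}) G U p = B h (G U) p" for p
  proof -
    have "ext_product B (monomial h {}) G U p =
      (\<Sum>T\<in>{{}}. shuffle_sign T (U - T) * B (monomial h {} T) (G (U - T)) p)"
      unfolding ext_product_def using True
      by (intro sum.mono_neutral_right) (auto simp: monomial_def assms)
    then show ?thesis by (simp add: monomial_def)
  qed
  then show ?thesis using True by auto
qed (simp add: ext_product_infinite)

lemma ext_product_monomial0_right:
  assumes "\<And>V. B (G V) 0 = 0"
  shows "ext_product B G (monomial h {}) U = (if finite U then B (G U) h else 0)"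
proof (cases "finite U")
  case True
  have "ext_product B G (monomial h {}) U p = B (G U) h p" for p
  proof -
    have "ext_product B G (monomial h {}) U p =
      (\<Sum>T\<in>{U}. shuffle_sign T (U - T) * B (G T) (monomial h {} (U - T)) p)"
      unfolding ext_product_def using True
      by (intro sum.mono_neutral_right) (auto simp: monomial_def assms)
    then show ?thesis by (simp add: monomial_def)
  qed
  then show ?thesis using True by auto
qed (simp add: ext_product_infinite)

lemma lderiv_monomial0 [simp]: "lderiv i (monomial h {}) = 0"
  by (auto simp: lderiv_def monomial_def fun_eq_iff)

lemma lderiv_gen: "lderiv i (gen j) = (if i = j then monomial 1 {} else 0)"
proof (intro ext)
  fix U p
  have "insert i U = {j} \<longleftrightarrow> i = j \<and> (U = {} \<or> U = {j})" by auto
  then show "lderiv i (gen j) U p = (if i = j then monomial 1 {} else 0) U p"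
    by (auto simp: lderiv_def monomial_def gen_def)
qed

section \<open>Smooth functions as coefficients\<close>

lemma coef_bilinear_UNIV: "coef_bilinear UNIV (*)"
  by unfold_locales (auto simp: fun_eq_iff algebra_simps)

context hamiltonian_space
begin

abbreviation R :: "('m \<Rightarrow> 'k) set" where "R \<equiv> smooth_funs S"
abbreviation N :: nat where "N \<equiv> 2 * lie_dim S"

lemma
  assumes "f \<in> R" "g \<in> R"
  shows pbr_closed: "pbr S f g \<in> R"
    and pbr_antisym: "pbr S f g = - pbr S g f"
  using symplectic_manifold.br_closed[OF symplectic] symplectic_manifold.br_antisym[OF symplectic] assms
  unfolding smooth_funs_def pbr_def by blast+

lemma pbr_leibniz:
  assumes "f \<in> R" "g \<in> R" "h \<in> R"
  shows "pbr S f (g * h) = pbr S f g * h + g * pbr S f h"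
    and "pbr S (f * g) h = f * pbr S g h + pbr S f h * g"
  using symplectic_manifold.br_mult_right[OF symplectic] symplectic_manifold.br_mult_left[OF symplectic] assms
  unfolding smooth_funs_def pbr_def by blast+

lemma pbr_jacobi:
  "f \<in> R \<Longrightarrow> g \<in> R \<Longrightarrow> h \<in> R \<Longrightarrow> pbr S f (pbr S g h) = pbr S (pbr S f g) h + pbr S g (pbr S f h)"
  using symplectic_manifold.br_jacobi[OF symplectic]
  unfolding smooth_funs_def pbr_def by blast

sublocale manifold: smooth_manifold "atlas S"
  using symplectic by (rule symplectic_manifold.axioms(1))

lemma smooth_funs_mult: "f \<in> R \<Longrightarrow> g \<in> R \<Longrightarrow> f * g \<in> R"
  and smooth_funs_1: "1 \<in> R" and smooth_funs_0: "0 \<in> R"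
  and smooth_funs_add: "f \<in> R \<Longrightarrow> g \<in> R \<Longrightarrow> f + g \<in> R"
  and smooth_funs_scale: "f \<in> R \<Longrightarrow> (\<lambda>p. c * f p) \<in> R"
  using manifold.Cinf_mult manifold.Cinf_1 manifold.Cinf_0 manifold.Cinf_add manifold.Cinf_scale
  unfolding smooth_funs_def by blast+

sublocale pb: coef_bilinear R "pbr S"
proof
  note br = symplectic_manifold.br_add_left[OF symplectic] symplectic_manifold.br_add_right[OF symplectic]
    symplectic_manifold.br_scale_left[OF symplectic] symplectic_manifold.br_scale_right[OF symplectic]
  show "pbr S (f + g) h = pbr S f h + pbr S g h" if "f \<in> R" "g \<in> R" "h \<in> R" for f g h
    using that unfolding smooth_funs_def pbr_def by (rule br)
  show "pbr S h (f + g) = pbr S h f + pbr S h g" if "f \<in> R" "g \<in> R" "h \<in> R" for f g h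
    using that(3,1,2) unfolding smooth_funs_def pbr_def by (rule br)
  show "pbr S (\<lambda>p. c * f p) g = (\<lambda>p. c * pbr S f g p)" if "f \<in> R" "g \<in> R" for f g c
    using that unfolding smooth_funs_def pbr_def by (rule br)
  show "pbr S f (\<lambda>p. c * g p) = (\<lambda>p. c * pbr S f g p)" if "f \<in> R" "g \<in> R" for f g c
    using that unfolding smooth_funs_def pbr_def by (rule br)
qed (fact smooth_funs_0 smooth_funs_add smooth_funs_scale pbr_closed)+

sublocale mul: coef_bilinear R "(*)"
  using smooth_funs_0 smooth_funs_add smooth_funs_scale smooth_funs_mult
  by unfold_locales (auto simp: fun_eq_iff algebra_simps)

text \<open>
  The Leibniz rule for \<open>1 * 1\<close>.
\<close>

lemma pbr_const: "f \<in> R \<Longrightarrow> pbr S f 1 = 0"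
  using pbr_leibniz(1)[of f 1 1] smooth_funs_1 by simp

abbreviation E :: "('m, 'k) ext set" where "E \<equiv> ext_over R N"

lemma brst_eq: "brst S = E"
  by (simp add: brst_def)

lemmas E_add = mul.ext_over_add[where n = N]
lemmas E_diff = mul.ext_over_diff[where n = N]
lemmas E_uminus = mul.ext_over_uminus[where n = N]
lemmas E_scale = mul.ext_over_scale[where n = N]
lemmas E_zero = mul.ext_over_zero[where n = N]
lemmas E_twist = mul.ext_over_twist[where n = N]
lemmas E_twist_if = mul.ext_over_twist_if[where n = N]
lemmas E_lderiv = mul.ext_over_lderiv[where n = N]
lemmas E_sum = mul.ext_over_sum[where n = N]
lemmas E_wedge = mul.ext_product_closed[where n = N, folded wedge_eq_ext_product]
lemmas E_intros = E_add E_diff E_uminus E_scale E_zero E_twist E_twist_if E_lderiv E_sum E_wedge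

lemmas wedge_add_left = mul.ext_product_add_left[where n = N, folded wedge_eq_ext_product]
lemmas wedge_add_right = mul.ext_product_add_right[where n = N, folded wedge_eq_ext_product]
lemmas wedge_uminus_left = mul.ext_product_uminus_left[where n = N, folded wedge_eq_ext_product]
lemmas wedge_uminus_right = mul.ext_product_uminus_right[where n = N, folded wedge_eq_ext_product]
lemmas wedge_scale_left = mul.ext_product_scale_left[where n = N, folded wedge_eq_ext_product]
lemmas wedge_scale_right = mul.ext_product_scale_right[where n = N, folded wedge_eq_ext_product]
lemmas wedge_zero_left = mul.ext_product_zero_left[where n = N, folded wedge_eq_ext_product]
lemmas wedge_zero_right = mul.ext_product_zero_right[where n = N, folded wedge_eq_ext_product]
lemmas wedge_sum_left = mul.ext_product_sum_left[where n = N, folded wedge_eq_ext_product]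
lemmas wedge_sum_right = mul.ext_product_sum_right[where n = N, folded wedge_eq_ext_product]
lemmas wedge_twist = mul.ext_product_twist[where n = N, folded wedge_eq_ext_product]
lemmas wedge_lderiv = mul.ext_product_lderiv[where n = N, folded wedge_eq_ext_product]

end

lemma wedge_assoc:
  fixes F G H :: "('m, 'k::real_normed_field) ext"
  assumes "F \<in> ext_over UNIV n" "G \<in> ext_over UNIV n" "H \<in> ext_over UNIV n"
  shows "(F \<and>\<^sub>e G) \<and>\<^sub>e H = F \<and>\<^sub>e (G \<and>\<^sub>e H)"
proof -
  interpret coef_bilinear UNIV "(*) :: ('m \<Rightarrow> 'k) \<Rightarrow> _" by (rule coef_bilinear_UNIV)
  have e: "(\<lambda>f g h :: 'm \<Rightarrow> 'k. f * g * h) = (\<lambda>f g h. f * (g * h))"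
    by (intro ext) (simp add: mult.assoc)
  show ?thesis
    unfolding wedge_eq_ext_product
    by (subst ext_product_assoc_right[OF assms(1)], simp, subst ext_product_assoc_left[OF assms(3)], simp)
      (simp only: e)
qed

lemma wedge_swap:
  fixes F G :: "('m, 'k::real_normed_field) ext"
  assumes "F \<in> ext_over UNIV n" "G \<in> ext_over UNIV n" "parity e F"
  shows "F \<and>\<^sub>e G = twist_if e G \<and>\<^sub>e F"
proof -
  interpret coef_bilinear UNIV "(*) :: ('m \<Rightarrow> 'k) \<Rightarrow> _" by (rule coef_bilinear_UNIV)
  show ?thesis
    unfolding wedge_eq_ext_product ext_product_swap[OF assms] by (simp only: mult.commute)
qed

lemma ext_over_UNIV: "F \<in> ext_over R n \<Longrightarrow> F \<in> ext_over UNIV n"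
  by (auto simp: ext_over_def)

lemma wedge_one_left: "G \<in> ext_over UNIV n \<Longrightarrow> monomial h {} \<and>\<^sub>e G = (\<lambda>U. h * G U)"
  for G :: "('m, 'k::real_normed_field) ext"
  using ext_over_finite[of G UNIV n] unfolding wedge_eq_ext_product
  by (intro ext) (simp add: ext_product_monomial0_left)

lemma wedge_one_right: "G \<in> ext_over UNIV n \<Longrightarrow> G \<and>\<^sub>e monomial h {} = (\<lambda>U. G U * h)"
  for G :: "('m, 'k::real_normed_field) ext"
  using ext_over_finite[of G UNIV n] unfolding wedge_eq_ext_product
  by (intro ext) (simp add: ext_product_monomial0_right)

section \<open>Leibniz rule and antisymmetry of the BRST bracket\<close>

context hamiltonian_space
begin

text \<open>
  The number of the generator conjugate to the generator with number \<open>i\<close>: it exchanges ghosts and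
  antighosts.
\<close>

definition dual :: "nat \<Rightarrow> nat" where
  "dual i = (if i < lie_dim S then lie_dim S + i else i - lie_dim S)"

lemma dual_less: "i < N \<Longrightarrow> dual i < N" and dual_dual: "i < N \<Longrightarrow> dual (dual i) = i"
  by (auto simp: dual_def)

lemma sum_dual: "(\<Sum>i<N. f i (dual i)) = (\<Sum>i<N. f (dual i) i)"
  by (rule sum.reindex_bij_witness[of _ dual dual]) (auto simp: dual_less dual_dual)

lemma sum_ghosts_antighosts:
  "(\<Sum>i<N. f i) = (\<Sum>a<lie_dim S. f a) + (\<Sum>a<lie_dim S. f (lie_dim S + a))"
  for f :: "nat \<Rightarrow> 'b::comm_monoid_add"
proof -
  have "{..<N} = {..<lie_dim S} \<union> (+) (lie_dim S) ` {..<lie_dim S}"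
  proof (intro equalityI subsetI)
    fix x assume "x \<in> {..<N}"
    then have "x < lie_dim S \<or> x = lie_dim S + (x - lie_dim S) \<and> x - lie_dim S < lie_dim S" by auto
    then show "x \<in> {..<lie_dim S} \<union> (+) (lie_dim S) ` {..<lie_dim S}" by blast
  qed auto
  moreover have "{..<lie_dim S} \<inter> (+) (lie_dim S) ` {..<lie_dim S} = {}" by auto
  ultimately show ?thesis by (simp only: sum.union_disjoint finite_lessThan finite_imageI) (simp add: sum.reindex)
qed

abbreviation bracket where "bracket \<equiv> brst_bracket S"
abbreviation PB where "PB \<equiv> ext_product (pbr S)"

text \<open>
  The bracket of the exterior algebra, written as one sum over all generators and with left derivatives
  only; a right derivative is the twist of the left one.
\<close>

definition ghost_part :: "('m, 'k) ext \<Rightarrow> ('m, 'k) ext \<Rightarrow> ('m, 'k) ext" where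
  "ghost_part F G = ext_scale 2 (\<Sum>i<N. twist (lderiv (dual i) F) \<and>\<^sub>e lderiv i G)"

lemma ghost_bracket_eq: "F \<in> E \<Longrightarrow> ghost_bracket S F G = ghost_part F G"
  unfolding ghost_bracket_def ghost_part_def sum_ghosts_antighosts
  by (intro ext) (simp add: ext_scale_def dual_def sum_ext_apply sum.distrib rderiv_eq_twist_lderiv)

lemma bracket_eq: "F \<in> E \<Longrightarrow> bracket F G = PB F G + ghost_part F G"
  unfolding brst_bracket_def by (intro ext) (simp add: ext_product_def ghost_bracket_eq)

lemma ghost_part_closed: "F \<in> E \<Longrightarrow> G \<in> E \<Longrightarrow> ghost_part F G \<in> E"
  unfolding ghost_part_def by (intro E_intros)

lemma bracket_closed: "F \<in> E \<Longrightarrow> G \<in> E \<Longrightarrow> bracket F G \<in> E"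
  by (simp add: bracket_eq E_add ghost_part_closed pb.ext_product_closed)

lemma ghost_part_add_left: "F \<in> E \<Longrightarrow> G \<in> E \<Longrightarrow> H \<in> E \<Longrightarrow> ghost_part (F + G) H = ghost_part F H + ghost_part G H"
  by (simp add: ghost_part_def lderiv_add twist_add wedge_add_left E_intros sum.distrib ext_scale_add)

lemma ghost_part_add_right: "F \<in> E \<Longrightarrow> G \<in> E \<Longrightarrow> H \<in> E \<Longrightarrow> ghost_part H (F + G) = ghost_part H F + ghost_part H G"
  by (simp add: ghost_part_def lderiv_add wedge_add_right E_intros sum.distrib ext_scale_add)

lemma ghost_part_scale_left: "F \<in> E \<Longrightarrow> G \<in> E \<Longrightarrow> ghost_part (ext_scale c F) G = ext_scale c (ghost_part F G)"
  by (simp add: ghost_part_def lderiv_scale twist_scale wedge_scale_left E_intros ext_scale_sum ext_scale_scale mult.commute[of c 2])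

lemma ghost_part_scale_right: "F \<in> E \<Longrightarrow> G \<in> E \<Longrightarrow> ghost_part F (ext_scale c G) = ext_scale c (ghost_part F G)"
  by (simp add: ghost_part_def lderiv_scale wedge_scale_right E_intros ext_scale_sum ext_scale_scale mult.commute[of c 2])

lemma bracket_add_left: "F \<in> E \<Longrightarrow> G \<in> E \<Longrightarrow> H \<in> E \<Longrightarrow> bracket (F + G) H = bracket F H + bracket G H"
  by (simp add: bracket_eq E_add ghost_part_add_left pb.ext_product_add_left[where n = N])

lemma bracket_add_right: "F \<in> E \<Longrightarrow> G \<in> E \<Longrightarrow> H \<in> E \<Longrightarrow> bracket H (F + G) = bracket H F + bracket H G"
  by (simp add: bracket_eq ghost_part_add_right pb.ext_product_add_right[where n = N])

lemma bracket_scale_left: "F \<in> E \<Longrightarrow> G \<in> E \<Longrightarrow> bracket (ext_scale c F) G = ext_scale c (bracket F G)"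
  by (simp add: bracket_eq E_scale ghost_part_scale_left pb.ext_product_scale_left[where n = N] ext_scale_add)

lemma bracket_scale_right: "F \<in> E \<Longrightarrow> G \<in> E \<Longrightarrow> bracket F (ext_scale c G) = ext_scale c (bracket F G)"
  by (simp add: bracket_eq ghost_part_scale_right pb.ext_product_scale_right[where n = N] ext_scale_add)

lemma bracket_uminus_left: "F \<in> E \<Longrightarrow> G \<in> E \<Longrightarrow> bracket (- F) G = - bracket F G"
  using bracket_scale_left[of F G "- 1"] by (simp add: ext_scale_uminus)

lemma bracket_uminus_right: "F \<in> E \<Longrightarrow> G \<in> E \<Longrightarrow> bracket F (- G) = - bracket F G"
  using bracket_scale_right[of F G "- 1"] by (simp add: ext_scale_uminus)

lemma bracket_diff_left: "F \<in> E \<Longrightarrow> G \<in> E \<Longrightarrow> H \<in> E \<Longrightarrow> bracket (F - G) H = bracket F H - bracket G H"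
  using bracket_add_left[of F "- G" H] by (simp add: E_uminus bracket_uminus_left)

lemma bracket_diff_right: "F \<in> E \<Longrightarrow> G \<in> E \<Longrightarrow> H \<in> E \<Longrightarrow> bracket H (F - G) = bracket H F - bracket H G"
  using bracket_add_right[of F "- G" H] by (simp add: E_uminus bracket_uminus_right)

lemma bracket_zero_left: "F \<in> E \<Longrightarrow> bracket 0 F = 0" and bracket_zero_right: "F \<in> E \<Longrightarrow> bracket F 0 = 0"
  using bracket_diff_left[of F F F] bracket_diff_right[of F F F] by auto

lemma ghost_part_twist: "F \<in> E \<Longrightarrow> G \<in> E \<Longrightarrow> twist (ghost_part F G) = ghost_part (twist F) (twist G)"
  by (simp add: ghost_part_def twist_scale twist_sum wedge_twist E_intros lderiv_twist[where n = N] twist_uminus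
      wedge_uminus_left wedge_uminus_right)

lemma bracket_twist: "F \<in> E \<Longrightarrow> G \<in> E \<Longrightarrow> twist (bracket F G) = bracket (twist F) (twist G)"
  by (simp add: bracket_eq twist_add ghost_part_twist pb.ext_product_twist[where n = N] E_twist)

lemma bracket_twist_if: "F \<in> E \<Longrightarrow> G \<in> E \<Longrightarrow> twist_if e (bracket F G) = bracket (twist_if e F) (twist_if e G)"
  by (simp add: twist_if_def bracket_twist)

text \<open>
  Derivatives with respect to generators anticommute with each other and with the twist. The signs
  arising from the two factors of each summand agree.
\<close>

lemma ghost_part_lderiv:
  assumes F: "F \<in> E" and G: "G \<in> E"
  shows "lderiv i (ghost_part F G) = ghost_part (lderiv i F) G + ghost_part (twist F) (lderiv i G)"
proof -
  have "lderiv i (twist (lderiv (dual j) F) \<and>\<^sub>e lderiv j G) =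
      twist (lderiv (dual j) (lderiv i F)) \<and>\<^sub>e lderiv j G
      + twist (lderiv (dual j) (twist F)) \<and>\<^sub>e lderiv j (lderiv i G)" for j
  proof -
    have 1: "lderiv i (twist (lderiv (dual j) F)) = twist (lderiv (dual j) (lderiv i F))"
      using lderiv_twist[OF E_lderiv[OF F], of i "dual j"] lderiv_lderiv[OF F, of i "dual j"]
      by (simp add: twist_uminus)
    have 2: "lderiv (dual j) (twist F) = - twist (lderiv (dual j) F)"
      by (rule lderiv_twist[OF F])
    have 3: "lderiv i (lderiv j G) = - lderiv j (lderiv i G)"
      by (rule lderiv_lderiv[OF G])
    show ?thesis
      using F G by (simp add: wedge_lderiv 1 2 3 E_intros twist_uminus wedge_uminus_left wedge_uminus_right)
  qed
  then show ?thesis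
    by (simp add: ghost_part_def lderiv_scale lderiv_sum sum.distrib ext_scale_add)
qed

lemma bracket_lderiv:
  assumes F: "F \<in> E" and G: "G \<in> E"
  shows "lderiv i (bracket F G) = bracket (lderiv i F) G + bracket (twist F) (lderiv i G)"
  using F G
  by (simp add: bracket_eq lderiv_add ghost_part_lderiv pb.ext_product_lderiv[where n = N] E_intros add_ac)

text \<open>
  The factor \<open>twist (lderiv (dual i) F)\<close> has parity opposite to \<open>F\<close>. Moving it past the twist of
  \<open>G\<close>, which the Leibniz rule for \<open>lderiv i\<close> produces, leaves the sign of moving \<open>F\<close> past \<open>G\<close>.
\<close>

lemma ghost_part_leibniz:
  assumes F: "F \<in> E" and G: "G \<in> E" and H: "H \<in> E" and e: "parity e F"
  shows "ghost_part F (G \<and>\<^sub>e H) = ghost_part F G \<and>\<^sub>e H + twist_if e G \<and>\<^sub>e ghost_part F H"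
proof -
  have "twist (lderiv (dual i) F) \<and>\<^sub>e lderiv i (G \<and>\<^sub>e H) =
      (twist (lderiv (dual i) F) \<and>\<^sub>e lderiv i G) \<and>\<^sub>e H
      + twist_if e G \<and>\<^sub>e (twist (lderiv (dual i) F) \<and>\<^sub>e lderiv i H)" for i
  proof -
    let ?X = "twist (lderiv (dual i) F)"
    have X: "?X \<in> E" "parity (\<not> e) ?X"
      using F e by (auto intro: E_intros parity_twist parity_lderiv)
    have "?X \<and>\<^sub>e twist G = twist_if e G \<and>\<^sub>e ?X"
      using wedge_swap[OF ext_over_UNIV[OF X(1)] ext_over_UNIV[OF E_twist[OF G]] X(2)]
      by (simp add: twist_if_twist)
    moreover have "?X \<and>\<^sub>e (lderiv i G \<and>\<^sub>e H) = (?X \<and>\<^sub>e lderiv i G) \<and>\<^sub>e H"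
      using X(1) F G H by (intro wedge_assoc[symmetric, where n = N] ext_over_UNIV[where n = N and R = R] E_intros)
    moreover have "?X \<and>\<^sub>e (twist G \<and>\<^sub>e lderiv i H) = (?X \<and>\<^sub>e twist G) \<and>\<^sub>e lderiv i H"
      using X(1) F G H by (intro wedge_assoc[symmetric, where n = N] ext_over_UNIV[where n = N and R = R] E_intros)
    moreover have "twist_if e G \<and>\<^sub>e (?X \<and>\<^sub>e lderiv i H) = (twist_if e G \<and>\<^sub>e ?X) \<and>\<^sub>e lderiv i H"
      using X(1) F G H by (intro wedge_assoc[symmetric, where n = N] ext_over_UNIV[where n = N and R = R] E_intros)
    ultimately show ?thesis
      using X G H by (simp add: wedge_lderiv wedge_add_right E_intros)
  qed
  then show ?thesis
    using F G H
    by (simp add: ghost_part_def sum.distrib ext_scale_add wedge_sum_left wedge_sum_right wedge_scale_left wedge_scale_right E_intros)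
qed

text \<open>
  The Leibniz rule of the Poisson bracket of functions, applied inside a triple product; in the second
  term the parts belonging to \<open>F\<close> and \<open>G\<close> are exchanged.
\<close>

lemma PB_leibniz:
  assumes F: "F \<in> E" and G: "G \<in> E" and H: "H \<in> E" and e: "parity e F"
  shows "PB F (G \<and>\<^sub>e H) = PB F G \<and>\<^sub>e H + twist_if e G \<and>\<^sub>e PB F H"
proof -
  have R: "F U \<in> R" "G U \<in> R" "H U \<in> R" "twist_if e G U \<in> R" for U
    using F G H E_twist_if[OF G, of e] by (auto simp: ext_over_def)
  have "PB F (G \<and>\<^sub>e H) = triple_product (\<lambda>f g h. pbr S f (g * h)) F G H"
    unfolding wedge_eq_ext_product by (rule pb.ext_product_assoc_right[OF F]) (simp add: R smooth_funs_mult)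
  also have "\<dots> = triple_product (\<lambda>f g h. pbr S f g * h) F G H + triple_product (\<lambda>f g h. g * pbr S f h) F G H"
    by (simp add: triple_product_def fun_eq_iff case_prod_unfold pbr_leibniz(1) R distrib_left sum.distrib)
  also have "triple_product (\<lambda>f g h. pbr S f g * h) F G H = PB F G \<and>\<^sub>e H"
    unfolding wedge_eq_ext_product
    by (rule mul.ext_product_assoc_left[OF H, symmetric]) (simp add: R pbr_closed)
  also have "triple_product (\<lambda>f g h. g * pbr S f h) F G H
      = triple_product (\<lambda>g f h. g * pbr S f h) (twist_if e G) F H"
    by (rule triple_product_swap[OF e]) (simp_all add: R pb.zero_left fun_eq_iff)
  also have "\<dots> = twist_if e G \<and>\<^sub>e PB F H"
    unfolding wedge_eq_ext_product
    by (rule mul.ext_product_assoc_right[OF E_twist_if[OF G], symmetric]) (simp add: R pbr_closed)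
  finally show ?thesis .
qed

lemma bracket_leibniz:
  assumes F: "F \<in> E" and G: "G \<in> E" and H: "H \<in> E" and e: "parity e F"
  shows "bracket F (G \<and>\<^sub>e H) = bracket F G \<and>\<^sub>e H + twist_if e G \<and>\<^sub>e bracket F H"
  using assms
  by (simp add: bracket_eq ghost_part_leibniz PB_leibniz wedge_add_left wedge_add_right E_intros ghost_part_closed pb.ext_product_closed
      add_ac)

text \<open>
  Exchanging the factors of each summand and renaming \<open>i\<close> to \<open>dual i\<close>.
\<close>

lemma ghost_part_antisym:
  assumes F: "F \<in> E" and G: "G \<in> E" and e: "parity e F"
  shows "ghost_part F G = - ghost_part (twist_if e G) F"
proof -
  have "twist (lderiv (dual i) F) \<and>\<^sub>e lderiv i G = - (twist (lderiv i (twist_if e G)) \<and>\<^sub>e lderiv (dual i) F)" for i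
  proof -
    let ?X = "lderiv (dual i) F"
    have X: "?X \<in> E" "parity (\<not> e) ?X"
      using F e by (auto intro: E_intros parity_lderiv)
    have t: "twist ?X = (if e then ?X else - ?X)"
      using twist_if_parity[OF X(2), of True] by (auto simp: twist_if_def)
    have "?X \<and>\<^sub>e lderiv i G = twist_if (\<not> e) (lderiv i G) \<and>\<^sub>e ?X"
      by (rule wedge_swap[OF ext_over_UNIV[OF X(1)] ext_over_UNIV[OF E_lderiv[OF G]] X(2)])
    then show ?thesis
      using X G F by (simp add: t twist_if_def lderiv_twist[OF G] wedge_uminus_left twist_uminus E_intros)
  qed
  then have "ghost_part F G = - ext_scale 2 (\<Sum>i<N. twist (lderiv i (twist_if e G)) \<and>\<^sub>e lderiv (dual i) F)"
    by (simp add: ghost_part_def sum_negf ext_scale_minus)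
  then show ?thesis
    by (simp add: ghost_part_def sum_dual[of "\<lambda>i j. twist (lderiv i (twist_if e G)) \<and>\<^sub>e lderiv j F"])
qed

lemma PB_antisym:
  assumes F: "F \<in> E" and G: "G \<in> E" and e: "parity e F"
  shows "PB F G = - PB (twist_if e G) F"
proof -
  have R: "F U \<in> R" "twist_if e G U \<in> R" for U
    using F E_twist_if[OF G, of e] by (auto simp: ext_over_def)
  show ?thesis
    unfolding pb.ext_product_swap[OF F G e] unfolding ext_product_def
    by (intro ext) (simp add: pbr_antisym[OF R(1) R(2)] sum_negf)
qed

lemma bracket_antisym:
  assumes F: "F \<in> E" and G: "G \<in> E" and e: "parity e F"
  shows "bracket F G = - bracket (twist_if e G) F"
  using assms by (simp add: bracket_eq ghost_part_antisym PB_antisym E_twist_if)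

end

section \<open>Graded Jacobi identity of the BRST bracket\<close>

text \<open>
  Parity as an eigenvalue of the twist, which is compatible with all operations.
\<close>

lemma parity_iff_twist: "parity e F \<longleftrightarrow> twist F = (if e then - F else F)"
proof
  assume "parity e F"
  then show "twist F = (if e then - F else F)"
    using twist_if_parity[of e F True] by (simp add: twist_if_def)
next
  assume t: "twist F = (if e then - F else F)"
  show "parity e F" unfolding parity_def
  proof (intro allI impI)
    fix U assume "F U \<noteq> 0"
    then obtain p where p: "F U p \<noteq> 0" by (auto simp: fun_eq_iff)
    have "(-1) ^ card U * F U p = (if e then - F U p else F U p)"
      using fun_cong[OF fun_cong[OF t], of U p] by (simp add: twist_def split: if_splits)
    then show "odd (card U) \<longleftrightarrow> e"
      using p by (cases "even (card U)"; cases e) auto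
  qed
qed

context hamiltonian_space
begin

lemma parity_bracket:
  assumes "F \<in> E" "G \<in> E" "parity e F" "parity d G"
  shows "parity (e \<noteq> d) (bracket F G)"
  using assms unfolding parity_iff_twist
  by (auto simp: bracket_twist bracket_uminus_left bracket_uminus_right E_intros)

lemma gen_mem: "i < N \<Longrightarrow> gen i \<in> E"
proof -
  assume i: "i < N"
  have g: "gen i U = (if U = {i} then 1 else 0)" for U :: "nat set"
    by (auto simp: gen_def fun_eq_iff)
  show ?thesis unfolding ext_over_def g using i by (auto simp: smooth_funs_0 smooth_funs_1)
qed

lemma monomial_mem: "h \<in> R \<Longrightarrow> monomial h {} \<in> E"
  by (auto simp: ext_over_def monomial_def smooth_funs_0)

lemma wedge_monomial1: "F \<in> E \<Longrightarrow> F \<and>\<^sub>e monomial 1 {} = F"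
  using wedge_one_right[OF ext_over_UNIV, of F R N 1] by simp

text \<open>
  Bracketing with a generator differentiates with respect to the conjugate generator. The factor 2 is
  the one in \<open>{\<xi>\<^sub>a, \<xi>\<^sup>b} = 2 \<delta>\<^sub>a\<^sup>b\<close>.
\<close>

lemma bracket_gen:
  assumes F: "F \<in> E" and i: "i < N"
  shows "bracket F (gen i) = ext_scale 2 (twist (lderiv (dual i) F))"
proof -
  have c: "pbr S (F T) (gen i V) = 0" for T V
  proof -
    have "gen i V = (if V = {i} then 1 else 0 :: 'm \<Rightarrow> 'k)" by (auto simp: gen_def fun_eq_iff)
    moreover have "F T \<in> R" using F by (simp add: ext_over_def)
    ultimately show ?thesis using pbr_const pb.zero_right by (metis (full_types))
  qed
  have "PB F (gen i) = 0"
    by (auto simp: ext_product_def c fun_eq_iff)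
  moreover have "(\<Sum>j<N. twist (lderiv (dual j) F) \<and>\<^sub>e lderiv j (gen i)) =
      (\<Sum>j<N. if i = j then twist (lderiv (dual j) F) else 0)"
    using F by (intro sum.cong refl) (auto simp: lderiv_gen wedge_monomial1 wedge_zero_right E_intros)
  moreover have "\<dots> = twist (lderiv (dual i) F)" using i by simp
  ultimately show ?thesis using F by (simp add: bracket_eq ghost_part_def)
qed

text \<open>
  Bracketing with a function from the left: functions involve no generators, so only the
  coefficients are affected.
\<close>

definition ad :: "('m \<Rightarrow> 'k) \<Rightarrow> ('m, 'k) ext \<Rightarrow> ('m, 'k) ext" where
  "ad h F = (\<lambda>U. pbr S h (F U))"

lemma ad_mem: "h \<in> R \<Longrightarrow> F \<in> E \<Longrightarrow> ad h F \<in> E"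
  by (auto simp: ad_def ext_over_def pbr_closed pb.zero_right)

lemma ad_add: "h \<in> R \<Longrightarrow> F \<in> E \<Longrightarrow> G \<in> E \<Longrightarrow> ad h (F + G) = ad h F + ad h G"
  by (auto simp: ad_def ext_over_def pb.add_right fun_eq_iff)

lemma ad_scale: "h \<in> R \<Longrightarrow> F \<in> E \<Longrightarrow> ad h (ext_scale c F) = ext_scale c (ad h F)"
  by (simp add: ad_def ext_over_def ext_scale_def pb.scale_right fun_eq_iff)

lemma ad_zero: "h \<in> R \<Longrightarrow> ad h 0 = 0"
  by (auto simp: ad_def pb.zero_right fun_eq_iff)

lemma ad_sum: "h \<in> R \<Longrightarrow> (\<And>a. a \<in> X \<Longrightarrow> f a \<in> E) \<Longrightarrow> ad h (\<Sum>a\<in>X. f a) = (\<Sum>a\<in>X. ad h (f a))"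
  by (induction X rule: infinite_finite_induct) (simp_all add: ad_zero ad_add E_sum)

lemma ad_twist: "h \<in> R \<Longrightarrow> F \<in> E \<Longrightarrow> ad h (twist F) = twist (ad h F)"
  by (simp add: ad_def ext_over_def twist_def pb.scale_right fun_eq_iff)

lemma ad_lderiv: "h \<in> R \<Longrightarrow> F \<in> E \<Longrightarrow> ad h (lderiv i F) = lderiv i (ad h F)"
proof (intro ext)
  fix U p assume h: "h \<in> R" and F: "F \<in> E"
  have "lderiv i F U = (if i \<in> U then 0 else (\<lambda>p. shuffle_sign {i} U * F (insert i U) p))"
    by (auto simp: lderiv_shuffle_sign fun_eq_iff)
  then show "ad h (lderiv i F) U p = lderiv i (ad h F) U p"
    using h F by (simp add: ad_def lderiv_shuffle_sign ext_over_def pb.scale_right pb.zero_right)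
qed

lemma ad_wedge: "h \<in> R \<Longrightarrow> F \<in> E \<Longrightarrow> G \<in> E \<Longrightarrow> ad h (F \<and>\<^sub>e G) = ad h F \<and>\<^sub>e G + F \<and>\<^sub>e ad h G"
  unfolding ad_def wedge_eq_ext_product
  by (rule mul.ext_product_derivation[OF _ _ pb.add_right pb.scale_right pbr_leibniz(1)])

lemma ad_PB: "h \<in> R \<Longrightarrow> F \<in> E \<Longrightarrow> G \<in> E \<Longrightarrow> ad h (PB F G) = PB (ad h F) G + PB F (ad h G)"
  unfolding ad_def
  by (rule pb.ext_product_derivation[OF _ _ pb.add_right pb.scale_right pbr_jacobi])

lemma ad_ghost_part:
  assumes h: "h \<in> R" and F: "F \<in> E" and G: "G \<in> E"
  shows "ad h (ghost_part F G) = ghost_part (ad h F) G + ghost_part F (ad h G)"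
  using assms
  by (simp add: ghost_part_def ad_scale ad_sum E_intros ad_wedge ad_twist ad_lderiv sum.distrib ext_scale_add)

text \<open>
  The Jacobi identity with a function in first place: \<open>ad h\<close> is a derivation of both kinds of products
  and commutes with derivatives with respect to generators.
\<close>

lemma ad_bracket:
  assumes h: "h \<in> R" and F: "F \<in> E" and G: "G \<in> E"
  shows "ad h (bracket F G) = bracket (ad h F) G + bracket F (ad h G)"
  using assms
  by (simp add: bracket_eq ad_add ad_ghost_part ad_PB ghost_part_closed pb.ext_product_closed ad_mem add_ac)

lemma bracket_function:
  assumes h: "h \<in> R" and F: "F \<in> E"
  shows "bracket F (monomial h {}) = - ad h F"
proof -
  have R: "F U \<in> R" for U using F by (simp add: ext_over_def)
  have "ghost_part F (monomial h {}) = 0" by (simp add: ghost_part_def wedge_zero_right F E_intros)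
  moreover have "PB F (monomial h {}) U = - ad h F U" for U
    using ext_over_finite[OF F, of U] R h pbr_antisym[of "F U" h]
    by (auto simp: ext_product_monomial0_right pb.zero_right ad_def)
  ultimately show ?thesis using F by (simp add: bracket_eq fun_eq_iff)
qed

lemma parity_ad: "h \<in> R \<Longrightarrow> F \<in> E \<Longrightarrow> parity e F \<Longrightarrow> parity e (ad h F)"
  using pb.zero_right[of h] unfolding parity_def ad_def by metis

text \<open>
  By antisymmetry this restates that \<open>ad h\<close> is a derivation of the bracket.
\<close>

lemma bracket_jacobi_function:
  assumes F: "F \<in> E" and G: "G \<in> E" and h: "h \<in> R" and e: "parity e F"
  shows "bracket F (bracket G (monomial h {})) = bracket (bracket F G) (monomial h {}) + bracket (twist_if e G) (bracket F (monomial h {}))"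
  using F G h bracket_antisym[OF ad_mem[OF h F] G parity_ad[OF h F e]]
  by (simp add: bracket_function bracket_uminus_right ad_bracket ad_mem bracket_closed E_twist_if)

text \<open>
  By antisymmetry this restates that the derivative with respect to a generator is a graded derivation
  of the bracket.
\<close>

lemma bracket_jacobi_gen:
  assumes F: "F \<in> E" and G: "G \<in> E" and i: "i < N" and e: "parity e F"
  shows "bracket F (bracket G (gen i)) = bracket (bracket F G) (gen i) + bracket (twist_if e G) (bracket F (gen i))"
proof -
  let ?d = "\<lambda>F. twist (lderiv (dual i) F)"
  have dF: "?d F \<in> E" "parity (\<not> e) (?d F)"
    using F e by (auto intro: E_intros parity_twist parity_lderiv)
  have "bracket (?d F) (twist G) = - bracket (twist_if e G) (?d F)"
    using bracket_antisym[OF dF(1) E_twist[OF G] dF(2)] by (simp add: twist_if_twist)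
  moreover have "?d (bracket F G) = bracket (?d F) (twist G) + bracket F (?d G)"
    using F G by (simp add: bracket_lderiv twist_add bracket_twist E_intros)
  ultimately have "bracket F (?d G) = ?d (bracket F G) + bracket (twist_if e G) (?d F)" by simp
  then show ?thesis
    using F G i dF by (simp add: bracket_gen bracket_closed bracket_scale_right E_intros flip: ext_scale_add)
qed

text \<open>
  Both sides define graded derivations in \<open>H\<close> of the same degree: in the product rule, the mixed terms
  on the right-hand side cancel against those on the left. Hence the identity passes from
  functions and generators to all monomials.
\<close>

lemma bracket_jacobi_homogeneous:
  assumes F: "F \<in> E" and G: "G \<in> E" and H: "H \<in> E" and e: "parity e F" and d: "parity d G"
  shows "bracket F (bracket G H) = bracket (bracket F G) H + bracket (twist_if e G) (bracket F H)"
  using H smooth_funs_0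
proof (induction rule: ext_over_induct)
  case (base h)
  then show ?case using bracket_jacobi_function F G e by blast
next
  case (add H H')
  then have "bracket F (bracket G (H + H')) = bracket (bracket F G) (H + H') + bracket (twist_if e G) (bracket F (H + H'))"
  proof -
    have IH: "bracket F (bracket G H) = bracket (bracket F G) H + bracket (twist_if e G) (bracket F H)"
      "bracket F (bracket G H') = bracket (bracket F G) H' + bracket (twist_if e G) (bracket F H')"
      by (fact add)+
    have H: "H \<in> E" "H' \<in> E" by (fact add)+
    show ?thesis
      using F G H by (simp add: bracket_add_right bracket_closed E_intros IH add_ac)
  qed
  then show ?case .
next
  case (step i h U)
  let ?x = "gen i" and ?H = "monomial h U" and ?G = "twist_if e G"
  have i: "i < N" and H: "?H \<in> E" and x: "gen i \<in> E" using step gen_mem by auto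
  have G': "?G \<in> E" "parity d ?G" using G d by (auto simp: E_twist_if parity_twist_if)
  have FG: "bracket F G \<in> E" "parity (e \<noteq> d) (bracket F G)" using parity_bracket bracket_closed F G e d by auto
  note mem = F G H x G' FG bracket_closed E_intros
  have "bracket G (?x \<and>\<^sub>e ?H) = bracket G ?x \<and>\<^sub>e ?H + twist_if d ?x \<and>\<^sub>e bracket G ?H"
    by (rule bracket_leibniz[OF G x H d])
  then have 1: "bracket F (bracket G (?x \<and>\<^sub>e ?H)) = bracket F (bracket G ?x) \<and>\<^sub>e ?H + twist_if e (bracket G ?x) \<and>\<^sub>e bracket F ?H
      + (bracket F (twist_if d ?x) \<and>\<^sub>e bracket G ?H + twist_if e (twist_if d ?x) \<and>\<^sub>e bracket F (bracket G ?H))"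
    by (simp add: bracket_add_right mem bracket_leibniz[OF F _ _ e])
  have 2: "bracket (bracket F G) (?x \<and>\<^sub>e ?H) = bracket (bracket F G) ?x \<and>\<^sub>e ?H + twist_if (e \<noteq> d) ?x \<and>\<^sub>e bracket (bracket F G) ?H"
    by (rule bracket_leibniz[OF FG(1) x H FG(2)])
  have "bracket F (?x \<and>\<^sub>e ?H) = bracket F ?x \<and>\<^sub>e ?H + twist_if e ?x \<and>\<^sub>e bracket F ?H"
    by (rule bracket_leibniz[OF F x H e])
  then have 3: "bracket ?G (bracket F (?x \<and>\<^sub>e ?H)) = bracket ?G (bracket F ?x) \<and>\<^sub>e ?H + twist_if d (bracket F ?x) \<and>\<^sub>e bracket ?G ?H
      + (bracket ?G (twist_if e ?x) \<and>\<^sub>e bracket F ?H + twist_if d (twist_if e ?x) \<and>\<^sub>e bracket ?G (bracket F ?H))"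
    by (simp add: bracket_add_right mem bracket_leibniz[OF G'(1) _ _ G'(2)])
  have c1: "twist_if e (bracket G ?x) = bracket ?G (twist_if e ?x)"
    by (rule bracket_twist_if[OF G x])
  \<comment> \<open>passing from \<open>F\<close>, \<open>G\<close> to their twists gives the same sign in both factors\<close>
  have c2: "twist_if d (bracket F ?x) \<and>\<^sub>e bracket ?G ?H = bracket F (twist_if d ?x) \<and>\<^sub>e bracket G ?H"
    unfolding bracket_twist_if[OF F x] twist_if_parity[OF e] twist_if_parity[OF d]
    by (auto simp: mem bracket_uminus_left wedge_uminus_left wedge_uminus_right)
  have c3: "twist_if d (twist_if e ?x) = twist_if e (twist_if d ?x)" "twist_if (e \<noteq> d) ?x = twist_if e (twist_if d ?x)"
    by (auto simp: twist_if_def)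
  have j: "bracket F (bracket G ?x) = bracket (bracket F G) ?x + bracket ?G (bracket F ?x)"
    by (rule bracket_jacobi_gen[OF F G i e])
  have IH: "bracket F (bracket G ?H) = bracket (bracket F G) ?H + bracket ?G (bracket F ?H)" by (rule step)
  have "bracket F (bracket G (?x \<and>\<^sub>e ?H)) = bracket (bracket F G) (?x \<and>\<^sub>e ?H) + bracket ?G (bracket F (?x \<and>\<^sub>e ?H))"
    unfolding 1 2 3 c1 c2 c3 j IH
    by (simp add: mem wedge_add_left wedge_add_right add_ac)
  then show ?case .
qed

text \<open>
  Both sides are additive in \<open>G\<close>, which is the sum of its odd and its even part.
\<close>

lemma bracket_jacobi:
  assumes F: "F \<in> E" and G: "G \<in> E" and H: "H \<in> E" and e: "parity e F"
  shows "bracket F (bracket G H) = bracket (bracket F G) H + bracket (twist_if e G) (bracket F H)"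
proof -
  let ?G0 = "ext_scale (1/2) (G - twist G)" and ?G1 = "ext_scale (1/2) (G + twist G)"
  have "?G0 \<in> E" "?G1 \<in> E" using G by (auto intro!: E_intros)
  moreover have "parity True ?G0" "parity False ?G1"
    by (simp_all add: parity_iff_twist twist_add twist_scale twist_diff add.commute flip: ext_scale_minus)
  moreover have "G = ?G0 + ?G1" by (simp add: ext_scale_def fun_eq_iff field_simps)
  ultimately obtain G0 G1 where GG: "G = G0 + G1" and "G0 \<in> E" "G1 \<in> E" "parity True G0" "parity False G1"
    by blast
  then show ?thesis
    using bracket_jacobi_homogeneous[OF F _ H e, of G0 True] bracket_jacobi_homogeneous[OF F _ H e, of G1 False] F H
    by (simp add: twist_if_def twist_add bracket_add_left bracket_add_right bracket_closed E_intros add_ac)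
qed

end

section \<open>The BRST differential and the restriction to the zero fibre\<close>

lemma homog_gen: "homog w (w {i}) (gen i)"
  by (auto simp: homog_def gen_def fun_eq_iff split: if_splits)

lemma homog_monomial: "homog w (w U) (monomial h U)"
  by (auto simp: homog_def monomial_def)

context hamiltonian_space
begin

definition ghost_number :: "nat set \<Rightarrow> int" where
  "ghost_number U = int (card (U \<inter> {..<lie_dim S})) - int (card (U \<inter> {lie_dim S..<2 * lie_dim S}))"

lemma weight_ghost_number: "weight ghost_number"
  unfolding weight_def ghost_number_def by (auto simp: Int_Un_distrib2 card_Un_disjoint disjoint_iff)

lemma brst_deg_iff: "F \<in> brst_deg S k \<longleftrightarrow> F \<in> E \<and> homog ghost_number k F"
  by (auto simp: brst_deg_def homog_def ghost_number_def brst_eq)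

lemma brst_degD: "F \<in> brst_deg S k \<Longrightarrow> F \<in> E"
  by (simp add: brst_deg_iff)

lemma parity_brst_deg:
  assumes "F \<in> brst_deg S k" shows "parity (odd k) F"
  unfolding parity_def
proof (intro allI impI)
  fix U assume U: "F U \<noteq> 0"
  then have "U \<subseteq> {..<N}" "ghost_number U = k" using assms by (auto simp: brst_deg_iff homog_def ext_over_def)
  have "U = (U \<inter> {..<lie_dim S}) \<union> (U \<inter> {lie_dim S..<2 * lie_dim S})"
    using \<open>U \<subseteq> {..<N}\<close> by auto
  then have "card U = card (U \<inter> {..<lie_dim S}) + card (U \<inter> {lie_dim S..<2 * lie_dim S})"
    by (subst card_Un_disjoint[symmetric]) auto
  then show "odd (card U) \<longleftrightarrow> odd k"
    using \<open>ghost_number U = k\<close> unfolding ghost_number_def by auto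
qed

lemma brst_deg_add: "F \<in> brst_deg S k \<Longrightarrow> G \<in> brst_deg S k \<Longrightarrow> F + G \<in> brst_deg S k"
  and brst_deg_scale: "F \<in> brst_deg S k \<Longrightarrow> ext_scale c F \<in> brst_deg S k"
  and brst_deg_sum: "(\<And>a. a \<in> X \<Longrightarrow> f a \<in> brst_deg S k) \<Longrightarrow> (\<Sum>a\<in>X. f a) \<in> brst_deg S k"
  by (simp_all add: brst_deg_iff E_intros homog_add homog_scale homog_sum)

lemma brst_deg_wedge: "F \<in> brst_deg S i \<Longrightarrow> G \<in> brst_deg S j \<Longrightarrow> F \<and>\<^sub>e G \<in> brst_deg S (i + j)"
  using mul.homog_ext_product[OF _ _ _ _ weight_ghost_number, of F N i G j]
  by (simp add: brst_deg_iff E_intros wedge_eq_ext_product mul.ext_product_closed)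

lemma ghost_number_dual: "i < N \<Longrightarrow> ghost_number {dual i} = - ghost_number {i}"
  by (auto simp: ghost_number_def dual_def)

text \<open>
  The ghost part removes a generator together with its conjugate, of total ghost number 0.
\<close>

lemma brst_deg_bracket: "F \<in> brst_deg S i \<Longrightarrow> G \<in> brst_deg S j \<Longrightarrow> bracket F G \<in> brst_deg S (i + j)"
proof -
  assume F: "F \<in> brst_deg S i" and G: "G \<in> brst_deg S j"
  note FE = brst_degD[OF F] brst_degD[OF G]
  have "PB F G \<in> brst_deg S (i + j)"
    using F G pb.homog_ext_product[OF _ _ _ _ weight_ghost_number, of F N i G j]
    by (simp add: brst_deg_iff pb.ext_product_closed)
  moreover have "twist (lderiv (dual k) F) \<and>\<^sub>e lderiv k G \<in> brst_deg S (i + j)" if "k < N" for k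
  proof -
    have "twist (lderiv (dual k) F) \<in> brst_deg S (i - ghost_number {dual k})" "lderiv k G \<in> brst_deg S (j - ghost_number {k})"
      using F G FE by (auto simp: brst_deg_iff E_intros intro!: homog_twist homog_lderiv[OF _ weight_ghost_number])
    from brst_deg_wedge[OF this] show ?thesis by (simp add: ghost_number_dual[OF that])
  qed
  ultimately show ?thesis
    using FE by (auto simp: bracket_eq ghost_part_def intro!: brst_deg_add brst_deg_scale brst_deg_sum)
qed

lemma gen_deg: "i < N \<Longrightarrow> gen i \<in> brst_deg S (ghost_number {i})"
  by (simp add: brst_deg_iff gen_mem homog_gen)

lemma function_deg: "h \<in> R \<Longrightarrow> monomial h {} \<in> brst_deg S 0"
  using homog_monomial[of ghost_number "{}" h] by (simp add: brst_deg_iff monomial_mem ghost_number_def)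

lemma mom_mem: "a < lie_dim S \<Longrightarrow> mom S a \<in> R"
  unfolding moment_fun_def smooth_funs_def
  by (rule manifold.Cinf_linear[OF bounded_linear_of_real]) (rule moment_smooth[OF basis_mem])

text \<open>
  The charge as an expression in the algebra operations, from which its degree can be read off.
\<close>

lemma charge_eq:
  "brst_charge S = ext_scale (- (1/4)) (\<Sum>a<lie_dim S. \<Sum>b<lie_dim S. \<Sum>c<lie_dim S.
      ext_scale (of_real (struct_const S a b c)) (gen a \<and>\<^sub>e gen b \<and>\<^sub>e gen (lie_dim S + c)))
    + (\<Sum>a<lie_dim S. monomial (mom S a) {} \<and>\<^sub>e gen a)"
proof -
  have "monomial (mom S a) {} \<and>\<^sub>e gen a = (\<lambda>U. mom S a * gen a U :: 'm \<Rightarrow> 'k)" if "a < lie_dim S" for a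
    using that by (intro wedge_one_left[OF ext_over_UNIV[OF gen_mem]]) simp
  then show ?thesis
    by (simp add: brst_charge_def fun_eq_iff ext_scale_def sum_ext_apply)
qed

lemma charge_deg: "brst_charge S \<in> brst_deg S 1"
proof -
  have g: "gen a \<in> brst_deg S 1" "gen (lie_dim S + a) \<in> brst_deg S (-1)" if "a < lie_dim S" for a
    using gen_deg[of a] gen_deg[of "lie_dim S + a"] that by (auto simp: ghost_number_def)
  have "gen a \<and>\<^sub>e gen b \<and>\<^sub>e gen (lie_dim S + c) \<in> brst_deg S 1"
    if "a < lie_dim S" "b < lie_dim S" "c < lie_dim S" for a b c
    using brst_deg_wedge[OF brst_deg_wedge[OF g(1)[OF that(1)] g(1)[OF that(2)]] g(2)[OF that(3)]] by simp
  moreover have "monomial (mom S a) {} \<and>\<^sub>e gen a \<in> brst_deg S 1" if "a < lie_dim S" for a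
    using brst_deg_wedge[OF function_deg[OF mom_mem[OF that]] g(1)[OF that]] by simp
  ultimately show ?thesis
    unfolding charge_eq by (intro brst_deg_add brst_deg_scale brst_deg_sum) auto
qed

lemma charge_mem: "brst_charge S \<in> E" and charge_parity: "parity True (brst_charge S)"
  using brst_degD[OF charge_deg] parity_brst_deg[OF charge_deg] by auto

abbreviation D where "D \<equiv> brst_diff S"

lemma D_closed: "F \<in> E \<Longrightarrow> D F \<in> E"
  by (simp add: brst_diff_def bracket_closed charge_mem)

lemma D_add: "F \<in> E \<Longrightarrow> G \<in> E \<Longrightarrow> D (F + G) = D F + D G"
  by (simp add: brst_diff_def bracket_add_right charge_mem)

lemma D_scale: "F \<in> E \<Longrightarrow> D (ext_scale c F) = ext_scale c (D F)"
  by (simp add: brst_diff_def bracket_scale_right charge_mem)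

lemma D_deg: "F \<in> brst_deg S k \<Longrightarrow> D F \<in> brst_deg S (k + 1)"
  unfolding brst_diff_def using brst_deg_bracket[OF charge_deg, of F k] by (simp add: add.commute)

lemma D_wedge: "F \<in> E \<Longrightarrow> G \<in> E \<Longrightarrow> D (F \<and>\<^sub>e G) = D F \<and>\<^sub>e G + twist F \<and>\<^sub>e D G"
  using bracket_leibniz[OF charge_mem _ _ charge_parity] by (simp add: brst_diff_def twist_if_def)

text \<open>
  The Jacobi identity with the odd charge in first place.
\<close>

lemma D_bracket: "F \<in> E \<Longrightarrow> G \<in> E \<Longrightarrow> D (bracket F G) = bracket (D F) G + bracket (twist F) (D G)"
  using bracket_jacobi[OF charge_mem _ _ charge_parity] by (simp add: brst_diff_def twist_if_def)

lemma D_twist: "F \<in> E \<Longrightarrow> D (twist F) = - twist (D F)"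
  using charge_parity
  by (simp add: brst_diff_def bracket_twist charge_mem parity_iff_twist bracket_uminus_left E_twist)

lemma restr_add: "restr S (f + g) = restr S f + restr S g"
  and restr_mult: "restr S (f * g) = restr S f * restr S g"
  and restr_scale: "restr S (\<lambda>p. c * f p) = (\<lambda>p. c * restr S f p)"
  and restr_zero: "restr S 0 = 0"
  and restr_diff: "restr S (f - g) = restr S f - restr S g"
  by (auto simp: restr_def fun_eq_iff)

abbreviation RZ :: "('m \<Rightarrow> 'k) set" where "RZ \<equiv> smooth_funs_Z S"

lemma restr_mem: "f \<in> R \<Longrightarrow> restr S f \<in> RZ"
  by (simp add: smooth_funs_Z_def)

sublocale zmul: coef_bilinear RZ "(*)"
proof
  show "0 \<in> RZ" using restr_mem[OF smooth_funs_0] by (simp add: restr_zero)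
  fix f g :: "'m \<Rightarrow> 'k" and c assume "f \<in> RZ"
  then obtain f' where f': "f = restr S f'" "f' \<in> R" by (auto simp: smooth_funs_Z_def)
  show "(\<lambda>p. c * f p) \<in> RZ" using restr_mem[OF smooth_funs_scale[OF f'(2)]] f' by (simp add: restr_scale)
  assume "g \<in> RZ"
  then obtain g' where g': "g = restr S g'" "g' \<in> R" by (auto simp: smooth_funs_Z_def)
  show "f + g \<in> RZ" "f * g \<in> RZ"
    using restr_mem[OF smooth_funs_add[OF f'(2) g'(2)]] restr_mem[OF smooth_funs_mult[OF f'(2) g'(2)]] f' g'
    by (simp_all add: restr_add restr_mult)
qed (auto simp: fun_eq_iff algebra_simps)

abbreviation C :: "('m, 'k) ext set" where "C \<equiv> ext_over RZ (lie_dim S)"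

lemma cochains_eq: "cochains S = C"
  by (simp add: cochains_def)

lemmas C_intros = zmul.ext_over_add[where n = "lie_dim S"] zmul.ext_over_diff[where n = "lie_dim S"]
  zmul.ext_over_uminus[where n = "lie_dim S"] zmul.ext_over_scale[where n = "lie_dim S"]
  zmul.ext_over_zero[where n = "lie_dim S"] zmul.ext_over_twist[where n = "lie_dim S"]
  zmul.ext_over_sum[where n = "lie_dim S"]
  zmul.ext_product_closed[where n = "lie_dim S", folded wedge_eq_ext_product]

lemmas C_wedge_add_left = zmul.ext_product_add_left[where n = "lie_dim S", folded wedge_eq_ext_product]
lemmas C_wedge_add_right = zmul.ext_product_add_right[where n = "lie_dim S", folded wedge_eq_ext_product]
lemmas C_wedge_scale_left = zmul.ext_product_scale_left[where n = "lie_dim S", folded wedge_eq_ext_product]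
lemmas C_wedge_scale_right = zmul.ext_product_scale_right[where n = "lie_dim S", folded wedge_eq_ext_product]
lemmas C_wedge_zero_left = zmul.ext_product_zero_left[where n = "lie_dim S", folded wedge_eq_ext_product]
lemmas C_wedge_zero_right = zmul.ext_product_zero_right[where n = "lie_dim S", folded wedge_eq_ext_product]

abbreviation rs where "rs \<equiv> res S"

lemma rs_closed: "F \<in> E \<Longrightarrow> rs F \<in> C"
  using zmul.zero_mem by (auto simp: res_def ext_over_def restr_mem)

lemma rs_add: "rs (F + G) = rs F + rs G"
  and rs_diff: "rs (F - G) = rs F - rs G"
  and rs_zero: "rs 0 = 0"
  and rs_scale: "rs (ext_scale c F) = ext_scale c (rs F)"
  and rs_twist: "rs (twist F) = twist (rs F)"
  by (auto simp: res_def fun_eq_iff restr_def ext_scale_def twist_def)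

lemma rs_uminus: "rs (- F) = - rs F"
  using rs_scale[of "- 1" F] by (simp add: ext_scale_uminus)

text \<open>
  An index set consisting of ghosts decomposes into sets of ghosts only, and restriction of functions to
  the zero fibre is multiplicative.
\<close>

lemma rs_wedge: "rs (F \<and>\<^sub>e G) = rs F \<and>\<^sub>e rs G"
proof (intro ext)
  fix U p
  show "rs (F \<and>\<^sub>e G) U p = (rs F \<and>\<^sub>e rs G) U p"
  proof (cases "U \<subseteq> {..<lie_dim S}")
    case True
    then have "T \<subseteq> {..<lie_dim S}" "U - T \<subseteq> {..<lie_dim S}" if "T \<subseteq> U" for T using that by auto
    then show ?thesis using True by (auto simp: res_def wedge_def restr_def intro!: sum.cong)
  next
    case False
    have "rs F T p * rs G (U - T) p = 0" if "T \<subseteq> U" for T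
    proof -
      have "\<not> T \<subseteq> {..<lie_dim S} \<or> \<not> U - T \<subseteq> {..<lie_dim S}" using False by blast
      then show ?thesis by (auto simp: res_def)
    qed
    then have "(rs F \<and>\<^sub>e rs G) U p = 0" unfolding wedge_def by (intro sum.neutral) (simp add: mult.assoc)
    then show ?thesis using False by (simp add: res_def)
  qed
qed

lemma cochains_deg_iff: "u \<in> cochains_deg S k \<longleftrightarrow> u \<in> C \<and> homog (\<lambda>U. int (card U)) k u"
  by (simp add: cochains_deg_def cochains_eq homog_def)

lemma cochains_degD: "u \<in> cochains_deg S k \<Longrightarrow> u \<in> C"
  by (simp add: cochains_deg_iff)

lemma parity_cochains_deg: "u \<in> cochains_deg S k \<Longrightarrow> parity (odd k) u"
  by (simp add: cochains_deg_iff parity_homog)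

lemma cochains_deg_wedge: "u \<in> cochains_deg S i \<Longrightarrow> v \<in> cochains_deg S j \<Longrightarrow> u \<and>\<^sub>e v \<in> cochains_deg S (i + j)"
  using zmul.homog_ext_product[OF _ _ _ _ weight_card, of u "lie_dim S" i v j]
  by (simp add: cochains_deg_iff C_intros wedge_eq_ext_product zmul.ext_product_closed)

lemma rs_deg:
  assumes "F \<in> brst_deg S k" shows "rs F \<in> cochains_deg S k"
  unfolding cochains_deg_iff homog_def
proof (intro conjI allI impI)
  show "rs F \<in> C" using assms brst_degD rs_closed by blast
  fix U assume "rs F U \<noteq> 0"
  then have "U \<subseteq> {..<lie_dim S}" "F U \<noteq> 0"
    by (auto simp: res_def restr_zero split: if_splits)
  then have "ghost_number U = k" "ghost_number U = int (card U)"
    using assms by (auto simp: brst_deg_iff homog_def ghost_number_def inf_absorb1 disjoint_iff card_eq_0_iff)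
  then show "int (card U) = k" by simp
qed

end

text \<open>
  A deformation retraction of the BRST complex onto the cochain complex.
\<close>

locale brst_contraction = hamiltonian_space S
  for S :: "('m::{t2_space,second_countable_topology}, 'e::real_normed_vector,
               'k::real_normed_field,
               'g::{t2_space,second_countable_topology}, 'h::real_normed_vector) ham_data" +
  fixes \<Phi> H :: "('m, 'k) ext \<Rightarrow> ('m, 'k) ext"
  assumes Phi_linear: "linear_map (cochains S) (brst S) \<Phi>"
    and Phi_deg: "\<Phi> ` cochains_deg S k \<subseteq> brst_deg S k"
    and H_linear: "linear_map (brst S) (brst S) H"
    and res_chain: "F \<in> brst S \<Longrightarrow> res S (brst_diff S F) = ce_diff S (res S F)"
    and Phi_chain: "u \<in> cochains S \<Longrightarrow> brst_diff S (\<Phi> u) = \<Phi> (ce_diff S u)"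
    and res_Phi: "u \<in> cochains S \<Longrightarrow> res S (\<Phi> u) = u"
    and homotopy: "F \<in> brst S \<Longrightarrow> F - \<Phi> (res S F) = brst_diff S (H F) + H (brst_diff S F)"
begin

abbreviation d where "d \<equiv> ce_diff S"

lemma Phi_closed: "u \<in> C \<Longrightarrow> \<Phi> u \<in> E"
  and Phi_add: "u \<in> C \<Longrightarrow> v \<in> C \<Longrightarrow> \<Phi> (u + v) = \<Phi> u + \<Phi> v"
  and Phi_scale: "u \<in> C \<Longrightarrow> \<Phi> (ext_scale c u) = ext_scale c (\<Phi> u)"
  using Phi_linear unfolding linear_map_def cochains_eq brst_eq ext_scale_def by blast+

lemma H_closed: "F \<in> E \<Longrightarrow> H F \<in> E" and H_zero: "H 0 = 0"
proof -
  show "F \<in> E \<Longrightarrow> H F \<in> E" using H_linear unfolding linear_map_def brst_eq by blast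
  have "H (0 + 0) = H 0 + H 0"
    using H_linear E_zero unfolding linear_map_def brst_eq by blast
  then show "H 0 = 0" by simp
qed

lemma rs_Phi: "u \<in> C \<Longrightarrow> rs (\<Phi> u) = u"
  using res_Phi by (simp add: cochains_eq)

lemma d_rs: "F \<in> E \<Longrightarrow> d (rs F) = rs (D F)"
  using res_chain by (simp add: brst_eq)

text \<open>
  As every cochain is the restriction of \<open>\<Phi> u\<close>, all properties of \<open>d\<close> can be read off from those of \<open>D\<close>.
\<close>

lemma d_eq: "u \<in> C \<Longrightarrow> d u = rs (D (\<Phi> u))"
  using d_rs[OF Phi_closed] rs_Phi by simp

lemma d_closed: "u \<in> C \<Longrightarrow> d u \<in> C"
  by (simp add: d_eq rs_closed D_closed Phi_closed)

lemma d_add: "u \<in> C \<Longrightarrow> v \<in> C \<Longrightarrow> d (u + v) = d u + d v"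
  by (simp add: d_eq C_intros Phi_add Phi_closed D_add rs_add)

lemma d_scale: "u \<in> C \<Longrightarrow> d (ext_scale c u) = ext_scale c (d u)"
  by (simp add: d_eq C_intros Phi_scale Phi_closed D_scale rs_scale)

lemma d_uminus: "u \<in> C \<Longrightarrow> d (- u) = - d u"
  using d_scale[of u "- 1"] by (simp add: ext_scale_uminus)

lemma d_zero: "d 0 = 0"
  using d_add[of 0 0] by (simp add: C_intros)

lemma d_sum: "(\<And>a. a \<in> X \<Longrightarrow> f a \<in> C) \<Longrightarrow> d (\<Sum>a\<in>X. f a) = (\<Sum>a\<in>X. d (f a))"
proof (induction X rule: infinite_finite_induct)
  case (insert x X)
  have "d (f x + (\<Sum>a\<in>X. f a)) = d (f x) + (\<Sum>a\<in>X. d (f a))"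
    using insert by (simp add: d_add C_intros)
  then have "d (\<Sum>a\<in>insert x X. f a) = (\<Sum>a\<in>insert x X. d (f a))"
    unfolding sum.insert[OF insert.hyps] .
  then show ?case .
next
  case (infinite X)
  then have "d (\<Sum>a\<in>X. f a) = (\<Sum>a\<in>X. d (f a))" by (simp add: d_zero)
  then show ?case .
next
  case empty
  have "d (\<Sum>a\<in>{}. f a) = (\<Sum>a\<in>{}. d (f a))" by (simp add: d_zero)
  then show ?case .
qed

lemma d_wedge:
  assumes u: "u \<in> C" and v: "v \<in> C"
  shows "d (u \<and>\<^sub>e v) = d u \<and>\<^sub>e v + twist u \<and>\<^sub>e d v"
proof -
  have "d (rs (\<Phi> u \<and>\<^sub>e \<Phi> v)) = rs (D (\<Phi> u) \<and>\<^sub>e \<Phi> v + twist (\<Phi> u) \<and>\<^sub>e D (\<Phi> v))"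
    using u v by (simp add: d_rs D_wedge Phi_closed E_intros)
  then show ?thesis using u v by (simp add: rs_wedge rs_add rs_twist rs_Phi d_eq)
qed

lemma d_twist: "u \<in> C \<Longrightarrow> d (twist u) = - twist (d u)"
  using d_rs[OF E_twist[OF Phi_closed[of u]]]
  by (simp add: rs_twist rs_Phi D_twist Phi_closed rs_uminus d_eq)

lemma d_deg: "u \<in> cochains_deg S k \<Longrightarrow> d u \<in> cochains_deg S (k + 1)"
  using Phi_deg[of k] rs_deg[OF D_deg, of "\<Phi> u" k] by (auto simp: d_eq cochains_degD)

lemma Phi_cocycle: "u \<in> C \<Longrightarrow> d u = 0 \<Longrightarrow> D (\<Phi> u) = 0"
  using Phi_chain[of u] Phi_add[of 0 0] by (simp add: cochains_eq C_intros)

text \<open>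
  On cocycles the homotopy formula says that \<open>\<Phi> \<circ> res\<close> is the identity up to exact elements.
\<close>

lemma Phi_rs_closed:
  assumes F: "F \<in> E" "D F = 0"
  obtains Y where "Y \<in> E" "\<Phi> (rs F) = F - D Y"
proof
  show "H F \<in> E" using H_closed F by blast
  have "F - \<Phi> (rs F) = D (H F)" using homotopy[of F] F by (simp add: brst_eq H_zero)
  then show "\<Phi> (rs F) = F - D (H F)" by (simp add: algebra_simps)
qed

text \<open>
  If \<open>D F = 0\<close> then \<open>D {twist F, Y} = {F, D Y}\<close>, so that the restriction of the latter is exact.
\<close>

lemma rs_bracket_exact_right:
  assumes "F \<in> E" "D F = 0" "Y \<in> E"
  obtains c where "c \<in> C" "rs (bracket F (D Y)) = d c"
proof
  show "rs (bracket (twist F) Y) \<in> C" using assms by (intro rs_closed bracket_closed E_intros)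
  show "rs (bracket F (D Y)) = d (rs (bracket (twist F) Y))"
    using assms by (simp add: d_rs bracket_closed E_twist D_bracket D_twist bracket_zero_left)
qed

lemma rs_bracket_exact_left:
  assumes "F \<in> E" "D F = 0" "Y \<in> E"
  obtains c where "c \<in> C" "rs (bracket (D Y) F) = d c"
proof
  show "rs (bracket Y F) \<in> C" using assms by (intro rs_closed bracket_closed E_intros)
  show "rs (bracket (D Y) F) = d (rs (bracket Y F))"
    using assms by (simp add: d_rs bracket_closed E_twist D_bracket bracket_zero_right)
qed

end

section \<open>The cohomology algebra\<close>

lemma scalar_ring_cring: "cring (scalar_ring :: 'k::real_normed_field ring)"
proof (rule cringI)
  have "\<exists>y\<in>carrier scalar_ring. y \<oplus>\<^bsub>scalar_ring\<^esub> x = \<zero>\<^bsub>scalar_ring\<^esub>" for x :: 'k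
    by (rule bexI[of _ "- x"]) (simp_all add: scalar_ring_def)
  then show "abelian_group (scalar_ring :: 'k ring)"
    by (intro abelian_groupI) (auto simp: scalar_ring_def)
  show "comm_monoid (scalar_ring :: 'k ring)"
    by (intro comm_monoidI) (auto simp: scalar_ring_def)
qed (auto simp: scalar_ring_def distrib_right)

context brst_contraction
begin

abbreviation Z where "Z \<equiv> cocycles S"
abbreviation cls where "cls \<equiv> coh_class S"
abbreviation M where "M \<equiv> cohomology S"

definition cochain_bracket :: "('m, 'k) ext \<Rightarrow> ('m, 'k) ext \<Rightarrow> ('m, 'k) ext" where
  "cochain_bracket a b = rs (bracket (\<Phi> a) (\<Phi> b))"

lemma Z_iff: "a \<in> Z \<longleftrightarrow> a \<in> C \<and> d a = 0"
  by (simp add: cocycles_def cochains_eq)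

lemma ZD: "a \<in> Z \<Longrightarrow> a \<in> C" "a \<in> Z \<Longrightarrow> d a = 0"
    "a \<in> Z \<Longrightarrow> \<Phi> a \<in> E" "a \<in> Z \<Longrightarrow> D (\<Phi> a) = 0"
  by (simp_all add: Z_iff Phi_closed Phi_cocycle)

lemma Z_add: "a \<in> Z \<Longrightarrow> b \<in> Z \<Longrightarrow> a + b \<in> Z"
  and Z_scale: "a \<in> Z \<Longrightarrow> ext_scale c a \<in> Z"
  and Z_zero: "0 \<in> Z"
  and Z_uminus: "a \<in> Z \<Longrightarrow> - a \<in> Z"
  and Z_wedge: "a \<in> Z \<Longrightarrow> b \<in> Z \<Longrightarrow> a \<and>\<^sub>e b \<in> Z"
  and Z_twist: "a \<in> Z \<Longrightarrow> twist a \<in> Z"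
  by (simp_all add: Z_iff C_intros d_add d_scale d_zero d_uminus d_wedge d_twist C_wedge_zero_left C_wedge_zero_right)

lemma Z_twist_if: "a \<in> Z \<Longrightarrow> twist_if e a \<in> Z"
  by (simp add: twist_if_def Z_twist)

lemma Z_cochain_bracket: "a \<in> Z \<Longrightarrow> b \<in> Z \<Longrightarrow> cochain_bracket a b \<in> Z"
  by (simp add: cochain_bracket_def Z_iff rs_closed bracket_closed Phi_closed d_rs D_bracket Phi_cocycle
      bracket_zero_left bracket_zero_right E_intros rs_zero)

lemma cohomologous_iff:
  "(a, b) \<in> cohomologous S \<longleftrightarrow> a \<in> Z \<and> b \<in> Z \<and> (\<exists>c\<in>C. b = a + d c)"
  by (simp add: cohomologous_def cochains_eq)

lemma equiv_cohomologous: "equiv Z (cohomologous S)"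
proof (rule equivI)
  show "refl_on Z (cohomologous S)"
    by (auto simp: refl_on_def cohomologous_iff intro!: bexI[of _ 0] C_intros d_zero)
  show "sym (cohomologous S)"
  proof (rule symI)
    fix a b assume "(a, b) \<in> cohomologous S"
    then obtain c where "a \<in> Z" "b \<in> Z" "c \<in> C" "b = a + d c" by (auto simp: cohomologous_iff)
    then show "(b, a) \<in> cohomologous S"
      by (auto simp: cohomologous_iff d_uminus intro!: bexI[of _ "- c"] C_intros)
  qed
  show "trans (cohomologous S)"
  proof (rule transI)
    fix a b e assume "(a, b) \<in> cohomologous S" "(b, e) \<in> cohomologous S"
    then obtain c c' where "a \<in> Z" "e \<in> Z" "c \<in> C" "c' \<in> C" "e = a + d c + d c'"
      by (auto simp: cohomologous_iff)
    then show "(a, e) \<in> cohomologous S"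
      by (auto simp: cohomologous_iff d_add add.assoc intro!: bexI[of _ "c + c'"] C_intros)
  qed
qed (auto simp: cohomologous_iff)

lemma cls_eq_iff: "a \<in> Z \<Longrightarrow> b \<in> Z \<Longrightarrow> cls a = cls b \<longleftrightarrow> (\<exists>c\<in>C. b = a + d c)"
  by (simp add: eq_equiv_class_iff[OF equiv_cohomologous] cohomologous_iff)

lemma cls_eqI: "a \<in> Z \<Longrightarrow> b \<in> Z \<Longrightarrow> c \<in> C \<Longrightarrow> b = a + d c \<Longrightarrow> cls b = cls a"
  using cls_eq_iff by blast

lemma cls_self: "a \<in> Z \<Longrightarrow> a \<in> cls a"
  using equiv_class_self[OF equiv_cohomologous] .

lemma carrier_cohomology: "carrier M = cls ` Z"
  by (auto simp: cohomology_def quotient_def)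

text \<open>
  The operations on cohomology are unions over all representatives. Such a union is a single class as
  soon as changing either representative by a coboundary does not change the class of the result.
\<close>

lemma class_UN:
  assumes a: "a \<in> Z" and b: "b \<in> Z"
    and left: "\<And>x y. x \<in> Z \<Longrightarrow> y \<in> Z \<Longrightarrow> f x y \<in> Z"
    and dl: "\<And>x y c. x \<in> Z \<Longrightarrow> y \<in> Z \<Longrightarrow> c \<in> C \<Longrightarrow> x + d c \<in> Z \<Longrightarrow> cls (f (x + d c) y) = cls (f x y)"
    and dr: "\<And>x y c. x \<in> Z \<Longrightarrow> y \<in> Z \<Longrightarrow> c \<in> C \<Longrightarrow> y + d c \<in> Z \<Longrightarrow> cls (f x (y + d c)) = cls (f x y)"
  shows "(\<Union>x\<in>cls a. \<Union>y\<in>cls b. cls (f x y)) = cls (f a b)"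
proof -
  have "cls (f x y) = cls (f a b)" if "x \<in> cls a" "y \<in> cls b" for x y
  proof -
    from that obtain c c' where c: "x = a + d c" "c \<in> C" "x \<in> Z" and c': "y = b + d c'" "c' \<in> C" "y \<in> Z"
      by (auto simp: cohomologous_iff)
    have "cls (f x y) = cls (f a y)" using dl[of a y c] a c c' by simp
    also have "\<dots> = cls (f a b)" using dr[of a b c'] a b c' by simp
    finally show ?thesis .
  qed
  moreover have "a \<in> cls a" "b \<in> cls b"
    using cls_self[OF a] cls_self[OF b] .
  ultimately show ?thesis by blast
qed

lemma add_cls: "a \<in> Z \<Longrightarrow> b \<in> Z \<Longrightarrow> cls a \<oplus>\<^bsub>M\<^esub> cls b = cls (a + b)"
proof -
  assume a: "a \<in> Z" "b \<in> Z"
  have "(\<Union>x\<in>cls a. \<Union>y\<in>cls b. cls (x + y)) = cls (a + b)"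
  proof (rule class_UN[OF a Z_add])
    fix x y c assume *: "x \<in> Z" "y \<in> Z" "c \<in> C"
    { assume "x + d c \<in> Z"
      then have "x + d c + y \<in> Z" using * Z_add by blast
      then show "cls (x + d c + y) = cls (x + y)" using * Z_add
        by (intro cls_eqI[of "x + y" _ c]) (auto simp: add_ac) }
    { assume "y + d c \<in> Z"
      then have "x + (y + d c) \<in> Z" using * Z_add by blast
      then show "cls (x + (y + d c)) = cls (x + y)" using * Z_add
        by (intro cls_eqI[of "x + y" _ c]) (auto simp: add_ac) }
  qed
  then show ?thesis by (simp add: cohomology_def)
qed

lemma mult_cls: "a \<in> Z \<Longrightarrow> b \<in> Z \<Longrightarrow> cls a \<otimes>\<^bsub>M\<^esub> cls b = cls (a \<and>\<^sub>e b)"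
proof -
  assume a: "a \<in> Z" "b \<in> Z"
  have "(\<Union>x\<in>cls a. \<Union>y\<in>cls b. cls (x \<and>\<^sub>e y)) = cls (a \<and>\<^sub>e b)"
  proof (rule class_UN[OF a Z_wedge])
    fix x y c assume *: "x \<in> Z" "y \<in> Z" "c \<in> C"
    { assume "x + d c \<in> Z"
      then have "(x + d c) \<and>\<^sub>e y \<in> Z" using * Z_wedge by blast
      then show "cls ((x + d c) \<and>\<^sub>e y) = cls (x \<and>\<^sub>e y)" using * ZD
        by (intro cls_eqI[of "x \<and>\<^sub>e y" _ "c \<and>\<^sub>e y"])
          (auto simp: Z_wedge C_wedge_add_left C_wedge_zero_right C_intros d_closed d_wedge) }
    { assume "y + d c \<in> Z"
      then have "x \<and>\<^sub>e (y + d c) \<in> Z" using * Z_wedge by blast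
      then show "cls (x \<and>\<^sub>e (y + d c)) = cls (x \<and>\<^sub>e y)" using * ZD
        by (intro cls_eqI[of "x \<and>\<^sub>e y" _ "twist x \<and>\<^sub>e c"])
          (auto simp: Z_wedge C_wedge_add_right C_wedge_zero_left C_intros d_closed d_wedge d_twist) }
  qed
  then show ?thesis by (simp add: cohomology_def)
qed

lemma Phi_d: "c \<in> C \<Longrightarrow> \<Phi> (d c) = D (\<Phi> c)"
  using Phi_chain by (simp add: cochains_eq)

text \<open>
  A coboundary \<open>d c\<close> is lifted to the exact element \<open>D (\<Phi> c)\<close>, and bracketing a cocycle with an exact
  element is exact after restriction.
\<close>

lemma cohomology_bracket_cls: "a \<in> Z \<Longrightarrow> b \<in> Z \<Longrightarrow> cohomology_bracket S \<Phi> (cls a) (cls b) = cls (cochain_bracket a b)"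
proof -
  assume a: "a \<in> Z" "b \<in> Z"
  have "(\<Union>x\<in>cls a. \<Union>y\<in>cls b. cls (cochain_bracket x y)) = cls (cochain_bracket a b)"
  proof (rule class_UN[OF a Z_cochain_bracket])
    fix x y c assume *: "x \<in> Z" "y \<in> Z" "c \<in> C"
    { assume xc: "x + d c \<in> Z"
      obtain w where w: "w \<in> C" "rs (bracket (D (\<Phi> c)) (\<Phi> y)) = d w"
        using rs_bracket_exact_left[of "\<Phi> y" "\<Phi> c"] * ZD Phi_closed by metis
      have "cochain_bracket (x + d c) y = cochain_bracket x y + d w"
        using * ZD by (simp add: cochain_bracket_def Phi_add Phi_d Phi_closed d_closed D_closed bracket_add_left rs_add w(2)[symmetric])
      then show "cls (cochain_bracket (x + d c) y) = cls (cochain_bracket x y)" using * xc w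
        by (intro cls_eqI[of "cochain_bracket x y" _ w] Z_cochain_bracket) }
    { assume yc: "y + d c \<in> Z"
      obtain w where w: "w \<in> C" "rs (bracket (\<Phi> x) (D (\<Phi> c))) = d w"
        using rs_bracket_exact_right[of "\<Phi> x" "\<Phi> c"] * ZD Phi_closed by metis
      have "cochain_bracket x (y + d c) = cochain_bracket x y + d w"
        using * ZD by (simp add: cochain_bracket_def Phi_add Phi_d Phi_closed d_closed D_closed bracket_add_right rs_add w(2)[symmetric])
      then show "cls (cochain_bracket x (y + d c)) = cls (cochain_bracket x y)" using * yc w
        by (intro cls_eqI[of "cochain_bracket x y" _ w] Z_cochain_bracket) }
  qed
  then show ?thesis by (simp add: cohomology_bracket_def cochain_bracket_def)
qed

lemma smult_cls: "a \<in> Z \<Longrightarrow> c \<odot>\<^bsub>M\<^esub> cls a = cls (ext_scale c a)"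
proof -
  assume a: "a \<in> Z"
  have "cls (ext_scale c x) = cls (ext_scale c a)" if "x \<in> cls a" for x
  proof -
    from that obtain e where "x = a + d e" "e \<in> C" "x \<in> Z" by (auto simp: cohomologous_iff)
    then show ?thesis using a
      by (intro cls_eqI[of "ext_scale c a" _ "ext_scale c e"] Z_scale C_intros) (auto simp: ext_scale_add d_scale)
  qed
  moreover have "a \<in> cls a" using a by (rule cls_self)
  ultimately have "(\<Union>x\<in>cls a. cls (ext_scale c x)) = cls (ext_scale c a)" by blast
  then show ?thesis by (simp add: cohomology_def ext_scale_def)
qed

definition unit_cochain :: "('m, 'k) ext" where "unit_cochain = monomial (restr S 1) {}"

lemma unit_cochain_C: "unit_cochain \<in> C"
  using zmul.zero_mem by (auto simp: unit_cochain_def ext_over_def monomial_def restr_mem smooth_funs_1)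

lemma RZ_restr: "f \<in> RZ \<Longrightarrow> restr S 1 * f = f" "f \<in> RZ \<Longrightarrow> f * restr S 1 = f"
  by (auto simp: smooth_funs_Z_def restr_def fun_eq_iff)

lemma unit_cochain_left: "a \<in> C \<Longrightarrow> unit_cochain \<and>\<^sub>e a = a"
  using wedge_one_left[OF ext_over_UNIV, of a RZ "lie_dim S" "restr S 1"] RZ_restr(1)
  by (simp add: unit_cochain_def ext_over_def)

lemma unit_cochain_right: "a \<in> C \<Longrightarrow> a \<and>\<^sub>e unit_cochain = a"
  using wedge_one_right[OF ext_over_UNIV, of a RZ "lie_dim S" "restr S 1"] RZ_restr(2)
  by (simp add: unit_cochain_def ext_over_def)

lemma unit_cochain_deg: "unit_cochain \<in> cochains_deg S 0"
  using homog_monomial[of "\<lambda>U. int (card U)" "{}" "restr S 1"] unit_cochain_C by (simp add: cochains_deg_iff unit_cochain_def)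

text \<open>
  The derivation rule for the product of the unit with itself.
\<close>

lemma unit_cochain_Z: "unit_cochain \<in> Z"
proof -
  have "twist unit_cochain = unit_cochain" by (auto simp: unit_cochain_def monomial_def twist_def fun_eq_iff)
  then have "d unit_cochain = d unit_cochain + d unit_cochain"
    using d_wedge[OF unit_cochain_C unit_cochain_C] unit_cochain_C d_closed by (simp add: unit_cochain_left unit_cochain_right)
  then show ?thesis by (simp add: Z_iff unit_cochain_C)
qed

lemma one_cls: "\<one>\<^bsub>M\<^esub> = cls unit_cochain" and zero_cls: "\<zero>\<^bsub>M\<^esub> = cls 0"
  by (simp_all add: cohomology_def unit_cochain_def cochain0_eq_monomial)

lemma C_UNIV: "a \<in> C \<Longrightarrow> a \<in> ext_over UNIV (lie_dim S)"
  by (rule ext_over_UNIV)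

sublocale coh: Ring.ring M
proof (rule ringI)
  show "abelian_group M"
  proof (rule abelian_groupI; unfold carrier_cohomology; (elim imageE)?; (simp only:)?)
    fix a assume "a \<in> Z"
    then show "\<exists>y\<in>cls ` Z. y \<oplus>\<^bsub>M\<^esub> cls a = \<zero>\<^bsub>M\<^esub>"
      by (intro bexI[of _ "cls (- a)"]) (auto simp: add_cls Z_uminus zero_cls)
  qed (auto simp: add_cls zero_cls Z_add Z_zero add_ac)
  show "monoid M"
  proof (rule monoidI; unfold carrier_cohomology; (elim imageE)?; (simp only:)?)
    fix a b c assume "a \<in> Z" "b \<in> Z" "c \<in> Z"
    then show "cls a \<otimes>\<^bsub>M\<^esub> cls b \<otimes>\<^bsub>M\<^esub> cls c = cls a \<otimes>\<^bsub>M\<^esub> (cls b \<otimes>\<^bsub>M\<^esub> cls c)"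
      by (simp add: mult_cls Z_wedge wedge_assoc[OF C_UNIV C_UNIV C_UNIV] ZD)
  qed (auto simp: mult_cls one_cls Z_wedge unit_cochain_Z unit_cochain_left unit_cochain_right ZD)
qed (auto simp: carrier_cohomology add_cls mult_cls Z_wedge Z_add C_wedge_add_left C_wedge_add_right ZD)

lemma uminus_cls: "a \<in> Z \<Longrightarrow> \<ominus>\<^bsub>M\<^esub> cls a = cls (- a)"
  by (rule coh.minus_equality) (auto simp: add_cls Z_uminus zero_cls carrier_cohomology)

lemma koszul_sign_cls:
  "a \<in> Z \<Longrightarrow> koszul_sign M i j (cls a) = cls (if odd i \<and> odd j then - a else a)"
  by (simp add: koszul_sign_def uminus_cls)

lemma cohomology_module: "Module.module scalar_ring M"
proof (rule moduleI[OF scalar_ring_cring coh.is_abelian_group]; unfold carrier_cohomology; (elim imageE)?; (simp only:)?)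
  fix a b :: 'k and x y assume x: "x \<in> Z"
  show "a \<odot>\<^bsub>M\<^esub> cls x \<in> cls ` Z"
    using x by (simp add: smult_cls Z_scale)
  have "ext_scale (a + b) x = ext_scale a x + ext_scale b x" by (simp add: ext_scale_def fun_eq_iff distrib_right)
  then show "(a \<oplus>\<^bsub>scalar_ring\<^esub> b) \<odot>\<^bsub>M\<^esub> cls x = a \<odot>\<^bsub>M\<^esub> cls x \<oplus>\<^bsub>M\<^esub> b \<odot>\<^bsub>M\<^esub> cls x"
    using x by (simp add: scalar_ring_def smult_cls add_cls Z_scale)
  show "(a \<otimes>\<^bsub>scalar_ring\<^esub> b) \<odot>\<^bsub>M\<^esub> cls x = a \<odot>\<^bsub>M\<^esub> (b \<odot>\<^bsub>M\<^esub> cls x)"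
    using x by (simp add: scalar_ring_def smult_cls Z_scale ext_scale_scale)
  show "\<one>\<^bsub>scalar_ring\<^esub> \<odot>\<^bsub>M\<^esub> cls x = cls x"
    using x by (simp add: scalar_ring_def smult_cls)
  assume y: "y \<in> Z"
  show "a \<odot>\<^bsub>M\<^esub> (cls x \<oplus>\<^bsub>M\<^esub> cls y) = a \<odot>\<^bsub>M\<^esub> cls x \<oplus>\<^bsub>M\<^esub> a \<odot>\<^bsub>M\<^esub> cls y"
    using x y by (simp add: smult_cls add_cls Z_scale Z_add ext_scale_add)
qed

end

section \<open>Grading of the cohomology\<close>

definition degree_part :: "int \<Rightarrow> ('m, 'k::real_normed_field) ext \<Rightarrow> ('m, 'k) ext" where
  "degree_part k u = (\<lambda>U. if int (card U) = k then u U else 0)"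

lemma degree_part_add: "degree_part k (u + v) = degree_part k u + degree_part k v"
  and degree_part_zero: "degree_part k 0 = 0"
  by (auto simp: degree_part_def fun_eq_iff)

lemma degree_part_sum: "degree_part k (\<Sum>a\<in>X. f a) = (\<Sum>a\<in>X. degree_part k (f a))"
  by (auto simp: degree_part_def fun_eq_iff sum_ext_apply)

context brst_contraction
begin

lemma degree_part_deg: "u \<in> C \<Longrightarrow> degree_part k u \<in> cochains_deg S k"
  using zmul.zero_mem by (auto simp: cochains_deg_iff homog_def degree_part_def ext_over_def)

lemma degree_part_C: "u \<in> C \<Longrightarrow> degree_part k u \<in> C"
  using degree_part_deg cochains_degD by blast

lemma degree_part_of_deg: "u \<in> cochains_deg S j \<Longrightarrow> degree_part k u = (if k = j then u else 0)"
  by (auto simp: degree_part_def cochains_deg_def fun_eq_iff)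

abbreviation degs :: "int set" where "degs \<equiv> {0..int (lie_dim S)}"

lemma degree_part_outside: "u \<in> C \<Longrightarrow> k \<notin> degs \<Longrightarrow> degree_part k u = 0"
proof -
  assume u: "u \<in> C" and k: "k \<notin> degs"
  have "degree_part k u U = 0" for U
  proof (cases "U \<subseteq> {..<lie_dim S}")
    case True
    then have "card U \<le> lie_dim S" using card_mono[OF finite_lessThan True] by simp
    then show ?thesis using k by (auto simp: degree_part_def)
  next
    case False
    then show ?thesis using u by (simp add: degree_part_def ext_over_def)
  qed
  then show ?thesis by (simp add: fun_eq_iff)
qed

lemma sum_degree_part: "u \<in> C \<Longrightarrow> (\<Sum>k\<in>degs. degree_part k u) = u"
proof (intro ext)
  fix U p assume u: "u \<in> C"
  have "(\<Sum>k\<in>degs. degree_part k u) U p = (\<Sum>k\<in>degs. if int (card U) = k then u U p else 0)"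
    by (simp add: sum_ext_apply degree_part_def if_distrib[of "\<lambda>f. f p"] cong: if_cong)
  also have "\<dots> = (if int (card U) \<in> degs then u U p else 0)"
    by simp
  also have "\<dots> = u U p"
    using fun_cong[OF degree_part_outside[OF u, of "int (card U)"], of U] by (auto simp: degree_part_def)
  finally show "(\<Sum>k\<in>degs. degree_part k u) U p = u U p" .
qed

text \<open>
  The differential raises the degree by 1, hence maps components to components.
\<close>

lemma degree_part_d: "u \<in> C \<Longrightarrow> degree_part (k + 1) (d u) = d (degree_part k u)"
proof -
  assume u: "u \<in> C"
  have "d u = (\<Sum>j\<in>degs. d (degree_part j u))"
    using d_sum[of degs "\<lambda>j. degree_part j u"] degree_part_C[OF u] sum_degree_part[OF u] by simp
  then have "degree_part (k + 1) (d u) = (\<Sum>j\<in>degs. degree_part (k + 1) (d (degree_part j u)))"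
    by (simp add: degree_part_sum)
  also have "\<dots> = (\<Sum>j\<in>degs. if j = k then d (degree_part k u) else 0)"
    using degree_part_of_deg[OF d_deg[OF degree_part_deg[OF u]]] by (intro sum.cong refl) auto
  also have "\<dots> = d (degree_part k u)"
    using degree_part_outside[OF u, of k] by (auto simp: d_zero)
  finally show ?thesis .
qed

lemma degree_part_Z: "u \<in> Z \<Longrightarrow> degree_part k u \<in> Z"
  using degree_part_d[of u k] by (simp add: Z_iff degree_part_C degree_part_zero)

abbreviation HD where "HD \<equiv> cohomology_deg S"

lemma HD_E:
  assumes "X \<in> HD k" obtains a where "a \<in> Z" "a \<in> cochains_deg S k" "X = cls a"
  using assms by (auto simp: cohomology_deg_def)

lemma HD_I: "a \<in> Z \<Longrightarrow> a \<in> cochains_deg S k \<Longrightarrow> cls a \<in> HD k"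
  by (auto simp: cohomology_deg_def)

lemma cochains_deg_add: "u \<in> cochains_deg S k \<Longrightarrow> v \<in> cochains_deg S k \<Longrightarrow> u + v \<in> cochains_deg S k"
  and cochains_deg_scale: "u \<in> cochains_deg S k \<Longrightarrow> ext_scale c u \<in> cochains_deg S k"
  and cochains_deg_zero: "0 \<in> cochains_deg S k"
  by (simp_all add: cochains_deg_iff C_intros homog_add homog_scale)

lemma HD_submodule: "submodule (HD k) scalar_ring M"
proof -
  interpret Module.module scalar_ring M by (rule cohomology_module)
  show ?thesis
  proof (rule submoduleI)
    show "HD k \<subseteq> carrier M" by (auto simp: carrier_cohomology cohomology_deg_def)
    show "\<zero>\<^bsub>M\<^esub> \<in> HD k" by (simp add: zero_cls HD_I Z_zero cochains_deg_zero)
  next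
    fix X assume "X \<in> HD k"
    then show "\<ominus>\<^bsub>M\<^esub> X \<in> HD k"
      by (elim HD_E) (auto simp: uminus_cls simp flip: ext_scale_uminus intro!: HD_I Z_scale cochains_deg_scale)
  next
    fix X Y assume "X \<in> HD k" "Y \<in> HD k"
    then show "X \<oplus>\<^bsub>M\<^esub> Y \<in> HD k"
      by (elim HD_E) (auto simp: add_cls intro!: HD_I Z_add cochains_deg_add)
  next
    fix c :: 'k and X assume "X \<in> HD k"
    then show "c \<odot>\<^bsub>M\<^esub> X \<in> HD k"
      by (elim HD_E) (auto simp: smult_cls intro!: HD_I Z_scale cochains_deg_scale)
  qed
qed

lemma HD_rep:
  assumes "X \<in> HD k"
  shows "\<exists>b. b \<in> Z \<and> b \<in> cochains_deg S k \<and> X = cls b \<and> (X = \<zero>\<^bsub>M\<^esub> \<longrightarrow> b = 0)"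
proof (cases "X = \<zero>\<^bsub>M\<^esub>")
  case True
  then show ?thesis by (intro exI[of _ 0]) (simp add: Z_zero cochains_deg_zero zero_cls)
next
  case False
  then show ?thesis using assms by (elim HD_E) blast
qed

lemma Z_sum: "(\<And>i. i \<in> I \<Longrightarrow> b i \<in> Z) \<Longrightarrow> (\<Sum>i\<in>I. b i) \<in> Z"
  by (simp add: Z_iff C_intros d_sum)

lemma finsum_cls:
  assumes "finite I" "\<And>i. i \<in> I \<Longrightarrow> b i \<in> Z"
  shows "finsum M (\<lambda>i. cls (b i)) I = cls (\<Sum>i\<in>I. b i)"
  using assms
proof (induction I)
  case (insert i I)
  have "finsum M (\<lambda>i. cls (b i)) (insert i I) = cls (b i) \<oplus>\<^bsub>M\<^esub> finsum M (\<lambda>i. cls (b i)) I"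
    using insert by (intro coh.finsum_insert) (auto simp: carrier_cohomology)
  also have "\<dots> = cls (b i + (\<Sum>i\<in>I. b i))"
    using insert by (simp add: add_cls Z_sum)
  also have "b i + (\<Sum>i\<in>I. b i) = (\<Sum>i\<in>insert i I. b i)"
    using insert by simp
  finally show ?case .
qed (simp add: zero_cls)

text \<open>
  The components of a cocycle are cocycles, and the components of a coboundary \<open>d c\<close> are the
  coboundaries of the components of \<open>c\<close>, shifted by one degree. The former gives existence and the
  latter uniqueness of the decomposition.
\<close>

lemma HD_direct_sum:
  assumes "X \<in> carrier M"
  shows "\<exists>!f. (\<forall>i. f i \<in> HD i) \<and> finite {i. f i \<noteq> \<zero>\<^bsub>M\<^esub>} \<and> X = finsum M f {i. f i \<noteq> \<zero>\<^bsub>M\<^esub>}"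
proof -
  obtain a where a: "a \<in> Z" "X = cls a" using assms by (auto simp: carrier_cohomology)
  let ?f = "\<lambda>i. cls (degree_part i a)"
  have sup: "{i. ?f i \<noteq> \<zero>\<^bsub>M\<^esub>} \<subseteq> degs"
    using degree_part_outside[OF ZD(1)[OF a(1)]] by (auto simp: zero_cls)
  show ?thesis
  proof (rule ex1I[of _ ?f], intro conjI allI)
    show "?f i \<in> HD i" for i using a by (intro HD_I degree_part_Z degree_part_deg ZD)
    show fin: "finite {i. ?f i \<noteq> \<zero>\<^bsub>M\<^esub>}" using sup finite_subset by blast
    have "finsum M ?f {i. ?f i \<noteq> \<zero>\<^bsub>M\<^esub>} = finsum M ?f degs"
      using sup a by (intro coh.add.finprod_mono_neutral_cong_left) (auto simp: carrier_cohomology degree_part_Z)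
    also have "\<dots> = cls (\<Sum>i\<in>degs. degree_part i a)"
      using a by (intro finsum_cls degree_part_Z) auto
    finally show "X = finsum M ?f {i. ?f i \<noteq> \<zero>\<^bsub>M\<^esub>}"
      using a sum_degree_part ZD by simp
  next
    \<comment> \<open>uniqueness: compare the components of \<open>a\<close> with those of a sum of representatives of \<open>g\<close>,
      choosing \<open>0\<close> outside the support of \<open>g\<close>\<close>
    fix g assume g: "(\<forall>i. g i \<in> HD i) \<and> finite {i. g i \<noteq> \<zero>\<^bsub>M\<^esub>} \<and> X = finsum M g {i. g i \<noteq> \<zero>\<^bsub>M\<^esub>}"
    let ?I = "{i. g i \<noteq> \<zero>\<^bsub>M\<^esub>}"
    have "\<forall>i. \<exists>b. b \<in> Z \<and> b \<in> cochains_deg S i \<and> g i = cls b \<and> (g i = \<zero>\<^bsub>M\<^esub> \<longrightarrow> b = 0)"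
      using g HD_rep by blast
    then obtain b where b': "\<forall>i. b i \<in> Z \<and> b i \<in> cochains_deg S i \<and> g i = cls (b i) \<and> (g i = \<zero>\<^bsub>M\<^esub> \<longrightarrow> b i = 0)"
      by (rule choice[THEN exE])
    then have b: "\<And>i. b i \<in> Z" "\<And>i. b i \<in> cochains_deg S i" "\<And>i. g i = cls (b i)" by blast+
    have b4: "b i = 0" if "i \<notin> ?I" for i
      using b'[THEN spec[of _ i]] that by (elim conjE) simp
    have "cls (\<Sum>i\<in>?I. b i) = X"
    proof -
      have "g = (\<lambda>i. cls (b i))" using b(3) by (rule ext)
      then have "finsum M g ?I = finsum M (\<lambda>i. cls (b i)) ?I" by (rule arg_cong)
      also have "\<dots> = cls (\<Sum>i\<in>?I. b i)" using g by (intro finsum_cls b) blast+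
      finally show ?thesis using g by (simp only:)
    qed
    moreover have "(\<Sum>i\<in>?I. b i) \<in> Z" using b by (intro Z_sum)
    ultimately obtain c where c: "c \<in> C" "a = (\<Sum>i\<in>?I. b i) + d c"
      using a cls_eq_iff[of "\<Sum>i\<in>?I. b i" a] by auto
    show "g = ?f"
    proof
      fix j
      have "degree_part j (\<Sum>i\<in>?I. b i) = (\<Sum>i\<in>?I. if i = j then b j else 0)"
        unfolding degree_part_sum using degree_part_of_deg[OF b(2)] by (intro sum.cong refl) auto
      also have "\<dots> = b j" using g b4[of j] by (cases "j \<in> ?I") (simp_all only: sum.delta' sum.delta if_True if_False simp_thms)
      finally have "degree_part j a = b j + d (degree_part (j - 1) c)"
        using c degree_part_d[of c "j - 1"] by (simp add: degree_part_add)
      from cls_eqI[OF b(1) degree_part_Z[OF a(1)] degree_part_C[OF c(1)] this]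
      show "g j = ?f j" unfolding b(3) by (rule sym)
    qed
  qed
qed

lemma cochain_bracket_deg: "a \<in> cochains_deg S i \<Longrightarrow> b \<in> cochains_deg S j \<Longrightarrow> cochain_bracket a b \<in> cochains_deg S (i + j)"
  unfolding cochain_bracket_def using Phi_deg by (intro rs_deg brst_deg_bracket) blast+

lemma Phi_parity: "a \<in> cochains_deg S i \<Longrightarrow> parity (odd i) (\<Phi> a)"
  using Phi_deg parity_brst_deg by blast

lemma twist_if_deg: "b \<in> cochains_deg S j \<Longrightarrow> twist_if (odd i) b = (if odd i \<and> odd j then - b else b)"
  using twist_if_parity[OF parity_cochains_deg, of b j "odd i"] by auto

lemma twist_if_Phi_deg: "b \<in> cochains_deg S j \<Longrightarrow> twist_if (odd i) (\<Phi> b) = (if odd i \<and> odd j then - \<Phi> b else \<Phi> b)"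
  using twist_if_parity[OF Phi_parity, of b j "odd i"] by auto

lemma cochain_bracket_uminus_left: "a \<in> Z \<Longrightarrow> b \<in> Z \<Longrightarrow> cochain_bracket (- a) b = - cochain_bracket a b"
  and cochain_bracket_add_left: "a \<in> Z \<Longrightarrow> b \<in> Z \<Longrightarrow> c \<in> Z \<Longrightarrow> cochain_bracket (a + b) c = cochain_bracket a c + cochain_bracket b c"
  and cochain_bracket_add_right: "a \<in> Z \<Longrightarrow> b \<in> Z \<Longrightarrow> c \<in> Z \<Longrightarrow> cochain_bracket c (a + b) = cochain_bracket c a + cochain_bracket c b"
  and cochain_bracket_scale_left: "a \<in> Z \<Longrightarrow> b \<in> Z \<Longrightarrow> cochain_bracket (ext_scale x a) b = ext_scale x (cochain_bracket a b)"
  and cochain_bracket_scale_right: "a \<in> Z \<Longrightarrow> b \<in> Z \<Longrightarrow> cochain_bracket a (ext_scale x b) = ext_scale x (cochain_bracket a b)"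
  using Phi_scale[of a "- 1"]
  by (simp_all add: cochain_bracket_def ZD Phi_add Phi_scale bracket_add_left bracket_add_right bracket_scale_left bracket_scale_right rs_add rs_scale
      ext_scale_uminus bracket_uminus_left rs_uminus)

lemma cochain_bracket_antisym:
  assumes a: "a \<in> Z" "a \<in> cochains_deg S i" and b: "b \<in> Z" "b \<in> cochains_deg S j"
  shows "cochain_bracket a b = - (if odd i \<and> odd j then - cochain_bracket b a else cochain_bracket b a)"
proof -
  have "bracket (\<Phi> a) (\<Phi> b) = - bracket (twist_if (odd i) (\<Phi> b)) (\<Phi> a)"
    using a b by (intro bracket_antisym ZD Phi_parity)
  then show ?thesis
    using a b by (auto simp: cochain_bracket_def twist_if_Phi_deg[OF b(2)] bracket_uminus_left ZD rs_uminus)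
qed

lemma cls_diff_d: "x \<in> Z \<Longrightarrow> y \<in> Z \<Longrightarrow> c \<in> C \<Longrightarrow> y = x - d c \<Longrightarrow> cls y = cls x"
  by (rule cls_eqI[of x y "- c"]) (auto simp: C_intros d_uminus)

text \<open>
  The product \<open>\<Phi> b \<and>\<^sub>e \<Phi> c\<close> is a cocycle with restriction \<open>b \<and>\<^sub>e c\<close>, hence differs from \<open>\<Phi> (b \<and>\<^sub>e c)\<close> by
  an exact element. The Leibniz rule can thus be applied in the BRST algebra.
\<close>

lemma cochain_bracket_leibniz:
  assumes a: "a \<in> Z" "parity e (\<Phi> a)" and b: "b \<in> Z" and c: "c \<in> Z"
  shows "cls (cochain_bracket a (b \<and>\<^sub>e c)) = cls (cochain_bracket a b \<and>\<^sub>e c + twist_if e b \<and>\<^sub>e cochain_bracket a c)"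
proof -
  have F: "\<Phi> b \<and>\<^sub>e \<Phi> c \<in> E" "D (\<Phi> b \<and>\<^sub>e \<Phi> c) = 0"
    using b c by (simp_all add: ZD E_intros D_wedge wedge_zero_left wedge_zero_right)
  obtain Y where Y: "Y \<in> E" "\<Phi> (rs (\<Phi> b \<and>\<^sub>e \<Phi> c)) = \<Phi> b \<and>\<^sub>e \<Phi> c - D Y"
    by (rule Phi_rs_closed[OF F])
  obtain w where w: "w \<in> C" "rs (bracket (\<Phi> a) (D Y)) = d w"
    by (rule rs_bracket_exact_right[OF ZD(3)[OF a(1)] ZD(4)[OF a(1)] Y(1)])
  have "rs (\<Phi> b \<and>\<^sub>e \<Phi> c) = b \<and>\<^sub>e c" using b c by (simp add: rs_wedge rs_Phi ZD)
  then have "cochain_bracket a (b \<and>\<^sub>e c) = rs (bracket (\<Phi> a) (\<Phi> b \<and>\<^sub>e \<Phi> c)) - d w"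
    using Y w F a by (simp add: cochain_bracket_def bracket_diff_right ZD D_closed rs_diff)
  also have "rs (bracket (\<Phi> a) (\<Phi> b \<and>\<^sub>e \<Phi> c)) = cochain_bracket a b \<and>\<^sub>e c + twist_if e b \<and>\<^sub>e cochain_bracket a c"
    using a b c by (auto simp: bracket_leibniz[OF _ _ _ a(2)] ZD rs_add rs_wedge cochain_bracket_def rs_Phi twist_if_def rs_twist)
  finally have "cochain_bracket a (b \<and>\<^sub>e c) = cochain_bracket a b \<and>\<^sub>e c + twist_if e b \<and>\<^sub>e cochain_bracket a c - d w" .
  moreover have "cochain_bracket a (b \<and>\<^sub>e c) \<in> Z" "cochain_bracket a b \<and>\<^sub>e c + twist_if e b \<and>\<^sub>e cochain_bracket a c \<in> Z"
    using a b c by (auto intro!: Z_cochain_bracket Z_add Z_wedge Z_twist_if)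
  ultimately show ?thesis
    using w by (intro cls_diff_d[of _ _ w])
qed

lemma bracket_cocycle:
  assumes "F \<in> E" "D F = 0" "G \<in> E" "D G = 0"
  shows "bracket F G \<in> E" "D (bracket F G) = 0" "rs (bracket F G) \<in> Z"
proof -
  show 1: "bracket F G \<in> E" using assms by (intro bracket_closed)
  show 2: "D (bracket F G) = 0" using assms by (simp add: D_bracket bracket_zero_left bracket_zero_right E_twist)
  show "rs (bracket F G) \<in> Z" unfolding Z_iff using rs_closed[OF 1] d_rs[OF 1] 2 rs_zero by simp
qed

text \<open>
  Lifting the restriction of a cocycle \<open>F\<close> gives back \<open>F\<close> up to an exact element, which contributes a
  coboundary to the bracket.
\<close>

lemma cls_cochain_bracket_rs_right:
  assumes a: "a \<in> Z" and F: "F \<in> E" "D F = 0" and m: "rs F \<in> Z"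
  shows "cls (cochain_bracket a (rs F)) = cls (rs (bracket (\<Phi> a) F))"
proof -
  obtain Y where Y: "Y \<in> E" "\<Phi> (rs F) = F - D Y"
    by (rule Phi_rs_closed[OF F])
  obtain w where w: "w \<in> C" "rs (bracket (\<Phi> a) (D Y)) = d w"
    by (rule rs_bracket_exact_right[OF ZD(3)[OF a] ZD(4)[OF a] Y(1)])
  have "cochain_bracket a (rs F) = rs (bracket (\<Phi> a) F) - d w"
    using Y w F a by (simp add: cochain_bracket_def bracket_diff_right ZD D_closed rs_diff)
  moreover have "rs (bracket (\<Phi> a) F) \<in> Z"
    by (rule bracket_cocycle(3)[OF ZD(3,4)[OF a] F])
  ultimately show ?thesis using a m w by (intro cls_diff_d[of _ _ w] Z_cochain_bracket)
qed

lemma cls_cochain_bracket_rs_left: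
  assumes a: "a \<in> Z" and F: "F \<in> E" "D F = 0" and m: "rs F \<in> Z"
  shows "cls (cochain_bracket (rs F) a) = cls (rs (bracket F (\<Phi> a)))"
proof -
  obtain Y where Y: "Y \<in> E" "\<Phi> (rs F) = F - D Y"
    by (rule Phi_rs_closed[OF F])
  obtain w where w: "w \<in> C" "rs (bracket (D Y) (\<Phi> a)) = d w"
    by (rule rs_bracket_exact_left[OF ZD(3)[OF a] ZD(4)[OF a] Y(1)])
  have "cochain_bracket (rs F) a = rs (bracket F (\<Phi> a)) - d w"
    using Y w F a by (simp add: cochain_bracket_def bracket_diff_left ZD D_closed rs_diff)
  moreover have "rs (bracket F (\<Phi> a)) \<in> Z"
    by (rule bracket_cocycle(3)[OF F ZD(3,4)[OF a]])
  ultimately show ?thesis using a m w by (intro cls_diff_d[of _ _ w] Z_cochain_bracket)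
qed

text \<open>
  In each of the three terms the inner bracket is a restriction that is lifted again, which amounts to
  the identity on classes. What remains is the Jacobi identity in the BRST algebra.
\<close>

lemma cochain_bracket_jacobi:
  assumes a: "a \<in> Z" "parity e (\<Phi> a)" and b: "b \<in> Z" "twist_if e (\<Phi> b) = \<Phi> (twist_if e b)" and c: "c \<in> Z"
  shows "cls (cochain_bracket a (cochain_bracket b c)) = cls (cochain_bracket (cochain_bracket a b) c) \<oplus>\<^bsub>M\<^esub> cls (cochain_bracket (twist_if e b) (cochain_bracket a c))"
proof -
  let ?b = "twist_if e b"
  have b': "?b \<in> Z" using b(1) by (rule Z_twist_if)
  note A = ZD(3,4)[OF a(1)] and B = ZD(3,4)[OF b(1)] and B' = ZD(3,4)[OF b'] and C = ZD(3,4)[OF c]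
  note AB = bracket_cocycle[OF A B] and BC = bracket_cocycle[OF B C] and AC = bracket_cocycle[OF A C]
  have "cls (cochain_bracket a (cochain_bracket b c)) = cls (rs (bracket (\<Phi> a) (bracket (\<Phi> b) (\<Phi> c))))"
    unfolding cochain_bracket_def[of b c] by (rule cls_cochain_bracket_rs_right[OF a(1) BC])
  also have "bracket (\<Phi> a) (bracket (\<Phi> b) (\<Phi> c)) =
      bracket (bracket (\<Phi> a) (\<Phi> b)) (\<Phi> c) + bracket (\<Phi> ?b) (bracket (\<Phi> a) (\<Phi> c))"
    using bracket_jacobi[OF A(1) B(1) C(1) a(2)] unfolding b(2) .
  also have "cls (rs \<dots>) = cls (rs (bracket (bracket (\<Phi> a) (\<Phi> b)) (\<Phi> c))) \<oplus>\<^bsub>M\<^esub> cls (rs (bracket (\<Phi> ?b) (bracket (\<Phi> a) (\<Phi> c))))"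
    unfolding rs_add
    by (rule add_cls[symmetric, OF bracket_cocycle(3)[OF AB(1,2) C] bracket_cocycle(3)[OF B' AC(1,2)]])
  also have "cls (rs (bracket (bracket (\<Phi> a) (\<Phi> b)) (\<Phi> c))) = cls (cochain_bracket (cochain_bracket a b) c)"
    unfolding cochain_bracket_def[of a b] by (rule cls_cochain_bracket_rs_left[OF c AB, symmetric])
  also have "cls (rs (bracket (\<Phi> ?b) (bracket (\<Phi> a) (\<Phi> c)))) = cls (cochain_bracket ?b (cochain_bracket a c))"
    unfolding cochain_bracket_def[of a c] by (rule cls_cochain_bracket_rs_right[OF b' AC, symmetric])
  finally show ?thesis .
qed

end

context brst_contraction
begin
lemma cohomology_graded_poisson:
  "graded_poisson_algebra scalar_ring M HD (cohomology_bracket S \<Phi>)"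
proof -
  interpret Module.module scalar_ring M by (rule cohomology_module)
  note ops = add_cls mult_cls smult_cls cohomology_bracket_cls Z_cochain_bracket Z_add Z_scale Z_wedge koszul_sign_cls uminus_cls Z_uminus
  have [simp]: "ext_scale c x \<and>\<^sub>e y = ext_scale c (x \<and>\<^sub>e y)" "x \<and>\<^sub>e ext_scale c y = ext_scale c (x \<and>\<^sub>e y)" if "x \<in> Z" "y \<in> Z" for c x y
    using that by (simp_all add: C_wedge_scale_left C_wedge_scale_right ZD)
  show ?thesis
  proof (intro graded_poisson_algebra.intro graded_poisson_algebra_axioms.intro)
    fix X Y i j assume "X \<in> HD i" "Y \<in> HD j"
    then obtain a b where a: "a \<in> Z" "a \<in> cochains_deg S i" "X = cls a"
      and b: "b \<in> Z" "b \<in> cochains_deg S j" "Y = cls b" by (elim HD_E)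
    show "X \<otimes>\<^bsub>M\<^esub> Y \<in> HD (i + j)"
      using a b by (auto simp: ops intro!: HD_I cochains_deg_wedge)
    have "a \<and>\<^sub>e b = twist_if (odd i) b \<and>\<^sub>e a"
      using a b by (intro wedge_swap[OF C_UNIV C_UNIV] ZD parity_cochains_deg)
    also have "\<dots> = (if odd i \<and> odd j then - (b \<and>\<^sub>e a) else b \<and>\<^sub>e a)"
      using a b C_wedge_scale_left[of b a "- 1"] by (auto simp: twist_if_deg[OF b(2)] ext_scale_uminus ZD)
    finally show "X \<otimes>\<^bsub>M\<^esub> Y = koszul_sign M i j (Y \<otimes>\<^bsub>M\<^esub> X)"
      using a b by (simp add: ops)
    show "cohomology_bracket S \<Phi> X Y \<in> HD (i + j)"
      using a b by (auto simp: ops intro!: HD_I cochain_bracket_deg)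
    show "cohomology_bracket S \<Phi> X Y = \<ominus>\<^bsub>M\<^esub> koszul_sign M i j (cohomology_bracket S \<Phi> Y X)"
      using a b cochain_bracket_antisym[OF a(1,2) b(1,2)] by (auto simp: ops)
    fix W k assume "W \<in> HD k"
    then obtain c where c: "c \<in> Z" "c \<in> cochains_deg S k" "W = cls c" by (elim HD_E)
    have twist_if: "twist_if (odd i) b = (if odd i \<and> odd j then - b else b)" by (rule twist_if_deg[OF b(2)])
    have cw: "- b \<and>\<^sub>e cochain_bracket a c = - (b \<and>\<^sub>e cochain_bracket a c)"
      using C_wedge_scale_left[of b "cochain_bracket a c" "- 1"] a b c by (simp add: ext_scale_uminus ZD Z_cochain_bracket)
    show "cohomology_bracket S \<Phi> X (Y \<otimes>\<^bsub>M\<^esub> W) =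
        cohomology_bracket S \<Phi> X Y \<otimes>\<^bsub>M\<^esub> W \<oplus>\<^bsub>M\<^esub> koszul_sign M i j (Y \<otimes>\<^bsub>M\<^esub> cohomology_bracket S \<Phi> X W)"
      using a b c cochain_bracket_leibniz[OF a(1) Phi_parity[OF a(2)] b(1) c(1)]
      by (auto simp: ops twist_if cw)
    have cc: "cochain_bracket (- b) (cochain_bracket a c) = - cochain_bracket b (cochain_bracket a c)"
      using a b c by (simp add: cochain_bracket_uminus_left Z_cochain_bracket)
    have "twist_if (odd i) (\<Phi> b) = \<Phi> (twist_if (odd i) b)"
      using Phi_scale[of b "- 1"] b by (auto simp: twist_if_Phi_deg[OF b(2)] twist_if ext_scale_uminus ZD)
    from cochain_bracket_jacobi[OF a(1) Phi_parity[OF a(2)] b(1) this c(1)]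
    show "cohomology_bracket S \<Phi> X (cohomology_bracket S \<Phi> Y W) =
        cohomology_bracket S \<Phi> (cohomology_bracket S \<Phi> X Y) W
        \<oplus>\<^bsub>M\<^esub> koszul_sign M i j (cohomology_bracket S \<Phi> Y (cohomology_bracket S \<Phi> X W))"
      using a b c by (auto simp: ops twist_if cc)
  next
    show "\<one>\<^bsub>M\<^esub> \<in> HD 0" by (simp add: one_cls HD_I unit_cochain_Z unit_cochain_deg)
  next
    fix c :: 'k and X Y assume "X \<in> carrier M" "Y \<in> carrier M"
    then obtain a b where a: "a \<in> Z" "X = cls a" and b: "b \<in> Z" "Y = cls b"
      by (auto simp: carrier_cohomology)
    show "(c \<odot>\<^bsub>M\<^esub> X) \<otimes>\<^bsub>M\<^esub> Y = c \<odot>\<^bsub>M\<^esub> (X \<otimes>\<^bsub>M\<^esub> Y)" "X \<otimes>\<^bsub>M\<^esub> (c \<odot>\<^bsub>M\<^esub> Y) = c \<odot>\<^bsub>M\<^esub> (X \<otimes>\<^bsub>M\<^esub> Y)"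
      using a b by (auto simp: ops)
    show "cohomology_bracket S \<Phi> X Y \<in> carrier M"
      using a b by (auto simp: ops carrier_cohomology)
    show "cohomology_bracket S \<Phi> (c \<odot>\<^bsub>M\<^esub> X) Y = c \<odot>\<^bsub>M\<^esub> cohomology_bracket S \<Phi> X Y"
      "cohomology_bracket S \<Phi> X (c \<odot>\<^bsub>M\<^esub> Y) = c \<odot>\<^bsub>M\<^esub> cohomology_bracket S \<Phi> X Y"
      using a b by (auto simp: ops cochain_bracket_scale_left cochain_bracket_scale_right)
    fix W assume "W \<in> carrier M"
    then obtain e where e: "e \<in> Z" "W = cls e" by (auto simp: carrier_cohomology)
    show "cohomology_bracket S \<Phi> (X \<oplus>\<^bsub>M\<^esub> Y) W = cohomology_bracket S \<Phi> X W \<oplus>\<^bsub>M\<^esub> cohomology_bracket S \<Phi> Y W"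
      "cohomology_bracket S \<Phi> X (Y \<oplus>\<^bsub>M\<^esub> W) = cohomology_bracket S \<Phi> X Y \<oplus>\<^bsub>M\<^esub> cohomology_bracket S \<Phi> X W"
      using a b e by (auto simp: ops cochain_bracket_add_left cochain_bracket_add_right)
  qed (fact HD_submodule HD_direct_sum cohomology_module coh.ring_axioms)+
qed

end

section \<open>Degree zero\<close>

context hamiltonian_space
begin

lemma mom_zero_fibre: "a < lie_dim S \<Longrightarrow> p \<in> zero_fibre S \<Longrightarrow> mom S a p = 0"
  using basis_mem by (simp add: zero_fibre_def moment_fun_def)

text \<open>
  By the resolution, \<open>f = \<Sum>\<^sub>a J\<^sub>a g\<^sub>a\<close>. In \<open>{f, h} = \<Sum>\<^sub>a J\<^sub>a {g\<^sub>a, h} + {J\<^sub>a, h} g\<^sub>a\<close> the first summand vanishes with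
  \<open>J\<^sub>a\<close> on the zero fibre and the second one by invariance of \<open>h\<close>.
\<close>

lemma restr_pbr_vanishing:
  assumes K: "koszul_resolution S"
    and f: "f \<in> R" "restr S f = 0" and h: "h \<in> R"
    and inv: "\<And>a. a < lie_dim S \<Longrightarrow> restr S (pbr S (mom S a) h) = 0"
  shows "restr S (pbr S f h) = 0"
proof -
  have "f p = 0" if "p \<in> zero_fibre S" for p
    using fun_cong[OF f(2), of p] that by (simp add: restr_def)
  then have "f \<in> vanishing_ideal S" using f(1) by (simp add: vanishing_ideal_def)
  then obtain G where G: "G \<in> koszul S 1" "f = koszul_diff S G {}"
    using K unfolding koszul_resolution_def by blast
  have GR: "G U \<in> R" for U using G(1) by (simp add: koszul_def ext_over_def)
  have "f = (\<lambda>p. \<Sum>a<lie_dim S. 1 * (mom S a * G {a}) p)"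
    unfolding G(2) koszul_diff_def by (simp add: lderiv_def)
  then have "pbr S f h = (\<lambda>p. \<Sum>a<lie_dim S. 1 * pbr S (mom S a * G {a}) h p)"
    using pb.sum_left[of "{..<lie_dim S}" "\<lambda>a. mom S a * G {a}" h "\<lambda>_. 1"] GR h mom_mem smooth_funs_mult
    by simp
  moreover have "pbr S (mom S a * G {a}) h p = 0" if "a < lie_dim S" "p \<in> zero_fibre S" for a p
    using fun_cong[OF inv[OF that(1)], of p] that GR h
    by (simp add: pbr_leibniz(2) mom_mem mom_zero_fibre restr_def)
  ultimately show ?thesis by (auto simp: restr_def fun_eq_iff)
qed

text \<open>
  The brackets \<open>{J\<^sub>a, J\<^sub>b}\<close> are linear combinations of the \<open>J\<^sub>c\<close>.
\<close>

lemma restr_pbr_mom: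
  assumes "a < lie_dim S" "b < lie_dim S"
  shows "restr S (pbr S (mom S a) (mom S b)) = 0"
  using assms by (auto simp: moment_bracket restr_def fun_eq_iff mom_zero_fibre)

text \<open>
  The action on a function on the zero fibre is computed on a chosen extension. Two extensions differ by
  an element of the vanishing ideal, which the \<open>J\<^sub>a\<close> preserve by the two preceding lemmas.
\<close>

lemma act_Z_restr:
  assumes K: "koszul_resolution S" and a: "a < lie_dim S" and f: "f \<in> R"
  shows "act_Z S a (restr S f) = restr S (pbr S (mom S a) f)"
proof -
  \<comment> \<open>the extension chosen in the definition of the action\<close>
  define g where "g = (SOME g. g \<in> smooth_funs S \<and> restr S g = restr S f)"
  have g: "g \<in> R" "restr S g = restr S f"
    unfolding g_def using someI[of "\<lambda>g. g \<in> smooth_funs S \<and> restr S g = restr S f" f] f by auto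
  have gf: "g - f \<in> R" using g f unfolding smooth_funs_def by (intro manifold.Cinf_diff)
  have "restr S (pbr S (g - f) (mom S a)) = 0"
    using restr_pbr_vanishing[OF K gf _ mom_mem[OF a]] restr_pbr_mom[OF _ a] g by (simp add: restr_diff)
  moreover have "pbr S (mom S a) g = pbr S (mom S a) f - pbr S (g - f) (mom S a)"
    using pbr_antisym[OF gf mom_mem[OF a]] pb.add_right[OF f gf mom_mem[OF a]] by simp
  ultimately show ?thesis
    unfolding act_Z_def g_def[symmetric] by (simp add: restr_diff)
qed

lemma act_Z_zero:
  assumes "koszul_resolution S" "a < lie_dim S"
  shows "act_Z S a 0 = 0"
  using act_Z_restr[OF assms smooth_funs_0] pb.zero_right[OF mom_mem[OF assms(2)]] by (simp add: restr_zero)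

lemma ce_diff_function:
  assumes K: "koszul_resolution S"
  shows "ce_diff S (monomial v {}) = (\<lambda>U p. \<Sum>a<lie_dim S. gen a U p * act_Z S a v p)"
proof -
  have "gen a \<and>\<^sub>e (\<lambda>T. act_Z S a (monomial v {} T)) = (\<lambda>U. gen a U * act_Z S a v)" if "a < lie_dim S" for a
  proof -
    have "(\<lambda>T. act_Z S a (monomial v {} T)) = monomial (act_Z S a v) {}"
      using act_Z_zero[OF K that] by (auto simp: monomial_def)
    moreover have "gen a \<in> E" using that by (intro gen_mem) simp
    ultimately show ?thesis by (simp only: wedge_one_right[OF ext_over_UNIV])
  qed
  moreover have "X \<and>\<^sub>e 0 = 0" for X :: "('m, 'k) ext"
    by (simp add: wedge_def fun_eq_iff)
  ultimately show ?thesis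
    by (intro ext) (simp add: ce_diff_def)
qed

lemma ce_diff_function_eq_0:
  assumes K: "koszul_resolution S"
  shows "ce_diff S (monomial v {}) = 0 \<longleftrightarrow> (\<forall>a<lie_dim S. act_Z S a v = 0)"
proof
  assume "ce_diff S (monomial v {}) = 0"
  then have 0: "(\<Sum>b<lie_dim S. gen b {a} p * act_Z S b v p) = 0" for a p
    by (simp add: ce_diff_function[OF K] fun_eq_iff)
  have "act_Z S a v p = 0" if "a < lie_dim S" for a p
  proof -
    have "(\<Sum>b<lie_dim S. gen b {a} p * act_Z S b v p) = (\<Sum>b<lie_dim S. if b = a then act_Z S a v p else 0)"
      by (intro sum.cong) (auto simp: gen_def)
    then show ?thesis using 0[of a p] that by simp
  qed
  then show "\<forall>a<lie_dim S. act_Z S a v = 0" by (simp add: fun_eq_iff)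
qed (simp add: ce_diff_function[OF K] fun_eq_iff)

text \<open>
  Extensions differ by elements of the vanishing ideal, and the bracket of such an element with an
  extension of an invariant function vanishes on the zero fibre.
\<close>

lemma restr_pbr_cong:
  assumes K: "koszul_resolution S"
    and R: "f \<in> R" "f' \<in> R" "g \<in> R" "g' \<in> R"
    and f: "restr S f \<in> invariants_Z S" "restr S f' = restr S f"
    and g: "restr S g \<in> invariants_Z S" "restr S g' = restr S g"
  shows "restr S (pbr S f' g') = restr S (pbr S f g)"
proof -
  have Rd: "f' - f \<in> R" "g' - g \<in> R"
    using R unfolding smooth_funs_def by (auto intro: manifold.Cinf_diff)
  have inv: "restr S (pbr S (mom S a) f) = 0" "restr S (pbr S (mom S a) g') = 0" if "a < lie_dim S" for a
    using f(1) g(1) act_Z_restr[OF K that R(1)] act_Z_restr[OF K that R(4)] that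
    unfolding g(2) invariants_Z_def by simp_all
  have "restr S (pbr S (f' - f) g') = 0" "restr S (pbr S (g' - g) f) = 0"
    by (rule restr_pbr_vanishing[OF K]; use Rd R f g inv in \<open>simp add: restr_diff\<close>)+
  moreover have "pbr S f' g' = pbr S f g + pbr S (f' - f) g' - pbr S (g' - g) f"
    using pb.add_left[OF R(1) Rd(1) R(4)] pb.add_right[OF R(3) Rd(2) R(1)] pbr_antisym[OF R(1) Rd(2)]
    by simp
  ultimately show ?thesis by (simp add: restr_add restr_diff)
qed

end

context brst_contraction
begin

text \<open>
  The empty set is the only finite index set of cardinality 0.
\<close>

lemma deg0_eq_function: "u \<in> cochains_deg S 0 \<Longrightarrow> u = monomial (u {}) {}"
proof (intro ext)
  fix U p assume u: "u \<in> cochains_deg S 0"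
  have "u U = 0" if "U \<noteq> {}"
  proof (rule ccontr)
    assume nz: "u U \<noteq> 0"
    then have "card U = 0" using u by (auto simp: cochains_deg_iff homog_def)
    moreover have "finite U" using nz ext_over_finite[OF cochains_degD[OF u]] by blast
    ultimately show False using that by simp
  qed
  then show "u U p = monomial (u {}) {} U p" by (simp add: monomial_def)
qed

lemma function_deg0: "v \<in> RZ \<Longrightarrow> monomial v {} \<in> cochains_deg S 0"
  using homog_monomial[of "\<lambda>U. int (card U)" "{}" v] zmul.zero_mem
  by (auto simp: cochains_deg_iff ext_over_def monomial_def)

lemma invariant_cocycle:
  assumes K: "koszul_resolution S" and v: "v \<in> RZ"
  shows "monomial v {} \<in> Z \<longleftrightarrow> v \<in> invariants_Z S"
  using v function_deg0[OF v] cochains_degD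
  by (auto simp: Z_iff ce_diff_function_eq_0[OF K] invariants_Z_def)

text \<open>
  A cochain of degree 0 is a function, and it is a cocycle if and only if it is invariant. Classes are
  single cochains because coboundaries have no component of degree 0.
\<close>

lemma invariants_bij:
  assumes K: "koszul_resolution S"
  shows "bij_betw (\<lambda>u. cls (monomial u {})) (invariants_Z S) (HD 0)"
  unfolding bij_betw_def
proof
  have mem: "u \<in> RZ" if "u \<in> invariants_Z S" for u using that by (simp add: invariants_Z_def)
  show "inj_on (\<lambda>u. cls (monomial u {})) (invariants_Z S)"
  proof (rule inj_onI)
    fix u v assume u: "u \<in> invariants_Z S" and v: "v \<in> invariants_Z S"
      and eq: "cls (monomial u {}) = cls (monomial v {})"
    have "monomial u {} \<in> Z" "monomial v {} \<in> Z"
      using invariant_cocycle[OF K mem] u v by auto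
    then obtain c where c: "c \<in> C" "monomial v {} = monomial u {} + d c"
      using cls_eq_iff[of "monomial u {}" "monomial v {}"] eq by auto
    have "degree_part 0 (d c) = 0"
      using degree_part_d[OF c(1), of "- 1"] degree_part_outside[OF c(1), of "- 1"] by (simp add: d_zero)
    then have "d c {} = 0" by (auto simp: degree_part_def dest: fun_cong[of _ _ "{}"])
    then show "u = v" using fun_cong[OF c(2), of "{}"] by (simp add: monomial_def)
  qed
  show "(\<lambda>u. cls (monomial u {})) ` invariants_Z S = HD 0"
  proof (intro equalityI subsetI)
    fix X assume "X \<in> (\<lambda>u. cls (monomial u {})) ` invariants_Z S"
    then show "X \<in> HD 0"
      using invariant_cocycle[OF K mem] function_deg0[OF mem] by (auto intro!: HD_I)
  next
    fix X assume "X \<in> HD 0"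
    then obtain a where a: "a \<in> Z" "a \<in> cochains_deg S 0" "X = cls a" by (rule HD_E)
    have e: "a = monomial (a {}) {}" by (rule deg0_eq_function[OF a(2)])
    have "a {} \<in> RZ" using ZD(1)[OF a(1)] by (simp add: ext_over_def)
    then have "a {} \<in> invariants_Z S"
      using invariant_cocycle[OF K, of "a {}"] a(1) unfolding e[symmetric] by blast
    then show "X \<in> (\<lambda>u. cls (monomial u {})) ` invariants_Z S"
      by (rule image_eqI[rotated]) (simp only: a(3) e[symmetric])
  qed
qed

text \<open>
  In the ghost part, the coefficient of the empty set only involves coefficients of single generators.
  These have ghost number \<open>1\<close> or \<open>-1\<close>, so they are 0 in elements of ghost number 0.
\<close>

lemma bracket_deg0:
  assumes F: "F \<in> brst_deg S 0" and G: "G \<in> brst_deg S 0"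
  shows "bracket F G {} = pbr S (F {}) (G {})"
proof -
  have z: "F {i} = 0" if "i < N" for i
  proof (rule ccontr)
    assume "F {i} \<noteq> 0"
    then have "ghost_number {i} = 0" using F by (simp add: brst_deg_iff homog_def)
    moreover have "ghost_number {i} \<noteq> 0" using that by (cases "i < lie_dim S") (auto simp: ghost_number_def)
    ultimately show False by blast
  qed
  have "twist (lderiv (dual i) F) {} p = 0" if "i < N" for i p
    using z[OF dual_less[OF that]] by (simp add: twist_def lderiv_def)
  then have "ghost_part F G {} = 0"
    by (auto simp: ghost_part_def ext_scale_def sum_ext_apply wedge_def fun_eq_iff)
  moreover have "PB F G {} = pbr S (F {}) (G {})"
    by (simp add: ext_product_def)
  ultimately show ?thesis using brst_degD[OF F] by (simp add: bracket_eq)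
qed

text \<open>
  The lifts \<open>\<Phi> a\<close> and \<open>\<Phi> b\<close> restrict to the given invariant functions, so their coefficients of the
  empty set may serve as extensions in the Dirac bracket.
\<close>

lemma dirac_bracket:
  assumes K: "koszul_resolution S" and F: "F \<in> R" and G: "G \<in> R"
    and iF: "restr S F \<in> invariants_Z S" and iG: "restr S G \<in> invariants_Z S"
  shows "cohomology_bracket S \<Phi> (cls (monomial (restr S F) {})) (cls (monomial (restr S G) {})) =
    cls (monomial (restr S (pbr S F G)) {})"
proof -
  let ?a = "monomial (restr S F) {}" and ?b = "monomial (restr S G) {}"
  have a: "?a \<in> Z" "?a \<in> cochains_deg S 0" and b: "?b \<in> Z" "?b \<in> cochains_deg S 0"
    using invariant_cocycle[OF K] function_deg0 restr_mem F G iF iG by auto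
  have deg: "\<Phi> ?a \<in> brst_deg S 0" "\<Phi> ?b \<in> brst_deg S 0"
    using Phi_deg a(2) b(2) by blast+
  have PhiR: "\<Phi> ?a {} \<in> R" "\<Phi> ?b {} \<in> R"
    using ZD(3)[OF a(1)] ZD(3)[OF b(1)] by (simp_all add: ext_over_def)
  have "restr S (\<Phi> ?a {}) = restr S F" "restr S (\<Phi> ?b {}) = restr S G"
    using fun_cong[OF rs_Phi[OF ZD(1)[OF a(1)]], of "{}"] fun_cong[OF rs_Phi[OF ZD(1)[OF b(1)]], of "{}"]
    by (simp_all add: res_def monomial_def)
  then have "restr S (pbr S (\<Phi> ?a {}) (\<Phi> ?b {})) = restr S (pbr S F G)"
    by (intro restr_pbr_cong[OF K F PhiR(1) G PhiR(2) iF _ iG])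
  then have "cochain_bracket ?a ?b {} = restr S (pbr S F G)"
    by (simp add: cochain_bracket_def res_def bracket_deg0[OF deg])
  moreover have "cochain_bracket ?a ?b \<in> cochains_deg S 0"
    using cochain_bracket_deg[OF a(2) b(2)] by simp
  ultimately have "cochain_bracket ?a ?b = monomial (restr S (pbr S F G)) {}"
    using deg0_eq_function[of "cochain_bracket ?a ?b"] by simp
  then show ?thesis using cohomology_bracket_cls[OF a(1) b(1)] by simp
qed

end

theorem corollary3p10p2:
  fixes S :: "('m::{t2_space,second_countable_topology}, 'e::real_normed_vector,
               'k::real_normed_field,
               'g::{t2_space,second_countable_topology}, 'h::real_normed_vector) ham_data"
    and \<Phi> H :: "('m, 'k) ext \<Rightarrow> ('m, 'k) ext"
  assumes "hamiltonian_space S"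
    and "koszul_resolution S"
    and "linear_map (cochains S) (brst S) \<Phi>"
    and "continuous_map (cochain_topology S) (brst_topology S) \<Phi>"
    and "\<And>k. \<Phi> ` cochains_deg S k \<subseteq> brst_deg S k"
    and "linear_map (brst S) (brst S) H"
    and "continuous_map (brst_topology S) (brst_topology S) H"
    and "\<And>k. H ` brst_deg S k \<subseteq> brst_deg S (k - 1)"
    and "\<And>F. F \<in> brst S \<Longrightarrow> res S (brst_diff S F) = ce_diff S (res S F)"
    and "\<And>u. u \<in> cochains S \<Longrightarrow> brst_diff S (\<Phi> u) = \<Phi> (ce_diff S u)"
    and "\<And>u. u \<in> cochains S \<Longrightarrow> res S (\<Phi> u) = u"
    and "\<And>F. F \<in> brst S \<Longrightarrow> F - \<Phi> (res S F) = brst_diff S (H F) + H (brst_diff S F)"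
  shows "graded_poisson_algebra scalar_ring (cohomology S) (cohomology_deg S)
           (cohomology_bracket S \<Phi>) \<and>
         (\<forall>a\<in>cocycles S. \<forall>b\<in>cocycles S.
           cohomology_bracket S \<Phi> (coh_class S a) (coh_class S b) =
             coh_class S (res S (brst_bracket S (\<Phi> a) (\<Phi> b)))) \<and>
         bij_betw (\<lambda>u. coh_class S (cochain0 u)) (invariants_Z S) (cohomology_deg S 0) \<and>
         (\<forall>F\<in>smooth_funs S. \<forall>G\<in>smooth_funs S.
           restr S F \<in> invariants_Z S \<longrightarrow> restr S G \<in> invariants_Z S \<longrightarrow>
           cohomology_bracket S \<Phi> (coh_class S (cochain0 (restr S F)))
             (coh_class S (cochain0 (restr S G))) =
           coh_class S (cochain0 (restr S (pbr S F G))))"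
proof -
  interpret hamiltonian_space S by fact
  interpret brst_contraction S \<Phi> H by unfold_locales (fact assms)+
  show ?thesis
  proof (intro conjI ballI impI; (unfold cochain0_eq_monomial)?)
    show "graded_poisson_algebra scalar_ring (cohomology S) (cohomology_deg S) (cohomology_bracket S \<Phi>)"
      by (rule cohomology_graded_poisson)
    show "bij_betw (\<lambda>u. coh_class S (monomial u {})) (invariants_Z S) (cohomology_deg S 0)"
      by (rule invariants_bij[OF assms(2)])
  next
    fix a b assume "a \<in> cocycles S" "b \<in> cocycles S"
    then show "cohomology_bracket S \<Phi> (coh_class S a) (coh_class S b) =
        coh_class S (res S (brst_bracket S (\<Phi> a) (\<Phi> b)))"
      by (rule cohomology_bracket_cls[unfolded cochain_bracket_def])
  next
    fix F G :: "'m \<Rightarrow> 'k"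
    assume "F \<in> smooth_funs S" "G \<in> smooth_funs S" "restr S F \<in> invariants_Z S" "restr S G \<in> invariants_Z S"
    then show "cohomology_bracket S \<Phi> (coh_class S (monomial (restr S F) {})) (coh_class S (monomial (restr S G) {})) =
        coh_class S (monomial (restr S (pbr S F G)) {})"
      by (rule dirac_bracket[OF assms(2)])
  qed
qed

end
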